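(* The Fueter-Sce-Qian coherent state transform $\tau_m\circ S\circ e^{\frac{\Delta_0}{2}}$ satisfies $$\tau_m\circ S\circ e^{\frac{\Delta_0}{2}}=\gamma_m\,\mathrm{GCK}\circ\partial_{x_0}^{m-1}\circ e^{\frac{\Delta_0}{2}}\qquad\text{on }\ \mathcal{L}^2(\mathbb{R},dx_0)\otimes\mathbb{C}_m,$$ $$\tau_m\circ S\circ e^{\frac{\Delta_0}{2}}=\gamma_m\,U_a\circ\partial_{x_0}^{m-1}=\gamma_m\,\check{R}\circ U_s\circ\partial_{x_0}^{m-1}\qquad\text{on }\ \mathcal{W}^{m-1,2}(\mathbb{R},dx_0)\otimes\mathbb{C}_m,$$ where $\gamma_m=\frac{(-1)^{\frac{1-m}{2}}2^{m-1}}{(m-1)!}\Gamma\left(\frac{m+1}{2}\right)^2$.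
   Context: $m\in\mathbb{N}$. $\mathbb{R}_m$ is the real Clifford algebra with generators $e_1,\dots,e_m$, $e_je_\ell+e_\ell e_j=-2\delta_{j\ell}$; $\mathbb{C}_m=\mathbb{C}\otimes\mathbb{R}_m$. Points of $\mathbb{R}^{m+1}$ are identified with paravectors $x=x_0+\underline{x}$, $\underline{x}=\sum_{j=1}^m x_je_j$; $\overline{x}=x_0-\underline{x}$, $x\overline{x}=|x|^2$, $x^{-1}=\overline{x}/|x|^2$. $\Delta=\sum_{j=0}^m\partial_{x_j}^2$. $e^{\frac{\Delta_0}{2}}$ (with $\Delta_0=\partial_{x_0}^2$) is the heat operator on $\mathcal{L}^2(\mathbb{R},dx_0)\otimes\mathbb{C}_m$: $e^{\frac{\Delta_0}{2}}[f](x_0)=\frac{1}{(2\pi)^{1/2}}\int_{\mathbb{R}}e^{-\frac{(x_0-y)^2}{2}}f(y)\,dy$; its images are real-analytic functions on $\mathbb{R}$ extending to entire functions. $\mathcal{W}^{k,2}(\mathbb{R},dx_0)$ is the Sobolev space of $f\in\mathcal{L}^2(\mathbb{R},dx_0)$ (complex-valued) whose weak derivatives up to order $k$ are in $\mathcal{L}^2$; on it $\partial_{x_0}^{m-1}$ denotes the weak derivative. For a $\mathbb{C}_m$-valued function $f_0$ on $\mathbb{R}$ extending to an entire function: $S[f_0](x)=\sum_{j\ge0}\frac{\underline{x}^j}{j!}f_0^{(j)}(x_0)$ is the slice extension, and $\mathrm{GCK}[f_0]$ is the unique axially monogenic function of the form $\sum_{j\ge0}\underline{x}^jf_j(x_0)$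 on $\mathbb{R}^{m+1}$ whose restriction to $\underline{x}=0$ is $f_0$; here axially monogenic means real-analytic with $(\partial_{x_0}+\sum_je_j\partial_{x_j})F=0$ and $F=A(x_0,|\underline{x}|)+\frac{\underline{x}}{|\underline{x}|}B(x_0,|\underline{x}|)$, $A$ even and $B$ odd in the second variable. The dual Radon transform is $\check{R}[f](x_0,\underline{x})=\frac{1}{\sigma_m}\int_{\mathbb{S}^{m-1}}f(x_0,\langle\underline{x},\underline{\omega}\rangle\underline{\omega})\,dS_{\underline{\omega}}$, where $\mathbb{S}^{m-1}$ is the unit sphere in $\mathbb{R}^m$ and $\sigma_m=\frac{2\pi^{m/2}}{\Gamma(m/2)}$ its area. The slice monogenic and axial monogenic coherent state transforms are $U_s=S\circ e^{\frac{\Delta_0}{2}}$ and $U_a=\mathrm{GCK}\circ e^{\frac{\Delta_0}{2}}$ on $\mathcal{L}^2(\mathbb{R},dx_0)\otimes\mathbb{C}_m$. The Fueter-Sce-Qian mapping $\tau_m$ on slice extensions of entire functions: for $f_0(x_0)=\sum_{\ell\ge0}x_0^\ell a_\ell$, $a_\ell\in\mathbb{C}_m$, one has $S[f_0](x)=\sum_\ell x^\ell a_\ell$ and $\tau_m[S[f_0]]=\sum_\ell\tau_m[x^\ell]\,a_\ell$. By definition $\tau_m[x^\ell]=0$ for $0\le\ell\le m-2$ and $\tau_m[x^\ell]=I\left[\Delta^{\frac{m-1}{2}}[x^{-\ell+m-2}]\right]$ for $\ell\ge m-1$, where $I[f](x)=\frac{\overline{x}}{|x|^{m+1}}f\left(\frac{\overline{x}}{|x|^2}\right)$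 is the Kelvin inversion and the (possibly fractional) power of $\Delta$ is given by the Fourier multiplier $(-\Delta)^{\frac{m-1}{2}}=\mathcal{F}^{-1}(2\pi|\cdot|)^{m-1}\mathcal{F}$. It is a known fact that $(-\Delta)^{\frac{m-1}{2}}[x^{-k}]=P^{(-k)}(x):=\frac{(-1)^{k-1}\lambda_m}{(k-1)!}\partial_{x_0}^{k-1}\left[\frac{\overline{x}}{|x|^{m+1}}\right]$ for $k\ge1$, with $\lambda_m=2^{m-1}\Gamma\left(\frac{m+1}{2}\right)^2$, and this gives it meaning here; so, with $P^{(k-1)}:=I[P^{(-k)}]$, $\tau_m[x^\ell]=(-1)^{\frac{1-m}{2}}P^{(\ell+1-m)}(x)$ for $\ell\ge m-1$. Here $(-1)^{\frac{1-m}{2}}$ is one fixed value (e.g. $e^{i\pi(1-m)/2}$), the same throughout. For $m$ odd, $\tau_m$ coincides with the pointwise operator $\Delta^{\frac{m-1}{2}}$. *)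

theory Defs
  imports "HOL-Analysis.Analysis"
begin

section \<open>The complex Clifford algebra\<close>

text \<open>
  The index type \<^typ>\<open>'n\<close> of the generators is finite and linearly ordered, and the dimension
  \<open>m\<close> is \<open>CARD('n)\<close>.  An element is the family of its complex coordinates with respect to the
  basis \<open>e_A = e_{i_1} \<dots> e_{i_k}\<close> for \<open>A = {i_1 < \<dots> < i_k}\<close>.
\<close>

typedef 'n cliff = "UNIV :: (complex ^ ('n::finite) set) set"
  morphisms cvec Cliff ..

setup_lifting type_definition_cliff

lift_definition coef :: "'n::finite cliff \<Rightarrow> 'n set \<Rightarrow> complex" is "\<lambda>u A. u $ A" .

lift_definition cscale :: "complex \<Rightarrow> 'n::finite cliff \<Rightarrow> 'n cliff"  (infixr "*\<^sub>C" 75)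
  is "\<lambda>c u. \<chi> A. c * u $ A" .

instantiation cliff :: (finite) real_vector
begin

lift_definition zero_cliff :: "'a cliff" is 0 .
lift_definition plus_cliff :: "'a cliff \<Rightarrow> 'a cliff \<Rightarrow> 'a cliff" is "(+)" .
lift_definition minus_cliff :: "'a cliff \<Rightarrow> 'a cliff \<Rightarrow> 'a cliff" is "(-)" .
lift_definition uminus_cliff :: "'a cliff \<Rightarrow> 'a cliff" is "uminus" .
lift_definition scaleR_cliff :: "real \<Rightarrow> 'a cliff \<Rightarrow> 'a cliff" is "(*\<^sub>R)" .

instance
  by standard (transfer; simp add: algebra_simps)+

end

instantiation cliff :: (finite) euclidean_space
begin

lift_definition inner_cliff :: "'a cliff \<Rightarrow> 'a cliff \<Rightarrow> real" is "inner" .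
lift_definition norm_cliff :: "'a cliff \<Rightarrow> real" is "norm" .
lift_definition Basis_cliff :: "'a cliff set" is "Basis" .

definition sgn_cliff :: "'a cliff \<Rightarrow> 'a cliff" where
  "sgn_cliff u = u /\<^sub>R norm u"
definition dist_cliff :: "'a cliff \<Rightarrow> 'a cliff \<Rightarrow> real" where
  "dist_cliff u v = norm (u - v)"
definition uniformity_cliff :: "('a cliff \<times> 'a cliff) filter" where
  "uniformity_cliff = (INF e\<in>{0<..}. principal {(u, v). dist u v < e})"
definition open_cliff :: "'a cliff set \<Rightarrow> bool" where
  "open_cliff U \<longleftrightarrow> (\<forall>u\<in>U. eventually (\<lambda>(u', v). u' = u \<longrightarrow> v \<in> U) uniformity)"

instance
proof
  fix u v w :: "'a cliff" and r :: real
  show "dist u v = norm (u - v)" by (rule dist_cliff_def)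
  show "sgn u = u /\<^sub>R norm u" by (rule sgn_cliff_def)
  show "uniformity = (INF e\<in>{0<..}. principal {(u, v :: 'a cliff). dist u v < e})"
    by (rule uniformity_cliff_def)
  show "open U \<longleftrightarrow> (\<forall>u\<in>U. eventually (\<lambda>(u', v). u' = u \<longrightarrow> v \<in> U) uniformity)"
    for U :: "'a cliff set" by (rule open_cliff_def)
  show "inner u v = inner v u" by transfer (rule inner_commute)
  show "inner (u + v) w = inner u w + inner v w" by transfer (rule inner_add_left)
  show "inner (r *\<^sub>R u) v = r * inner u v" by transfer simp
  show "0 \<le> inner u u" by transfer simp
  show "inner u u = 0 \<longleftrightarrow> u = 0" by transfer simp
  show "norm u = sqrt (inner u u)" by transfer (rule norm_eq_sqrt_inner)
  show "(Basis :: 'a cliff set) \<noteq> {}" by transfer simp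
  show "finite (Basis :: 'a cliff set)" by transfer simp
  show "u \<in> Basis \<Longrightarrow> v \<in> Basis \<Longrightarrow> inner u v = (if u = v then 1 else 0)"
    by transfer (rule inner_Basis)
  show "(\<forall>v\<in>Basis. inner u v = 0) \<longleftrightarrow> u = 0"
    by transfer (rule euclidean_all_zero_iff)
qed

end

lemma cliff_eqI: "(\<And>A. coef u A = coef v A) \<Longrightarrow> u = v"
  by transfer (simp add: vec_eq_iff)

lemma coef_simps [simp]:
  "coef 0 A = 0" "coef (u + v) A = coef u A + coef v A" "coef (u - v) A = coef u A - coef v A"
  "coef (- u) A = - coef u A" "coef (r *\<^sub>R u) A = r *\<^sub>R coef u A" "coef (c *\<^sub>C u) A = c * coef u A"
  by (transfer; simp)+

text \<open>
  Reordering \<open>e_A e_B\<close> takes one transposition for each \<open>(i, j) \<in> A \<times> B\<close> with \<open>j < i\<close>, and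
  each common index contributes \<open>e_i e_i = -1\<close>; hence \<open>e_A e_B = csign A B e_{sym_diff A B}\<close>.
\<close>

definition csign :: "'n::{finite,linorder} set \<Rightarrow> 'n set \<Rightarrow> complex" where
  "csign A B = (\<Prod>i\<in>A. \<Prod>j\<in>B. if j \<le> i then -1 else 1)"

lemma prod_sym_diff:
  fixes f :: "'n::finite \<Rightarrow> complex"
  assumes "\<And>i. f i * f i = 1"
  shows "prod f (sym_diff A B) = prod f A * prod f B"
proof -
  have A: "prod f A = prod f (A - B) * prod f (A \<inter> B)"
    by (subst prod.union_disjoint [symmetric]) (auto intro: prod.cong)
  have B: "prod f B = prod f (B - A) * prod f (A \<inter> B)"
    by (subst prod.union_disjoint [symmetric]) (auto intro: prod.cong)
  have AB: "prod f (sym_diff A B) = prod f (A - B) * prod f (B - A)"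
    by (rule prod.union_disjoint) auto
  have "prod f (A \<inter> B) * prod f (A \<inter> B) = 1"
    by (simp add: prod.distrib [symmetric] assms)
  then show ?thesis unfolding A B AB by (simp add: algebra_simps)
qed

lemma csign_sym_diff_left: "csign (sym_diff A B) C = csign A C * csign B C"
  unfolding csign_def by (rule prod_sym_diff) (auto simp: prod.distrib [symmetric] intro!: prod.neutral)

lemma csign_sym_diff_right: "csign A (sym_diff B C) = csign A B * csign A C"
  unfolding csign_def prod.distrib [symmetric] by (intro prod.cong prod_sym_diff) auto

instantiation cliff :: ("{finite,linorder}") real_algebra_1
begin

lift_definition one_cliff :: "'a cliff" is "\<chi> A. if A = {} then 1 else 0" .

text \<open>For fixed \<open>A\<close> and \<open>C\<close>, the only \<open>B\<close> with \<open>sym_diff A B = C\<close> is \<open>sym_diff A C\<close>.\<close>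

lift_definition times_cliff :: "'a cliff \<Rightarrow> 'a cliff \<Rightarrow> 'a cliff" is
  "\<lambda>u v. \<chi> C. \<Sum>A\<in>UNIV. csign A (sym_diff A C) * u $ A * v $ (sym_diff A C)" .

lemma coef_times:
  "coef (u * v) C = (\<Sum>A\<in>UNIV. csign A (sym_diff A C) * coef u A * coef v (sym_diff A C))"
  for u v :: "'a cliff"
  by transfer simp

lemma coef_one: "coef (1 :: 'a cliff) A = (if A = {} then 1 else 0)"
  by transfer simp

instance
proof
  fix u v w :: "'a cliff" and r :: real
  show "u * v * w = u * (v * w)"
  proof (rule cliff_eqI)
    fix D :: "'a set"
    have "coef (u * v * w) D =
      (\<Sum>A\<in>UNIV. \<Sum>E\<in>UNIV. csign E (sym_diff E A) * csign A (sym_diff A D) *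
         coef u E * coef v (sym_diff E A) * coef w (sym_diff A D))"
      by (simp add: coef_times sum_distrib_left sum_distrib_right mult_ac)
    also have "\<dots> = (\<Sum>E\<in>UNIV. \<Sum>A\<in>UNIV. csign E (sym_diff E A) * csign A (sym_diff A D) *
         coef u E * coef v (sym_diff E A) * coef w (sym_diff A D))"
      by (rule sum.swap)
    also have "\<dots> = (\<Sum>E\<in>UNIV. \<Sum>G\<in>UNIV.
         csign E (sym_diff E D) * csign G (sym_diff G (sym_diff E D)) *
         coef u E * coef v G * coef w (sym_diff G (sym_diff E D)))"
    proof (rule sum.cong [OF refl])
      fix E :: "'a set"
      have inv: "sym_diff E (sym_diff E A) = A" for A by blast
      have "csign E (sym_diff E A) * csign A (sym_diff A D) =
            csign E (sym_diff E D) * csign (sym_diff E A) (sym_diff A D)" for A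
      proof -
        have "csign E (sym_diff E D) = csign E (sym_diff E A) * csign E (sym_diff A D)"
          by (subst csign_sym_diff_right [symmetric]) (rule arg_cong [where f = "csign E"], blast)
        moreover have "csign A (sym_diff A D) =
            csign E (sym_diff A D) * csign (sym_diff E A) (sym_diff A D)"
          by (subst csign_sym_diff_left [symmetric]) (simp only: inv)
        ultimately show ?thesis by simp
      qed
      moreover have "sym_diff (sym_diff E A) (sym_diff E D) = sym_diff A D" for A by blast
      moreover define g where "g = (\<lambda>G. csign E (sym_diff E D) * csign G (sym_diff G (sym_diff E D)) *
           coef u E * coef v G * coef w (sym_diff G (sym_diff E D)))"
      moreover have "(\<Sum>A\<in>UNIV. g (sym_diff E A)) = (\<Sum>G\<in>UNIV. g G)"
        by (rule sum.reindex_bij_betw, rule bij_betwI [where g = "sym_diff E"]) (simp_all only: inv, auto)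
      ultimately show "(\<Sum>A\<in>UNIV. csign E (sym_diff E A) * csign A (sym_diff A D) *
           coef u E * coef v (sym_diff E A) * coef w (sym_diff A D)) = (\<Sum>G\<in>UNIV.
           csign E (sym_diff E D) * csign G (sym_diff G (sym_diff E D)) *
           coef u E * coef v G * coef w (sym_diff G (sym_diff E D)))"
        by simp
    qed
    also have "\<dots> = coef (u * (v * w)) D"
      by (simp add: coef_times sum_distrib_left sum_distrib_right mult_ac)
    finally show "coef (u * v * w) D = coef (u * (v * w)) D" .
  qed
  show "1 * u = u"
  proof (rule cliff_eqI)
    fix C :: "'a set"
    have "coef (1 * u) C = (\<Sum>A\<in>(UNIV :: 'a set set). if A = {} then coef u C else 0)"
      unfolding coef_times coef_one by (rule sum.cong [OF refl]) (auto simp: csign_def)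
    then show "coef (1 * u) C = coef u C" by simp
  qed
  show "u * 1 = u"
  proof (rule cliff_eqI)
    fix C :: "'a set"
    have "coef (u * 1) C = (\<Sum>A\<in>UNIV. if A = C then coef u C else 0)"
      unfolding coef_times coef_one
      by (rule sum.cong [OF refl], subst mult.assoc) (auto simp: csign_def)
    then show "coef (u * 1) C = coef u C" by simp
  qed
  show "(u + v) * w = u * w + v * w" "u * (v + w) = u * v + u * w"
    "r *\<^sub>R u * v = r *\<^sub>R (u * v)" "u * r *\<^sub>R v = r *\<^sub>R (u * v)"
    by (rule cliff_eqI; simp add: coef_times algebra_simps sum.distrib scaleR_sum_right)+
  show "(0 :: 'a cliff) \<noteq> 1"
    by (metis coef_one coef_simps(1) zero_neq_one)
qed

end

definition gen :: "'n::{finite,linorder} \<Rightarrow> 'n cliff" where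
  "gen j = Cliff (\<chi> A. if A = {j} then 1 else 0)"

lemma gen_anticommute: "gen i * gen j + gen j * gen i = (if i = j then -2 else 0)"
proof (rule cliff_eqI)
  have coef_gen: "coef (gen k) A = (if A = {k} then 1 else 0)" for k :: 'a and A
    by (simp add: gen_def coef.abs_eq)
  have gg: "coef (gen k * gen l) C =
      (if sym_diff {k} {l} = C then if l \<le> k then -1 else 1 else 0)" for k l :: 'a and C
  proof -
    have "coef (gen k * gen l) C =
      (\<Sum>A\<in>UNIV. if A = {k} then csign {k} (sym_diff {k} C) * (if sym_diff {k} C = {l} then 1 else 0) else 0)"
      unfolding coef_times coef_gen by (rule sum.cong [OF refl]) auto
    also have "\<dots> = (if sym_diff {k} C = {l} then csign {k} {l} else 0)" by simp
    finally have "coef (gen k * gen l) C = (if sym_diff {k} C = {l} then csign {k} {l} else 0)" .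
    moreover have "sym_diff {k} C = {l} \<longleftrightarrow> sym_diff {k} {l} = C" by blast
    ultimately show ?thesis by (simp only: csign_def) simp
  qed
  have "(2 :: 'a cliff) = 1 + 1" by simp
  then have two: "coef (2 :: 'a cliff) A = (if A = {} then 2 else 0)" for A
    by (simp only: coef_simps coef_one) simp
  have comm: "{j, i} = {i, j}" by blast
  show "coef (gen i * gen j + gen j * gen i) C = coef (if i = j then -2 else 0) C" for C
  proof (cases "i = j")
    case True
    then show ?thesis by (simp add: two gg)
  next
    case False
    then show ?thesis by (cases "i < j") (auto simp: gg comm)
  qed
qed

section \<open>Paravectors\<close>

text \<open>The point \<open>x = x_0 + x_1 e_1 + \<dots> + x_m e_m\<close> is the pair \<open>(x_0, (x_1, \<dots>, x_m))\<close>.\<close>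

type_synonym 'n para = "real \<times> (real, 'n) vec"

definition vecpart :: "(real, 'n::{finite,linorder}) vec \<Rightarrow> 'n cliff" where
  "vecpart v = (\<Sum>j\<in>UNIV. v $ j *\<^sub>R gen j)"

definition para :: "'n::{finite,linorder} para \<Rightarrow> 'n cliff" where
  "para x = of_real (fst x) + vecpart (snd x)"

definition pconj :: "'n::finite para \<Rightarrow> 'n para" where
  "pconj x = (fst x, - snd x)"

section \<open>Function spaces and the heat operator\<close>

text \<open>Elements of Lebesgue and Sobolev spaces are represented by functions; nothing is
  identified almost everywhere.\<close>

definition L2 :: "(real \<Rightarrow> complex) set" where
  "L2 = {f \<in> borel_measurable lborel. integrable lborel (\<lambda>t. (cmod (f t))\<^sup>2)}"

definition test_function :: "(real \<Rightarrow> real) \<Rightarrow> bool" where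
  "test_function \<phi> \<longleftrightarrow>
     (\<forall>k t. (deriv ^^ k) \<phi> field_differentiable at t) \<and> compact (closure {t. \<phi> t \<noteq> 0})"

definition weak_deriv :: "nat \<Rightarrow> (real \<Rightarrow> complex) \<Rightarrow> (real \<Rightarrow> complex) \<Rightarrow> bool" where
  "weak_deriv k f g \<longleftrightarrow> (\<forall>\<phi>. test_function \<phi> \<longrightarrow>
     (\<integral>t. (deriv ^^ k) \<phi> t *\<^sub>R f t \<partial>lborel) = (-1) ^ k * (\<integral>t. \<phi> t *\<^sub>R g t \<partial>lborel))"

definition sobolev :: "nat \<Rightarrow> (real \<Rightarrow> complex) set" where
  "sobolev k = {f \<in> L2. \<forall>j\<le>k. \<exists>g\<in>L2. weak_deriv j f g}"

text \<open>The algebra is finite-dimensional, so tensoring with it amounts to imposing the condition on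
  every coordinate.\<close>

definition tensor_cliff :: "(real \<Rightarrow> complex) set \<Rightarrow> (real \<Rightarrow> 'n::finite cliff) set" where
  "tensor_cliff X = {f. \<forall>A. (\<lambda>t. coef (f t) A) \<in> X}"

definition weak_deriv_cliff ::
    "nat \<Rightarrow> (real \<Rightarrow> 'n::finite cliff) \<Rightarrow> (real \<Rightarrow> 'n cliff) \<Rightarrow> bool" where
  "weak_deriv_cliff k f g \<longleftrightarrow> (\<forall>A. weak_deriv k (\<lambda>t. coef (f t) A) (\<lambda>t. coef (g t) A))"

definition heat :: "(real \<Rightarrow> 'n::finite cliff) \<Rightarrow> real \<Rightarrow> 'n cliff" where
  "heat f s = (1 / sqrt (2 * pi)) *\<^sub>R (\<integral>y. exp (- ((s - y)\<^sup>2 / 2)) *\<^sub>R f y \<partial>lborel)"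

definition nderiv :: "nat \<Rightarrow> (real \<Rightarrow> 'a::real_normed_vector) \<Rightarrow> real \<Rightarrow> 'a" where
  "nderiv j = (\<lambda>f t. vector_derivative f (at t)) ^^ j"

section \<open>Slice extension and generalized CK extension\<close>

definition slice_ext :: "(real \<Rightarrow> 'n::{finite,linorder} cliff) \<Rightarrow> 'n para \<Rightarrow> 'n cliff" where
  "slice_ext f0 x = (\<Sum>j. (vecpart (snd x) ^ j /\<^sub>R fact j) * nderiv j f0 (fst x))"

definition partial ::
    "'a::real_normed_vector \<Rightarrow> ('a \<Rightarrow> 'b::real_normed_vector) \<Rightarrow> 'a \<Rightarrow> 'b" where
  "partial b F x = vector_derivative (\<lambda>t. F (x + t *\<^sub>R b)) (at 0)"

text \<open>The sum runs over the multi-indices \<open>\<alpha>\<close> on the coordinates.\<close>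

definition real_analytic :: "('a::euclidean_space \<Rightarrow> 'b::real_normed_vector) \<Rightarrow> bool" where
  "real_analytic F \<longleftrightarrow> (\<forall>a. \<exists>r>0. \<exists>c. \<forall>h. norm h < r \<longrightarrow>
     ((\<lambda>\<alpha>::'a \<Rightarrow> nat. (\<Prod>b\<in>Basis. (h \<bullet> b) ^ \<alpha> b) *\<^sub>R c \<alpha>) has_sum F (a + h))
       (Basis \<rightarrow>\<^sub>E UNIV))"

definition monogenic :: "('n::{finite,linorder} para \<Rightarrow> 'n cliff) \<Rightarrow> bool" where
  "monogenic F \<longleftrightarrow>
     (\<forall>x. partial (1, 0) F x + (\<Sum>j\<in>UNIV. gen j * partial (0, axis j 1) F x) = 0)"

text \<open>At \<open>v = 0\<close> the second summand vanishes, in accordance with \<open>B\<close> being odd.\<close>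

definition axial :: "('n::{finite,linorder} para \<Rightarrow> 'n cliff) \<Rightarrow> bool" where
  "axial F \<longleftrightarrow> (\<exists>A B :: real \<Rightarrow> real \<Rightarrow> 'n cliff.
     (\<forall>s r. A s (- r) = A s r \<and> B s (- r) = - B s r) \<and>
     (\<forall>s v. F (s, v) = A s (norm v) + (vecpart v /\<^sub>R norm v) * B s (norm v)))"

definition axially_monogenic :: "('n::{finite,linorder} para \<Rightarrow> 'n cliff) \<Rightarrow> bool" where
  "axially_monogenic F \<longleftrightarrow> real_analytic F \<and> monogenic F \<and> axial F"

definition GCK :: "(real \<Rightarrow> 'n::{finite,linorder} cliff) \<Rightarrow> 'n para \<Rightarrow> 'n cliff" where
  "GCK f0 = (THE F. axially_monogenic F \<and>
     (\<exists>c :: nat \<Rightarrow> real \<Rightarrow> 'n cliff.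
        \<forall>x. (\<lambda>j. vecpart (snd x) ^ j * c j (fst x)) sums F x) \<and>
     (\<forall>s. F (s, 0) = f0 s))"

definition U_s :: "(real \<Rightarrow> 'n::{finite,linorder} cliff) \<Rightarrow> 'n para \<Rightarrow> 'n cliff" where
  "U_s f = slice_ext (heat f)"

definition U_a :: "(real \<Rightarrow> 'n::{finite,linorder} cliff) \<Rightarrow> 'n para \<Rightarrow> 'n cliff" where
  "U_a f = GCK (heat f)"

section \<open>The dual Radon transform\<close>

text \<open>
  Surface measure on the unit sphere: the measure of \<open>E\<close> is \<open>m\<close> times the Lebesgue measure of the
  cone \<open>{r \<omega> | 0 < r < 1, \<omega> \<in> E}\<close>, which is what integration in polar coordinates
  \<open>dx = r^{m-1} dr dS\<close> requires.  For \<open>m = 1\<close> this is the counting measure on \<open>{-1, 1}\<close>.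
\<close>

definition sphere_measure :: "(real ^ 'n::finite) measure" where
  "sphere_measure =
     scale_measure (of_nat CARD('n)) (distr (restrict_space lborel (ball 0 1 - {0})) borel sgn)"

definition sphere_area :: "nat \<Rightarrow> real" where
  "sphere_area m = 2 * pi powr (real m / 2) / Gamma (real m / 2)"

lemma measure_sphere_measure:
  "measure (sphere_measure :: (real ^ 'n::finite) measure) UNIV = sphere_area CARD('n)"
proof -
  have sgn: "sgn \<in> restrict_space lborel (ball 0 1 - {0}) \<rightarrow>\<^sub>M (borel :: (real ^ 'n) measure)"
    unfolding sgn_div_norm by (intro measurable_restrict_space1) measurable
  have "measure (distr (restrict_space lborel (ball 0 1 - {0})) borel sgn) (UNIV :: (real ^ 'n) set)
      = measure lborel (ball 0 1 - {0} :: (real ^ 'n) set)"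
    by (subst measure_distr [OF sgn]) (simp_all add: measure_restrict_space space_restrict_space)
  also have "\<dots> = measure lborel (ball 0 1 :: (real ^ 'n) set)"
    by (rule measure_Diff_null_set) auto
  also have "\<dots> = unit_ball_vol (real CARD('n))"
    using content_ball [of 1 "0 :: real ^ 'n"] by simp
  finally have "measure (sphere_measure :: (real ^ 'n) measure) UNIV
      = real CARD('n) * unit_ball_vol (real CARD('n))"
    by (simp add: sphere_measure_def measure_def enn2real_mult)
  moreover have "Gamma (real CARD('n) / 2 + 1) = real CARD('n) / 2 * Gamma (real CARD('n) / 2)"
    by (rule Gamma_plus1) auto
  ultimately show ?thesis
    unfolding sphere_area_def unit_ball_vol_def by simp
qed

definition dual_radon :: "('n::finite para \<Rightarrow> 'n cliff) \<Rightarrow> 'n para \<Rightarrow> 'n cliff" where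
  "dual_radon F x = (1 / sphere_area CARD('n)) *\<^sub>R
     (\<integral>\<omega>. F (fst x, (snd x \<bullet> \<omega>) *\<^sub>R \<omega>) \<partial>sphere_measure)"

section \<open>The Fueter-Sce-Qian mapping\<close>

definition lambda_const :: "nat \<Rightarrow> real" where
  "lambda_const m = 2 ^ (m - 1) * (Gamma ((real m + 1) / 2))\<^sup>2"

text \<open>\<open>P_neg k\<close>, for \<open>k \<ge> 1\<close>, is the function \<open>P^{(-k)}\<close>, which is the meaning given to
  \<open>(-\<Delta>)^{(m-1)/2} [x^{-k}]\<close>.\<close>

definition P_neg :: "nat \<Rightarrow> 'n::{finite,linorder} para \<Rightarrow> 'n cliff" where
  "P_neg k x = ((-1) ^ (k - 1) * lambda_const CARD('n) / fact (k - 1)) *\<^sub>R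
     (partial (1, 0) ^^ (k - 1)) (\<lambda>y. para (pconj y) /\<^sub>R norm y ^ (CARD('n) + 1)) x"

definition kelvin ::
    "('n::{finite,linorder} para \<Rightarrow> 'n cliff) \<Rightarrow> 'n para \<Rightarrow> 'n cliff" where
  "kelvin F x = (para (pconj x) /\<^sub>R norm x ^ (CARD('n) + 1)) * F (pconj x /\<^sub>R (norm x)\<^sup>2)"

text \<open>The Kelvin inversion is undefined at the origin; \<open>P_pos n\<close>, which is \<open>P^{(n)} = I[P^{(-(n+1))}]\<close>,
  is a polynomial and takes its limit there.\<close>

definition P_pos :: "nat \<Rightarrow> 'n::{finite,linorder} para \<Rightarrow> 'n cliff" where
  "P_pos n x = (if x = 0 then Lim (at 0) (kelvin (P_neg (n + 1))) else kelvin (P_neg (n + 1)) x)"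

text \<open>The principal value \<open>exp (i \<pi> (1 - m) / 2)\<close>.\<close>

definition minus_one_power :: "nat \<Rightarrow> complex" where
  "minus_one_power m = (-1) powr of_real ((1 - real m) / 2)"

definition tau_monomial :: "nat \<Rightarrow> 'n::{finite,linorder} para \<Rightarrow> 'n cliff" where
  "tau_monomial l x =
     (if l + 1 < CARD('n) then 0
      else minus_one_power CARD('n) *\<^sub>C P_pos (l + 1 - CARD('n)) x)"

text \<open>The coefficients \<open>a_l\<close> are unique (restrict to the real axis); they exist exactly when \<open>F\<close> is the
  slice extension \<open>\<Sum>l. x^l a_l\<close> of an entire function \<open>\<Sum>l. x_0^l a_l\<close>, and \<open>tau F\<close> is meaningful only
  then.\<close>

definition tau :: "('n::{finite,linorder} para \<Rightarrow> 'n cliff) \<Rightarrow> 'n para \<Rightarrow> 'n cliff" where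
  "tau F x =
     (let a = (THE a :: nat \<Rightarrow> 'n cliff. \<forall>y. (\<lambda>l. para y ^ l * a l) sums F y)
      in \<Sum>l. tau_monomial l x * a l)"

definition gamma_const :: "nat \<Rightarrow> complex" where
  "gamma_const m =
     minus_one_power m * 2 ^ (m - 1) / fact (m - 1) * of_real ((Gamma ((real m + 1) / 2))\<^sup>2)"

end

theory Submission
  imports Defs "HOL-Probability.Distributions"
begin

text \<open>
  Write \<open>m\<close> for the number of generators, \<open>s\<close> for the real part and \<open>v\<close> for the vector part of a
  paravector.  All transforms in the theorem act on functions \<open>\<Sum>n. s ^ n a_n\<close> with Clifford-valued
  \<open>a_n\<close>, and each of them is determined by what it does to a power of the variable.  Such a series
  exists for \<open>heat f\<close>, because the heat kernel has an expansion in Hermite functions which may be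
  integrated against \<open>f\<close> term by term (\<open>heat_eq_pseries\<close>).

  The extension \<open>GCK\<close>.  The Dirac operator \<open>\<Sum>j. e_j \<partial>_j\<close> sends \<open>v ^ j\<close> to \<open>- \<beta>_j v ^ (j - 1)\<close> with
  \<open>\<beta>_j = j\<close> for even \<open>j\<close> and \<open>\<beta>_j = j - 1 + m\<close> for odd \<open>j\<close> (\<open>dirac_vecpart_series\<close>).  Hence
  \<open>\<Sum>j. v ^ j c_j(s)\<close> is monogenic precisely when \<open>\<beta>_(j + 1) c_(j + 1)\<close> is the derivative of \<open>c_j\<close>, so
  that \<open>c_0\<close> determines everything: \<open>c_j\<close> is the \<open>j\<close>-th derivative of \<open>c_0\<close> divided by
  \<open>\<beta>_1 \<dots> \<beta>_j\<close>.  Thus \<open>GCK\<close> maps \<open>s ^ n\<close> to an explicit polynomial \<open>ck_poly n\<close>, and power series to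
  the corresponding series (\<open>GCK_pseries\<close>).

  The mapping \<open>tau\<close>.  On the plane spanned by \<open>1\<close> and a unit vector everything takes place in a copy of
  the complex numbers.  There the derivatives of the Cauchy kernel are found by induction, and their
  Kelvin transforms turn out to be \<open>P_pos n = \<lambda>_m (n + m - 1 choose n) ck_poly n\<close> (\<open>P_pos_eq\<close>).  For
  \<open>l = n + m - 1\<close> the binomial coefficient is the factor \<open>l! / n!\<close> produced by \<open>m - 1\<close>
  differentiations of \<open>s ^ l\<close>, divided by \<open>(m - 1)!\<close>.  Comparing coefficients gives the first
  identity (\<open>tau_slice_ext\<close>).

  The weak derivative.  The coefficients of \<open>heat g\<close> are integrals of \<open>g\<close> against Hermite functions,
  which are derivatives of a Gaussian.  If \<open>g\<close> is a weak derivative of \<open>f\<close>, moving the derivative to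
  the Gaussian shifts the index of the Hermite function.  So \<open>heat g\<close> is the derivative of \<open>heat f\<close>
  (\<open>heat_weak_deriv\<close>), which is the second identity.

  The dual Radon transform.  On the slice extension it averages \<open>(<v, \<omega>> \<omega>) ^ j\<close> over the unit sphere.
  Rotation invariance of the surface measure and differentiation with respect to \<open>v\<close> yield a recurrence
  for the moments of the sphere, by which the average is \<open>j! / (\<beta>_1 \<dots> \<beta>_j) v ^ j\<close>
  (\<open>integral_vecpart_power\<close>).  This is exactly the change from the slice extension to \<open>GCK\<close>
  (\<open>dual_radon_slice_ext\<close>), and the third identity follows.
\<close>

section \<open>The Clifford algebra as a normed algebra\<close>

text \<open>
  The Euclidean norm of the coordinates is not submultiplicative: \<open>u = 1 + \<i> e_1\<close> satisfies
  \<open>u\<^sup>2 = 2 u\<close> and has norm \<open>sqrt 2\<close>.  The sum of the absolute values is an equivalent norm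
  which is submultiplicative; products are estimated in it.
\<close>

definition cnorm1 :: "'n::finite cliff \<Rightarrow> real" where
  "cnorm1 u = (\<Sum>A\<in>UNIV. cmod (coef u A))"

lemma norm_coef_le: "cmod (coef u A) \<le> norm u"
  by transfer (rule Finite_Cartesian_Product.norm_nth_le)

lemma norm_le_cnorm1: "norm u \<le> cnorm1 u"
  unfolding cnorm1_def by transfer (simp add: norm_vec_def L2_set_le_sum)

lemma cnorm1_nonneg [simp]: "0 \<le> cnorm1 u"
  by (simp add: cnorm1_def sum_nonneg)

lemma cnorm1_zero [simp]: "cnorm1 0 = 0"
  by (simp add: cnorm1_def)

lemma cnorm1_add: "cnorm1 (u + v) \<le> cnorm1 u + cnorm1 v"
  by (simp add: cnorm1_def sum.distrib [symmetric] sum_mono norm_triangle_ineq)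

lemma cnorm1_sum: "cnorm1 (sum f A) \<le> (\<Sum>i\<in>A. cnorm1 (f i))"
proof (induction A rule: infinite_finite_induct)
  case (insert x F)
  then show ?case using cnorm1_add [of "f x" "sum f F"] by simp
qed simp_all

lemma cnorm1_scaleR [simp]: "cnorm1 (r *\<^sub>R u) = \<bar>r\<bar> * cnorm1 u"
  by (simp add: cnorm1_def sum_distrib_left norm_mult)

lemma cnorm1_le_norm: "cnorm1 (u :: 'n::finite cliff) \<le> real CARD('n set) * norm u"
  unfolding cnorm1_def by (rule order_trans [OF sum_bounded_above [OF norm_coef_le]]) simp

lemma cnorm1_times: "cnorm1 (u * v) \<le> cnorm1 u * cnorm1 (v :: 'n::{finite,linorder} cliff)"
proof -
  have sgn1: "cmod (csign A B) = 1" for A B :: "'n set"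
    by (auto simp: csign_def prod_norm [symmetric] intro!: prod.neutral)
  have "cnorm1 (u * v) \<le> (\<Sum>C\<in>UNIV. \<Sum>A\<in>UNIV. cmod (coef u A) * cmod (coef v (sym_diff A C)))"
    unfolding cnorm1_def coef_times
    by (intro sum_mono order_trans [OF norm_sum]) (simp add: norm_mult sgn1)
  also have "\<dots> = (\<Sum>A\<in>UNIV. \<Sum>C\<in>UNIV. cmod (coef u A) * cmod (coef v (sym_diff A C)))"
    by (rule sum.swap)
  also have "\<dots> = (\<Sum>A\<in>UNIV. cmod (coef u A) * cnorm1 v)"
  proof (rule sum.cong [OF refl])
    fix A :: "'n set"
    have "bij_betw (sym_diff A) UNIV UNIV"
      by (rule bij_betwI [where g = "sym_diff A"]) auto
    then have "(\<Sum>C\<in>UNIV. cmod (coef v (sym_diff A C))) = cnorm1 v"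
      unfolding cnorm1_def by (rule sum.reindex_bij_betw)
    then show "(\<Sum>C\<in>UNIV. cmod (coef u A) * cmod (coef v (sym_diff A C))) = cmod (coef u A) * cnorm1 v"
      by (simp add: sum_distrib_left [symmetric])
  qed
  finally show ?thesis by (simp add: cnorm1_def sum_distrib_right)
qed

lemma cnorm1_one [simp]: "cnorm1 (1 :: 'n::{finite,linorder} cliff) = 1"
proof -
  have "cnorm1 (1 :: 'n cliff) = (\<Sum>A\<in>(UNIV :: 'n set set). if A = {} then 1 else 0)"
    unfolding cnorm1_def by (rule sum.cong) (auto simp: coef_one)
  then show ?thesis by simp
qed

lemma cnorm1_of_real [simp]: "cnorm1 (of_real r :: 'n::{finite,linorder} cliff) = \<bar>r\<bar>"
  by (simp add: of_real_def)

lemma cnorm1_gen [simp]: "cnorm1 (gen j) = 1"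
proof -
  have "cnorm1 (gen j) = (\<Sum>A\<in>UNIV. if A = {j} then 1 else 0)"
    unfolding cnorm1_def by (rule sum.cong) (auto simp: gen_def coef.abs_eq)
  then show ?thesis by simp
qed

lemma cnorm1_power: "cnorm1 (u ^ n) \<le> cnorm1 (u :: 'n::{finite,linorder} cliff) ^ n"
proof (induction n)
  case (Suc n)
  have "cnorm1 (u ^ Suc n) \<le> cnorm1 u * cnorm1 (u ^ n)" by (simp add: cnorm1_times)
  also have "\<dots> \<le> cnorm1 u * cnorm1 u ^ n" using Suc by (intro mult_left_mono) simp_all
  finally show ?case by simp
qed simp

lemma bounded_bilinear_times_cliff: "bounded_bilinear ((*) :: 'n::{finite,linorder} cliff \<Rightarrow> _)"
  by (subst bilinear_conv_bounded_bilinear [symmetric])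
    (auto simp: bilinear_def algebra_simps intro!: linearI)

lemmas bounded_linear_times_right_cliff = bounded_bilinear.bounded_linear_right [OF bounded_bilinear_times_cliff]

lemma bounded_linear_cscale: "bounded_linear (\<lambda>u. c *\<^sub>C (u :: 'n::finite cliff))"
  by (intro linear_conv_bounded_linear [THEN iffD1] linearI; rule cliff_eqI)
    (simp_all add: algebra_simps)

lemma bounded_linear_coef: "bounded_linear (\<lambda>u :: 'n::finite cliff. coef u A)"
  by (intro linear_conv_bounded_linear [THEN iffD1] linearI) simp_all

lemma cscale_mult_left: "(c *\<^sub>C u) * v = c *\<^sub>C (u * v)" for u v :: "'n::{finite,linorder} cliff"
  by (rule cliff_eqI) (simp add: coef_times sum_distrib_left mult_ac)

lemma of_real_commute_cliff: "of_real r * u = u * (of_real r :: 'n::{finite,linorder} cliff)"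
  by (simp add: of_real_def)

lemma scaleR_power_cliff: "(t *\<^sub>R u) ^ q = t ^ q *\<^sub>R (u :: 'n::{finite,linorder} cliff) ^ q"
  by (induction q) (simp_all add: mult_ac)

lemma bounded_linear_vecpart: "bounded_linear vecpart"
  unfolding vecpart_def
  by (intro bounded_linear_sum bounded_linear_scaleR_const bounded_linear_vec_nth)

lemmas linear_vecpart = bounded_linear.linear [OF bounded_linear_vecpart]

lemma vecpart_0 [simp]: "vecpart 0 = 0"
  by (simp add: vecpart_def)

lemma vecpart_add: "vecpart (u + v) = vecpart u + vecpart v"
  by (rule linear_add [OF linear_vecpart])

lemma vecpart_scaleR: "vecpart (r *\<^sub>R v) = r *\<^sub>R vecpart v"
  by (rule linear_cmul [OF linear_vecpart])

lemma vecpart_axis: "vecpart (axis j 1) = gen j"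
proof -
  have "vecpart (axis j 1) = (\<Sum>i\<in>UNIV. if i = j then gen i else 0)"
    unfolding vecpart_def by (rule sum.cong) (auto simp: axis_def)
  then show ?thesis by simp
qed

lemma gen_square: "gen j * gen j = - 1"
proof -
  have "2 *\<^sub>R (gen j * gen j) = 2 *\<^sub>R (- 1)"
    using gen_anticommute [of j j] by (simp add: scaleR_2)
  then show ?thesis by (simp only: scaleR_cancel_left) simp
qed

text \<open>
  The mixed products cancel in pairs by anticommutation.
\<close>

lemma vecpart_square: "vecpart v * vecpart v = of_real (- (norm v)\<^sup>2)"
proof -
  define S where "S = (\<Sum>i\<in>UNIV. \<Sum>j\<in>UNIV. (v $ i * v $ j) *\<^sub>R (gen i * gen j))"
  have S: "vecpart v * vecpart v = S"
    by (simp add: S_def vecpart_def sum_product mult.commute)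
  have S': "S = (\<Sum>i\<in>UNIV. \<Sum>j\<in>UNIV. (v $ i * v $ j) *\<^sub>R (gen j * gen i))"
    unfolding S_def by (subst sum.swap) (simp add: mult.commute)
  have "2 *\<^sub>R S = S + S" by (rule scaleR_2)
  also have "\<dots> = (\<Sum>i\<in>UNIV. \<Sum>j\<in>UNIV. (v $ i * v $ j) *\<^sub>R (if i = j then -2 else 0))"
    by (subst (2) S')
      (simp add: S_def sum.distrib [symmetric] scaleR_add_right [symmetric] gen_anticommute)
  also have "\<dots> = (\<Sum>i\<in>UNIV. (v $ i * v $ i) *\<^sub>R (-2))"
  proof (rule sum.cong [OF refl])
    fix i
    have "(\<Sum>j\<in>UNIV. (v $ i * v $ j) *\<^sub>R (if i = j then - 2 else 0)) =
      (\<Sum>j\<in>UNIV. if j = i then (v $ i * v $ i) *\<^sub>R (- 2 :: 'a cliff) else 0)"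
      by (rule sum.cong) auto
    then show "(\<Sum>j\<in>UNIV. (v $ i * v $ j) *\<^sub>R (if i = j then - 2 else 0)) =
      (v $ i * v $ i) *\<^sub>R (- 2 :: 'a cliff)" by simp
  qed
  also have "\<dots> = (\<Sum>i\<in>UNIV. v $ i * v $ i) *\<^sub>R (- 2)"
    by (rule scaleR_sum_left [symmetric])
  also have "(\<Sum>i\<in>UNIV. v $ i * v $ i) = (norm v)\<^sup>2"
    by (simp add: norm_vec_def L2_set_def power2_eq_square sum_nonneg)
  also have "(norm v)\<^sup>2 *\<^sub>R (- 2) = 2 *\<^sub>R (of_real (- (norm v)\<^sup>2) :: 'a cliff)"
  proof -
    have "(2 :: 'a cliff) = 2 *\<^sub>R 1" by (simp add: scaleR_2)
    then show ?thesis by (simp only: of_real_def scaleR_minus_right scaleR_minus_left scaleR_scaleR mult.commute)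
  qed
  finally show ?thesis unfolding S by (simp only: scaleR_cancel_left) simp
qed

lemma vecpart_power_even: "vecpart v ^ (2 * k) = of_real ((- (norm v)\<^sup>2) ^ k)"
  by (simp add: power_mult power2_eq_square [of "vecpart v"] vecpart_square flip: of_real_power of_real_minus)

lemma vecpart_power_odd: "vecpart v ^ Suc (2 * k) = (- (norm v)\<^sup>2) ^ k *\<^sub>R vecpart v"
  by (subst power_Suc2, subst vecpart_power_even) (simp add: of_real_def)

lemma cnorm1_vecpart: "cnorm1 (vecpart v :: 'n::{finite,linorder} cliff) \<le> real CARD('n) * norm v"
proof -
  have "cnorm1 (vecpart v) \<le> (\<Sum>j\<in>UNIV. \<bar>v $ j\<bar>)"
    unfolding vecpart_def by (rule order_trans [OF cnorm1_sum]) simp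
  also have "\<dots> \<le> real CARD('n) * norm v"
    by (rule order_trans [OF sum_bounded_above [of _ _ "norm v"]])
      (use Finite_Cartesian_Product.norm_nth_le [of v] in auto)
  finally show ?thesis .
qed

section \<open>Entire vector-valued power series\<close>

definition entire_coeffs :: "(nat \<Rightarrow> 'b::real_normed_vector) \<Rightarrow> bool" where
  "entire_coeffs a \<longleftrightarrow> (\<forall>R. summable (\<lambda>n. norm (a n) * R ^ n))"

definition pseries :: "(nat \<Rightarrow> 'b::real_normed_vector) \<Rightarrow> real \<Rightarrow> 'b" where
  "pseries a t = (\<Sum>n. t ^ n *\<^sub>R a n)"

text \<open>
  Compare the terms for \<open>R\<close> with the bounded terms for \<open>\<bar>R\<bar> + 1\<close>: the quotient is geometric.
\<close>

lemma entire_coeffs_if_bounded: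
  fixes a :: "nat \<Rightarrow> 'b::real_normed_vector"
  assumes "\<And>R :: real. 0 < R \<Longrightarrow> \<exists>K. \<forall>n. R ^ n * norm (a n) \<le> K"
  shows "entire_coeffs a"
  unfolding entire_coeffs_def
proof
  fix R :: real
  have "0 < \<bar>R\<bar> + 1" by simp
  from assms [OF this] obtain K where K: "\<And>n. (\<bar>R\<bar> + 1) ^ n * norm (a n) \<le> K"
    by blast
  show "summable (\<lambda>n. norm (a n) * R ^ n)"
  proof (rule summable_comparison_test')
    show "summable (\<lambda>n. K * (\<bar>R\<bar> / (\<bar>R\<bar> + 1)) ^ n)"
      by (intro summable_mult summable_geometric) simp
    fix n :: nat
    have "norm (norm (a n) * R ^ n) = ((\<bar>R\<bar> + 1) ^ n * norm (a n)) * (\<bar>R\<bar> / (\<bar>R\<bar> + 1)) ^ n"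
      using abs_ge_zero [of R] by (simp add: power_divide norm_mult power_abs abs_mult del: abs_ge_zero)
    also have "\<dots> \<le> K * (\<bar>R\<bar> / (\<bar>R\<bar> + 1)) ^ n"
      by (intro mult_right_mono K) simp
    finally show "norm (norm (a n) * R ^ n) \<le> K * (\<bar>R\<bar> / (\<bar>R\<bar> + 1)) ^ n" .
  qed
qed

lemma entire_coeffsI:
  fixes a :: "nat \<Rightarrow> 'b::real_normed_vector"
  assumes "\<And>t :: real. summable (\<lambda>n. t ^ n *\<^sub>R a n)"
  shows "entire_coeffs a"
proof (rule entire_coeffs_if_bounded)
  fix R :: real assume "0 < R"
  have "Bseq (\<lambda>n. R ^ n *\<^sub>R a n)"
    by (intro convergent_imp_Bseq convergentI [of _ 0] summable_LIMSEQ_zero assms)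
  then obtain K where "\<And>n. norm (R ^ n *\<^sub>R a n) \<le> K"
    by (auto simp: Bseq_def)
  then show "\<exists>K. \<forall>n. R ^ n * norm (a n) \<le> K" using \<open>0 < R\<close> by auto
qed

lemma entire_coeffs_bounded:
  fixes a :: "nat \<Rightarrow> 'b::real_normed_vector"
  assumes "entire_coeffs a"
  shows "\<exists>K. \<forall>n. R ^ n * norm (a n) \<le> K"
proof -
  have "Bseq (\<lambda>n. norm (a n) * R ^ n)"
    using assms by (intro convergent_imp_Bseq convergentI [of _ 0] summable_LIMSEQ_zero)
      (simp add: entire_coeffs_def)
  then obtain K where "\<And>n. norm (norm (a n) * R ^ n) \<le> K"
    by (auto simp: Bseq_def)
  then have "R ^ n * norm (a n) \<le> K" for n
    by (metis abs_le_D1 mult.commute real_norm_def)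
  then show ?thesis by blast
qed

lemma pseries_sums:
  fixes a :: "nat \<Rightarrow> 'b::banach"
  assumes "entire_coeffs a"
  shows "(\<lambda>n. t ^ n *\<^sub>R a n) sums pseries a t"
  unfolding pseries_def
proof (rule summable_sums, rule summable_norm_cancel)
  have "summable (\<lambda>n. norm (a n) * \<bar>t\<bar> ^ n)"
    using assms by (simp add: entire_coeffs_def)
  then show "summable (\<lambda>n. norm (t ^ n *\<^sub>R a n))" by (simp add: mult.commute power_abs)
qed

lemma has_vector_derivative_componentwise:
  fixes g :: "real \<Rightarrow> 'b::euclidean_space"
  assumes "\<And>i. i \<in> Basis \<Longrightarrow> ((\<lambda>t. g t \<bullet> i) has_real_derivative d \<bullet> i) (at t)"
  shows "(g has_vector_derivative d) (at t)"
  unfolding has_vector_derivative_def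
  by (subst has_derivative_componentwise_within)
    (use assms in \<open>auto simp: has_field_derivative_def mult_commute_abs\<close>)

text \<open>
  Several derivatives are found later as the linear coefficient of a series that is only known near its
  centre.
\<close>

lemma has_vector_derivative_powser_0:
  fixes b :: "nat \<Rightarrow> 'b::euclidean_space"
  assumes "0 < \<rho>" and s: "\<And>h. \<bar>h\<bar> < \<rho> \<Longrightarrow> (\<lambda>n. h ^ n *\<^sub>R b n) sums g h"
  shows "(g has_vector_derivative b 1) (at 0)"
proof (rule has_vector_derivative_componentwise)
  fix i :: 'b assume "i \<in> Basis"
  define c where "c = (\<lambda>n. b n \<bullet> i)"
  have cs: "(\<lambda>n. c n * h ^ n) sums (g h \<bullet> i)" if "\<bar>h\<bar> < \<rho>" for h
    using bounded_linear.sums [OF bounded_linear_inner_left s [OF that], of i]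
    by (simp add: c_def mult.commute)
  have "DERIV (\<lambda>x. \<Sum>n. c n * x ^ n) 0 :> (\<Sum>n. diffs c n * 0 ^ n)"
    by (rule termdiffs_strong [of _ "\<rho> / 2"]) (use cs [of "\<rho> / 2"] \<open>0 < \<rho>\<close> in \<open>auto simp: sums_iff\<close>)
  also have "(\<Sum>n. diffs c n * 0 ^ n) = b 1 \<bullet> i"
    by (simp add: diffs_def c_def)
  finally have D: "((\<lambda>x. \<Sum>n. c n * x ^ n) has_real_derivative b 1 \<bullet> i) (at 0)" .
  show "((\<lambda>t. g t \<bullet> i) has_real_derivative b 1 \<bullet> i) (at 0)"
    by (rule has_field_derivative_transform_within_open [OF D, of "{-\<rho><..<\<rho>}"])
      (use \<open>0 < \<rho>\<close> cs in \<open>auto simp: sums_iff abs_less_iff\<close>)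
qed

lemma entire_coeffs_shift:
  fixes a :: "nat \<Rightarrow> 'b::euclidean_space"
  assumes a: "entire_coeffs a"
  shows "entire_coeffs (\<lambda>n. real (Suc n) *\<^sub>R a (Suc n))"
  unfolding entire_coeffs_def
proof
  fix R :: real
  have "summable (\<lambda>n. diffs (\<lambda>n. norm (a n)) n * R ^ n)"
    by (rule termdiff_converges_all) (use a in \<open>simp add: entire_coeffs_def\<close>)
  then show "summable (\<lambda>n. norm (real (Suc n) *\<^sub>R a (Suc n)) * R ^ n)"
    by (simp add: diffs_def)
qed

lemma has_vector_derivative_pseries:
  fixes a :: "nat \<Rightarrow> 'b::euclidean_space"
  assumes a: "entire_coeffs a"
  shows "(pseries a has_vector_derivative pseries (\<lambda>n. real (Suc n) *\<^sub>R a (Suc n)) t) (at t)"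
proof (rule has_vector_derivative_componentwise)
  fix i :: 'b assume "i \<in> Basis"
  define c where "c = (\<lambda>n. a n \<bullet> i)"
  have eq: "pseries d t \<bullet> i = (\<Sum>n. (d n \<bullet> i) * t ^ n)" if "entire_coeffs d" for d t
    using bounded_linear.sums [OF bounded_linear_inner_left pseries_sums [OF that], of t i]
    by (simp add: sums_iff mult.commute)
  have "summable (\<lambda>n. c n * y ^ n)" for y
    using bounded_linear.sums [OF bounded_linear_inner_left pseries_sums [OF a], of y i]
    by (simp add: sums_iff mult.commute c_def)
  then have "((\<lambda>x. \<Sum>n. c n * x ^ n) has_field_derivative (\<Sum>n. diffs c n * t ^ n)) (at t)"
    by (rule termdiffs_strong_converges_everywhere)
  then show "((\<lambda>t. pseries a t \<bullet> i) has_real_derivative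
      pseries (\<lambda>n. real (Suc n) *\<^sub>R a (Suc n)) t \<bullet> i) (at t)"
    by (simp only: eq [OF a] eq [OF entire_coeffs_shift [OF a]] c_def diffs_def inner_scaleR_left)
qed

lemma nderiv_pseries:
  fixes a :: "nat \<Rightarrow> 'b::euclidean_space"
  assumes "entire_coeffs a"
  shows "nderiv j (pseries a) = pseries (\<lambda>n. (fact (n + j) / fact n) *\<^sub>R a (n + j))"
    and "entire_coeffs (\<lambda>n. (fact (n + j) / fact n) *\<^sub>R a (n + j) :: 'b)"
proof (induction j)
  case 0
  { case 1 show ?case by (simp add: nderiv_def) }
  { case 2 show ?case using assms by simp }
next
  case (Suc j)
  define d where "d = (\<lambda>n. (fact (n + j) / fact n :: real) *\<^sub>R a (n + j))"
  have d: "(\<lambda>n. real (Suc n) *\<^sub>R d (Suc n)) = (\<lambda>n. (fact (n + Suc j) / fact n) *\<^sub>R a (n + Suc j))"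
    by (rule ext) (simp add: d_def divide_simps)
  have e: "entire_coeffs d" using Suc.IH(2) by (simp add: d_def)
  { case 1
    have "nderiv (Suc j) (pseries a) = (\<lambda>t. vector_derivative (pseries d) (at t))"
      using Suc.IH(1) by (simp add: nderiv_def d_def)
    then show ?case
      using has_vector_derivative_pseries [OF e, THEN vector_derivative_at, unfolded d] by (simp only: fun_eq_iff simp_thms) }
  { case 2 show ?case using entire_coeffs_shift [OF e] unfolding d . }
qed

text \<open>
  Once the coefficients below \<open>n\<close> are known to vanish, the series may be divided by \<open>h ^ n\<close>, and the
  \<open>n\<close>-th coefficient is its limit as \<open>h\<close> tends to \<open>0\<close>.
\<close>

lemma powser_zero_imp_coeff_zero:
  fixes b :: "nat \<Rightarrow> 'b::euclidean_space"
  assumes "0 < \<rho>" and z: "\<And>h. h \<noteq> 0 \<Longrightarrow> \<bar>h\<bar> < \<rho> \<Longrightarrow> (\<lambda>n. h ^ n *\<^sub>R b n) sums 0"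
  shows "b n = 0"
proof (induction n rule: less_induct)
  case (less n)
  have tail: "(\<lambda>k. h ^ k *\<^sub>R b (k + n)) sums 0" if h: "h \<noteq> 0" "\<bar>h\<bar> < \<rho>" for h
  proof -
    have "(\<lambda>k. h ^ (k + n) *\<^sub>R b (k + n)) sums 0"
      using z [OF h] less by (subst sums_zero_iff_shift) auto
    then have "(\<lambda>k. (1 / h ^ n) *\<^sub>R (h ^ (k + n) *\<^sub>R b (k + n))) sums ((1 / h ^ n) *\<^sub>R 0)"
      by (rule sums_scaleR_right)
    then show ?thesis using h by (simp add: power_add)
  qed
  show ?case
  proof (rule euclidean_eqI)
    fix i :: 'b
    have "(\<lambda>k. (b (k + n) \<bullet> i) * h ^ k) sums 0" if "h \<noteq> 0" "norm h < \<rho>" for h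
      using bounded_linear.sums [OF bounded_linear_inner_left tail, of h i] that
      by (simp add: mult.commute)
    from powser_limit_0_strong [OF \<open>0 < \<rho>\<close> this]
    have "((\<lambda>_ :: real. 0) \<longlongrightarrow> b (0 + n) \<bullet> i) (at 0)" .
    then show "b n \<bullet> i = 0 \<bullet> i" by (simp add: tendsto_const_iff)
  qed
qed

text \<open>
  The same triangle of terms is summed by rows and by columns.  Expansions of \<open>(s + v) ^ n\<close> inside a power
  series are rearranged in this way.
\<close>

lemma sums_triangle:
  fixes u :: "nat \<Rightarrow> nat \<Rightarrow> 'b::banach"
  assumes "summable (\<lambda>n. \<Sum>j\<le>n. norm (u n j))"
  shows "\<exists>S. (\<lambda>n. \<Sum>j\<le>n. u n j) sums S \<and> (\<lambda>j. \<Sum>i. u (i + j) j) sums S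
    \<and> (\<forall>j. summable (\<lambda>i. norm (u (i + j) j)))"
proof -
  define T where "T = Sigma UNIV (\<lambda>n :: nat. {..n})"
  have "(\<lambda>(n, j). norm (u n j)) summable_on T"
    unfolding T_def
  proof (rule summable_on_SigmaI)
    show "(\<lambda>n. \<Sum>j\<le>n. norm (u n j)) summable_on UNIV"
      using assms by (subst summable_on_UNIV_nonneg_real_iff) (auto intro: sum_nonneg)
  qed (auto intro: has_sum_finite)
  then have abs: "(\<lambda>p. norm (case_prod u p)) summable_on T" by (simp add: case_prod_unfold)
  then obtain S where S: "(case_prod u has_sum S) T"
    using abs_summable_summable summable_on_def by blast
  have 1: "(\<lambda>n. \<Sum>j\<le>n. u n j) sums S"
    by (rule has_sum_imp_sums, rule has_sum_SigmaD [OF S [unfolded T_def]]) (auto intro: has_sum_finite)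
  have bij: "bij_betw (\<lambda>(j, i). (i + j, j)) (Sigma UNIV (\<lambda>_. UNIV)) T"
    by (rule bij_betwI [where g = "\<lambda>(n, j). (j, n - j)"]) (auto simp: T_def)
  have S': "((\<lambda>(j, i). u (i + j) j) has_sum S) (Sigma UNIV (\<lambda>_. UNIV))"
    using has_sum_reindex_bij_betw [OF bij, of "case_prod u" S] S by (simp add: case_prod_unfold)
  have as: "(\<lambda>p. norm ((\<lambda>(j, i). u (i + j) j) p)) summable_on (Sigma UNIV (\<lambda>_. UNIV))"
    using summable_on_reindex_bij_betw [OF bij, of "\<lambda>p. norm (case_prod u p)"] abs
    by (simp add: case_prod_unfold)
  have 2: "(\<lambda>i. norm (u (i + j) j)) summable_on UNIV" for j
  proof -
    have "(\<lambda>i. norm ((\<lambda>(j, i). u (i + j) j) (j, i))) summable_on UNIV"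
      by (rule bspec [OF conjunct1 [OF iffD1 [OF Infinite_Sum.abs_summable_on_Sigma_iff as]]]) simp
    then show ?thesis by simp
  qed
  have 3: "(\<lambda>j. \<Sum>i. u (i + j) j) sums S"
  proof (rule has_sum_imp_sums, rule has_sum_SigmaD [OF S'])
    fix j :: nat
    have sm: "summable (\<lambda>i. norm (u (i + j) j))"
      using 2 [of j] by (rule summable_on_imp_summable)
    have "((\<lambda>i. u (i + j) j) has_sum (\<Sum>i. u (i + j) j)) UNIV"
      by (rule norm_summable_imp_has_sum [OF sm summable_sums [OF summable_norm_cancel [OF sm]]])
    then show "((\<lambda>i. case (j, i) of (j, i) \<Rightarrow> u (i + j) j) has_sum (\<Sum>i. u (i + j) j)) UNIV"
      by simp
  qed
  show ?thesis using 1 3 summable_on_imp_summable [OF 2] by blast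
qed

lemma entire_coeffs_cnorm1:
  fixes a :: "nat \<Rightarrow> 'n::finite cliff"
  assumes "entire_coeffs a" "0 \<le> R"
  shows "summable (\<lambda>n. R ^ n * cnorm1 (a n))"
proof (rule summable_comparison_test')
  show "summable (\<lambda>n. real CARD('n set) * (norm (a n) * R ^ n))"
    using assms by (intro summable_mult) (simp add: entire_coeffs_def)
  show "norm (R ^ n * cnorm1 (a n)) \<le> real CARD('n set) * (norm (a n) * R ^ n)" for n
    using mult_left_mono [OF cnorm1_le_norm [of "a n"], of "R ^ n"] \<open>0 \<le> R\<close>
    by (simp add: mult_ac abs_mult)
qed

lemma summable_cnorm1_imp_summable_norm:
  assumes "summable g" "\<And>n. cnorm1 (f n) \<le> g n"
  shows "summable (\<lambda>n. norm (f n))"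
  by (rule summable_comparison_test' [OF assms(1)]) (use order_trans [OF norm_le_cnorm1 assms(2)] in simp)

text \<open>
  By the binomial theorem the \<open>n\<close>-th row is at most \<open>(\<rho> + \<sigma>) ^ n\<close> times the size of \<open>a n\<close>.
\<close>

lemma triangle_entire:
  fixes a :: "nat \<Rightarrow> 'n::{finite,linorder} cliff" and c :: "nat \<Rightarrow> nat \<Rightarrow> 'n cliff"
  assumes a: "entire_coeffs a" and nonneg: "0 \<le> \<rho>" "0 \<le> \<sigma>"
    and c: "\<And>n j. j \<le> n \<Longrightarrow> cnorm1 (c n j) \<le> real (n choose j) * \<rho> ^ j * \<sigma> ^ (n - j)"
  shows "\<exists>S. (\<lambda>n. (\<Sum>j\<le>n. c n j) * a n) sums S \<and> (\<lambda>j. \<Sum>i. c (i + j) j * a (i + j)) sums S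
    \<and> (\<forall>j. summable (\<lambda>i. c (i + j) j * a (i + j)))"
proof -
  have "summable (\<lambda>n. \<Sum>j\<le>n. norm (c n j * a n))"
  proof (rule summable_comparison_test')
    show "summable (\<lambda>n. (\<rho> + \<sigma>) ^ n * cnorm1 (a n))"
      using a nonneg by (intro entire_coeffs_cnorm1) simp_all
    fix n
    have "norm (\<Sum>j\<le>n. norm (c n j * a n)) = (\<Sum>j\<le>n. norm (c n j * a n))"
      by (simp add: sum_nonneg)
    also have "\<dots> \<le> (\<Sum>j\<le>n. real (n choose j) * \<rho> ^ j * \<sigma> ^ (n - j) * cnorm1 (a n))"
    proof (rule sum_mono)
      fix j assume "j \<in> {..n}"
      then have "cnorm1 (c n j) * cnorm1 (a n) \<le> real (n choose j) * \<rho> ^ j * \<sigma> ^ (n - j) * cnorm1 (a n)"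
        by (intro mult_right_mono c) simp_all
      then show "norm (c n j * a n) \<le> real (n choose j) * \<rho> ^ j * \<sigma> ^ (n - j) * cnorm1 (a n)"
        by (rule order_trans [OF order_trans [OF norm_le_cnorm1 cnorm1_times]])
    qed
    also have "\<dots> = (\<rho> + \<sigma>) ^ n * cnorm1 (a n)"
      by (simp add: binomial_ring sum_distrib_right)
    finally show "norm (\<Sum>j\<le>n. norm (c n j * a n)) \<le> (\<rho> + \<sigma>) ^ n * cnorm1 (a n)" .
  qed
  from sums_triangle [OF this] obtain S where
      1: "(\<lambda>n. \<Sum>j\<le>n. c n j * a n) sums S"
    and 2: "(\<lambda>j. \<Sum>i. c (i + j) j * a (i + j)) sums S"
    and 3: "\<And>j. summable (\<lambda>i. norm (c (i + j) j * a (i + j)))"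
    by auto
  show ?thesis
    using 1 2 summable_norm_cancel [OF 3] by (intro exI [of _ S]) (simp add: sum_distrib_right)
qed

section \<open>Extensions of real power series to paravectors\<close>

text \<open>
  The numbers \<open>\<beta>_j\<close> in \<open>D (v ^ j) = - \<beta>_j v ^ (j - 1)\<close> for the Dirac operator \<open>D\<close>; \<open>dirac_fact\<close> is
  their product up to \<open>j\<close>.
\<close>

definition dirac_factor :: "nat \<Rightarrow> nat \<Rightarrow> real" where
  "dirac_factor m j = (if even j then real j else real (j - 1 + m))"

primrec dirac_fact :: "nat \<Rightarrow> nat \<Rightarrow> real" where
  "dirac_fact m 0 = 1"
| "dirac_fact m (Suc j) = dirac_factor m (Suc j) * dirac_fact m j"

lemma dirac_factor_ge: "1 \<le> m \<Longrightarrow> real j \<le> dirac_factor m j"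
  by (auto simp: dirac_factor_def)

lemma dirac_factor_le: "1 \<le> m \<Longrightarrow> dirac_factor m (Suc j) \<le> real m * real (Suc j)"
proof -
  assume "1 \<le> m"
  moreover from this have "real j * 1 \<le> real j * real m" by (intro mult_left_mono) simp_all
  ultimately show ?thesis by (auto simp: dirac_factor_def algebra_simps)
qed

lemma dirac_fact_ge: "1 \<le> m \<Longrightarrow> fact j \<le> dirac_fact m j"
proof (induction j)
  case (Suc j)
  have "real (Suc j) * fact j \<le> dirac_factor m (Suc j) * dirac_fact m j"
    using Suc dirac_factor_ge [of m "Suc j"] by (intro mult_mono) simp_all
  then show ?case by simp
qed simp

lemma dirac_fact_pos: "1 \<le> m \<Longrightarrow> 0 < dirac_fact m j"
  using dirac_fact_ge [of m j] fact_gt_zero [of j, where 'a = real] by linarith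

text \<open>
  The factor by which the coefficient of \<open>v ^ j\<close> changes from the slice extension, where it is a
  derivative divided by \<open>j!\<close>, to the monogenic extension.
\<close>

definition ck_weight :: "nat \<Rightarrow> nat \<Rightarrow> real" where
  "ck_weight m j = fact j / dirac_fact m j"

lemma ck_weight_bounds: "1 \<le> m \<Longrightarrow> 0 \<le> ck_weight m j" "1 \<le> m \<Longrightarrow> ck_weight m j \<le> 1"
  using dirac_fact_pos [of m j] dirac_fact_ge [of m j] by (simp_all add: ck_weight_def)

definition ck_poly :: "nat \<Rightarrow> 'n::{finite,linorder} para \<Rightarrow> 'n cliff" where
  "ck_poly n x = (\<Sum>j\<le>n. (real (n choose j) * ck_weight CARD('n) j * fst x ^ (n - j)) *\<^sub>R vecpart (snd x) ^ j)"

definition ck_series :: "(nat \<Rightarrow> 'n::{finite,linorder} cliff) \<Rightarrow> 'n para \<Rightarrow> 'n cliff" where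
  "ck_series a x = (\<Sum>n. ck_poly n x * a n)"

lemma one_le_card: "1 \<le> CARD('n::finite)"
  by (simp add: Suc_le_eq)

lemma binomial_times_fact: "real ((i + j) choose j) * fact j = fact (i + j) / fact i"
  by (subst binomial_fact) simp_all

lemma suminf_times_left:
  fixes f :: "nat \<Rightarrow> 'n::{finite,linorder} cliff"
  assumes "summable f"
  shows "(\<Sum>i. u * f i) = u * (\<Sum>i. f i)"
  using bounded_linear.suminf [OF bounded_linear_times_right_cliff assms] by (rule sym)

lemma cnorm1_binomial_term:
  fixes v :: "'n::{finite,linorder} cliff"
  assumes "0 \<le> k" "k \<le> 1"
  shows "cnorm1 ((real (n choose j) * k * s ^ (n - j)) *\<^sub>R v ^ j)
    \<le> real (n choose j) * cnorm1 v ^ j * \<bar>s\<bar> ^ (n - j)"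
proof -
  have "k * cnorm1 (v ^ j) \<le> 1 * cnorm1 v ^ j"
    using assms by (intro mult_mono cnorm1_power) simp_all
  from mult_left_mono [OF this, of "real (n choose j) * \<bar>s\<bar> ^ (n - j)"] show ?thesis
    using assms by (simp add: abs_mult power_abs mult_ac)
qed

text \<open>
  Pascal's rule.  A summand that gains a factor \<open>v\<close> has its weight shifted by one.
\<close>

lemma binomial_Suc_sum:
  fixes v :: "'n::{finite,linorder} cliff"
  shows "(\<Sum>j\<le>Suc n. (real (Suc n choose j) * \<kappa> j * s ^ (Suc n - j)) *\<^sub>R v ^ j) =
    s *\<^sub>R (\<Sum>j\<le>n. (real (n choose j) * \<kappa> j * s ^ (n - j)) *\<^sub>R v ^ j) +
    v * (\<Sum>j\<le>n. (real (n choose j) * \<kappa> (Suc j) * s ^ (n - j)) *\<^sub>R v ^ j)"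
proof -
  have "(\<Sum>j\<le>Suc n. (real (Suc n choose j) * \<kappa> j * s ^ (Suc n - j)) *\<^sub>R v ^ j) =
      (\<kappa> 0 * s ^ Suc n) *\<^sub>R 1 + (\<Sum>j\<le>n. (real (Suc n choose Suc j) * \<kappa> (Suc j) * s ^ (n - j)) *\<^sub>R v ^ Suc j)"
    by (subst sum.atMost_Suc_shift) simp
  also have "(\<Sum>j\<le>n. (real (Suc n choose Suc j) * \<kappa> (Suc j) * s ^ (n - j)) *\<^sub>R v ^ Suc j) =
      (\<Sum>j\<le>n. (real (n choose j) * \<kappa> (Suc j) * s ^ (n - j)) *\<^sub>R v ^ Suc j) +
      (\<Sum>j\<le>n. (real (n choose Suc j) * \<kappa> (Suc j) * s ^ (n - j)) *\<^sub>R v ^ Suc j)"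
    by (simp add: sum.distrib [symmetric] algebra_simps)
  also have "(\<Sum>j\<le>n. (real (n choose j) * \<kappa> (Suc j) * s ^ (n - j)) *\<^sub>R v ^ Suc j) =
      v * (\<Sum>j\<le>n. (real (n choose j) * \<kappa> (Suc j) * s ^ (n - j)) *\<^sub>R v ^ j)"
    by (simp add: sum_distrib_left)
  also have "(\<kappa> 0 * s ^ Suc n) *\<^sub>R 1 + (v * (\<Sum>j\<le>n. (real (n choose j) * \<kappa> (Suc j) * s ^ (n - j)) *\<^sub>R v ^ j) +
      (\<Sum>j\<le>n. (real (n choose Suc j) * \<kappa> (Suc j) * s ^ (n - j)) *\<^sub>R v ^ Suc j)) =
      ((\<kappa> 0 * s ^ Suc n) *\<^sub>R 1 + (\<Sum>j\<le>n. (real (n choose Suc j) * \<kappa> (Suc j) * s ^ (n - j)) *\<^sub>R v ^ Suc j)) +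
      v * (\<Sum>j\<le>n. (real (n choose j) * \<kappa> (Suc j) * s ^ (n - j)) *\<^sub>R v ^ j)"
    by (simp only: add_ac)
  also have "(\<kappa> 0 * s ^ Suc n) *\<^sub>R 1 + (\<Sum>j\<le>n. (real (n choose Suc j) * \<kappa> (Suc j) * s ^ (n - j)) *\<^sub>R v ^ Suc j) =
      (\<Sum>j\<le>Suc n. (real (n choose j) * \<kappa> j * s ^ (Suc n - j)) *\<^sub>R v ^ j)"
    by (subst sum.atMost_Suc_shift) simp
  also have "\<dots> = s *\<^sub>R (\<Sum>j\<le>n. (real (n choose j) * \<kappa> j * s ^ (n - j)) *\<^sub>R v ^ j)"
    by (simp add: scaleR_sum_right Suc_diff_le mult_ac)
  finally show ?thesis .
qed

lemma binomial_cliff: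
  fixes v :: "'n::{finite,linorder} cliff"
  shows "(of_real s + v) ^ n = (\<Sum>j\<le>n. (real (n choose j) * 1 * s ^ (n - j)) *\<^sub>R v ^ j)"
proof (induction n)
  case (Suc n)
  show ?case
    unfolding binomial_Suc_sum [of n "\<lambda>_. 1"] power_Suc Suc by (simp add: of_real_def distrib_right)
qed simp

text \<open>
  The weight \<open>1\<close> gives Taylor's formula when \<open>v\<close> is real and the slice extension when \<open>v\<close> is a vector;
  the weight \<open>ck_weight\<close> gives the monogenic extension.
\<close>

lemma binomial_double_series:
  fixes a :: "nat \<Rightarrow> 'n::{finite,linorder} cliff" and v :: "'n cliff"
  assumes a: "entire_coeffs a" and \<kappa>: "\<And>j. 0 \<le> \<kappa> j" "\<And>j. \<kappa> j \<le> 1"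
  shows "\<exists>S. (\<lambda>n. (\<Sum>j\<le>n. (real (n choose j) * \<kappa> j * s ^ (n - j)) *\<^sub>R v ^ j) * a n) sums S \<and>
    (\<lambda>j. v ^ j * ((\<kappa> j / fact j) *\<^sub>R nderiv j (pseries a) s)) sums S"
proof -
  define c where "c = (\<lambda>n j. (real (n choose j) * \<kappa> j * s ^ (n - j)) *\<^sub>R v ^ j)"
  have "cnorm1 (c n j) \<le> real (n choose j) * cnorm1 v ^ j * \<bar>s\<bar> ^ (n - j)" for n j
    unfolding c_def by (intro cnorm1_binomial_term \<kappa>)
  from triangle_entire [OF a _ _ this] obtain S where
      1: "(\<lambda>n. (\<Sum>j\<le>n. c n j) * a n) sums S"
    and 2: "(\<lambda>j. \<Sum>i. c (i + j) j * a (i + j)) sums S"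
    by auto
  have "(\<Sum>i. c (i + j) j * a (i + j)) = v ^ j * ((\<kappa> j / fact j) *\<^sub>R nderiv j (pseries a) s)" for j
  proof -
    have e: "entire_coeffs (\<lambda>i. (fact (i + j) / fact i) *\<^sub>R a (i + j))"
      by (rule nderiv_pseries [OF a])
    have "c (i + j) j * a (i + j) =
        ((\<kappa> j / fact j) *\<^sub>R v ^ j) * (s ^ i *\<^sub>R (fact (i + j) / fact i) *\<^sub>R a (i + j))" for i
      by (simp add: c_def flip: binomial_times_fact)
    then have "(\<Sum>i. c (i + j) j * a (i + j)) =
        ((\<kappa> j / fact j) *\<^sub>R v ^ j) * pseries (\<lambda>i. (fact (i + j) / fact i) *\<^sub>R a (i + j)) s"
      using suminf_times_left [OF sums_summable [OF pseries_sums [OF e, of s]]]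
      by (simp only: pseries_def)
    then show ?thesis by (simp only: nderiv_pseries [OF a] mult_scaleR_left mult_scaleR_right)
  qed
  with 1 2 show ?thesis by (auto simp: c_def)
qed

lemma ck_series_sums:
  fixes a :: "nat \<Rightarrow> 'n::{finite,linorder} cliff"
  assumes a: "entire_coeffs a"
  shows "(\<lambda>n. ck_poly n x * a n) sums ck_series a x"
    and "(\<lambda>j. vecpart (snd x) ^ j * (nderiv j (pseries a) (fst x) /\<^sub>R dirac_fact CARD('n) j)) sums ck_series a x"
proof -
  have w: "ck_weight CARD('n) j / fact j = inverse (dirac_fact CARD('n) j)" for j
    by (simp add: ck_weight_def divide_inverse)
  obtain S where 1: "(\<lambda>n. ck_poly n x * a n) sums S"
    and 2: "(\<lambda>j. vecpart (snd x) ^ j * (nderiv j (pseries a) (fst x) /\<^sub>R dirac_fact CARD('n) j)) sums S"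
    using binomial_double_series [where \<kappa> = "ck_weight CARD('n)" and s = "fst x" and v = "vecpart (snd x)",
        OF a ck_weight_bounds(1) [OF one_le_card] ck_weight_bounds(2) [OF one_le_card]]
    unfolding w ck_poly_def by auto
  have "ck_series a x = S" using 1 by (simp add: ck_series_def sums_iff)
  with 1 2 show "(\<lambda>n. ck_poly n x * a n) sums ck_series a x"
    and "(\<lambda>j. vecpart (snd x) ^ j * (nderiv j (pseries a) (fst x) /\<^sub>R dirac_fact CARD('n) j)) sums ck_series a x"
    by (simp_all only:)
qed

lemma pseries_recenter:
  fixes a :: "nat \<Rightarrow> 'n::{finite,linorder} cliff"
  assumes a: "entire_coeffs a"
  shows "entire_coeffs (\<lambda>j. nderiv j (pseries a) s /\<^sub>R fact j)"
    and "pseries (\<lambda>j. nderiv j (pseries a) s /\<^sub>R fact j) h = pseries a (s + h)"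
proof -
  have main: "(\<lambda>j. h ^ j *\<^sub>R (nderiv j (pseries a) s /\<^sub>R fact j)) sums pseries a (s + h)" for h
  proof -
    obtain S where 1: "(\<lambda>n. (of_real s + of_real h) ^ n * a n) sums S"
      and 2: "(\<lambda>j. of_real h ^ j * ((1 / fact j) *\<^sub>R nderiv j (pseries a) s)) sums S"
      using binomial_double_series [OF a, of "\<lambda>_. 1" s "of_real h"] unfolding binomial_cliff by auto
    have "(\<lambda>n. (s + h) ^ n *\<^sub>R a n) sums S"
      using 1 by (simp add: of_real_def scaleR_power_cliff flip: scaleR_add_left)
    then have "S = pseries a (s + h)" by (simp add: pseries_def sums_iff)
    then show ?thesis using 2 by (simp add: of_real_def scaleR_power_cliff divide_inverse mult.commute)
  qed
  show "entire_coeffs (\<lambda>j. nderiv j (pseries a) s /\<^sub>R fact j)"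
    using main by (intro entire_coeffsI) (rule sums_summable)
  show "pseries (\<lambda>j. nderiv j (pseries a) s /\<^sub>R fact j) h = pseries a (s + h)"
    using main by (simp add: pseries_def sums_iff)
qed

lemma has_vector_derivative_shift:
  "((\<lambda>h. f (s + h)) has_vector_derivative d) (at h) \<longleftrightarrow> (f has_vector_derivative d) (at (s + h))"
  unfolding has_vector_derivative_def has_derivative_at by (simp add: add.assoc)

lemma nderiv_shift: "nderiv j (\<lambda>h. f (s + h)) h = nderiv j f (s + h)"
proof (induction j arbitrary: h)
  case (Suc j)
  have "nderiv (Suc j) (\<lambda>h. f (s + h)) h = vector_derivative (nderiv j (\<lambda>h. f (s + h))) (at h)"
    by (simp add: nderiv_def)
  also have "\<dots> = vector_derivative (\<lambda>h. nderiv j f (s + h)) (at h)"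
    using Suc by presburger
  also have "\<dots> = nderiv (Suc j) f (s + h)"
    by (simp add: nderiv_def vector_derivative_def has_vector_derivative_shift)
  finally show ?case .
qed (simp add: nderiv_def)

lemma nderiv_Suc: "nderiv (Suc j) f t = vector_derivative (nderiv j f) (at t)"
  by (simp add: nderiv_def)

lemma nderiv_nderiv: "nderiv j (nderiv k f) = nderiv (j + k) f"
  by (simp add: nderiv_def funpow_add)

text \<open>
  Only the derivatives at \<open>s + h\<close> enter the series, and they can be computed from the Taylor expansion
  at \<open>s\<close>.
\<close>

lemma ck_series_recenter:
  fixes a :: "nat \<Rightarrow> 'n::{finite,linorder} cliff"
  assumes a: "entire_coeffs a"
  shows "ck_series a (s + h, v) = ck_series (\<lambda>j. nderiv j (pseries a) s /\<^sub>R fact j) (h, v)"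
proof -
  define b where "b = (\<lambda>j. nderiv j (pseries a) s /\<^sub>R fact j)"
  have b: "entire_coeffs b" and "pseries b = (\<lambda>h. pseries a (s + h))"
    using pseries_recenter [OF a] by (auto simp: b_def)
  then have "nderiv j (pseries b) h = nderiv j (pseries a) (s + h)" for j
    by (simp add: nderiv_shift)
  then show ?thesis
    using sums_unique2 [OF ck_series_sums(2) [OF b, of "(h, v)"]] ck_series_sums(2) [OF a, of "(s + h, v)"]
    by (simp add: b_def)
qed

text \<open>
  After recentring at \<open>s\<close>, the same double series is ordered by powers of the increment.  The derivative
  is the coefficient of the first power.
\<close>

lemma ck_series_derivative_real:
  fixes a :: "nat \<Rightarrow> 'n::{finite,linorder} cliff"
  assumes a: "entire_coeffs a"
  shows "((\<lambda>t. ck_series a (t, v)) has_vector_derivative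
      ck_series (\<lambda>n. real (Suc n) *\<^sub>R a (Suc n)) (s, v)) (at s)"
proof -
  define b where "b = (\<lambda>j. nderiv j (pseries a) s /\<^sub>R fact j)"
  have b: "entire_coeffs b" unfolding b_def by (rule pseries_recenter [OF a])
  define d where "d = (\<lambda>i. \<Sum>k. ((real ((k + i) choose i) * ck_weight CARD('n) k) *\<^sub>R vecpart v ^ k) * b (k + i))"
  define c where "c = (\<lambda>h n i. (real (n choose i) * ck_weight CARD('n) (n - i) * h ^ i) *\<^sub>R vecpart v ^ (n - i) :: 'n cliff)"
  have bound: "cnorm1 (c h n i) \<le> real (n choose i) * \<bar>h\<bar> ^ i * cnorm1 (vecpart v) ^ (n - i)" if "i \<le> n" for h n i
    using cnorm1_binomial_term [OF ck_weight_bounds [OF one_le_card [where 'n = 'n], of "n - i"], where n = n and j = "n - i" and s = h and v = "vecpart v"]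
      that binomial_symmetric [OF that]
    by (simp add: c_def mult_ac)
  \<comment> \<open>the coefficients of the rearranged series do not involve \<open>h\<close>, so \<open>h = 1\<close> shows their existence\<close>
  have sm: "summable (\<lambda>k. ((real ((k + i) choose i) * ck_weight CARD('n) k) *\<^sub>R vecpart v ^ k) * b (k + i))" for i
  proof -
    have "summable (\<lambda>k. c 1 (k + i) i * b (k + i))"
      using triangle_entire [OF b _ _ bound, of 1] by auto
    then show ?thesis by (simp add: c_def)
  qed
  have "(\<lambda>i. h ^ i *\<^sub>R d i) sums ck_series b (h, v)" for h
  proof -
    from triangle_entire [OF b _ _ bound, of h] obtain S where
        1: "(\<lambda>n. (\<Sum>j\<le>n. c h n j) * b n) sums S"
      and 2: "(\<lambda>j. \<Sum>i. c h (i + j) j * b (i + j)) sums S"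
      by auto
    have "(\<Sum>j\<le>n. c h n j) = ck_poly n (h, v)" for n
    proof -
      have "(\<Sum>j\<le>n. c h n j) = (\<Sum>j\<le>n. c h n (n - j))"
        by (rule sum.reindex_bij_witness [of _ "\<lambda>j. n - j" "\<lambda>j. n - j"]) auto
      also have "\<dots> = ck_poly n (h, v)"
        unfolding ck_poly_def by (rule sum.cong) (auto simp: c_def simp flip: binomial_symmetric)
      finally show ?thesis .
    qed
    then have S: "S = ck_series b (h, v)" using 1 by (simp add: ck_series_def sums_iff)
    have "(\<Sum>i. c h (i + j) j * b (i + j)) = h ^ j *\<^sub>R d j" for j
      using suminf_scaleR_right [OF sm [of j], of "h ^ j"] by (simp add: d_def c_def mult_ac)
    then show ?thesis using 2 S by simp
  qed
  from has_vector_derivative_powser_0 [OF zero_less_one this]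
  have "((\<lambda>h. ck_series a (s + h, v)) has_vector_derivative d 1) (at 0)"
    by (simp add: ck_series_recenter [OF a] b_def)
  then have D: "((\<lambda>t. ck_series a (t, v)) has_vector_derivative d 1) (at s)"
    using has_vector_derivative_shift [of "\<lambda>t. ck_series a (t, v)" s "d 1" 0] by simp
  define a' where "a' = (\<lambda>n. real (Suc n) *\<^sub>R a (Suc n))"
  have a': "entire_coeffs a'" unfolding a'_def by (rule entire_coeffs_shift [OF a])
  have pa': "pseries a' = nderiv 1 (pseries a)"
    by (simp add: nderiv_pseries [OF a] a'_def)
  have "d 1 = (\<Sum>k. vecpart v ^ k * (nderiv k (pseries a') s /\<^sub>R dirac_fact CARD('n) k))"
    unfolding d_def
  proof (rule suminf_cong)
    fix k
    have "nderiv k (pseries a') s = nderiv (k + 1) (pseries a) s"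
      by (simp add: pa' nderiv_nderiv)
    moreover have "(fact k + fact k * real k :: real) \<noteq> 0"
      using fact_nonzero [of "Suc k", where 'a = real] by (simp add: algebra_simps)
    ultimately show "(real (k + 1 choose 1) * ck_weight CARD('n) k) *\<^sub>R vecpart v ^ k * b (k + 1) =
         vecpart v ^ k * (nderiv k (pseries a') s /\<^sub>R dirac_fact CARD('n) k)"
      by (simp add: b_def ck_weight_def field_simps)
  qed
  also have "\<dots> = ck_series a' (s, v)"
    using ck_series_sums(2) [OF a', of "(s, v)"] by (simp add: sums_iff)
  finally show ?thesis using D by (simp add: a'_def)
qed

section \<open>The Dirac operator on powers of the vector variable\<close>

text \<open>
  One axis suffices: for \<open>e = R e_i\<close> one has \<open>(- e) ^ n e ^ n = R ^ (2 n)\<close>, so \<open>c n\<close> is recovered from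
  the bounded term \<open>e ^ n c n\<close> with a gain of \<open>R ^ n\<close>.
\<close>

lemma entire_coeffs_if_vecpart_sums:
  fixes c :: "nat \<Rightarrow> 'n::{finite,linorder} cliff"
  assumes "\<And>v. summable (\<lambda>j. vecpart v ^ j * c j)"
  shows "entire_coeffs c"
proof (rule entire_coeffs_if_bounded)
  fix R :: real assume "0 < R"
  \<comment> \<open>an arbitrary generator\<close>
  define e :: "'n cliff" where "e = R *\<^sub>R gen undefined"
  have e: "vecpart (R *\<^sub>R axis undefined 1) = e"
    by (simp add: e_def vecpart_scaleR vecpart_axis)
  have "summable (\<lambda>j. e ^ j * c j)" using assms [of "R *\<^sub>R axis undefined 1"] unfolding e .
  then have "Bseq (\<lambda>j. e ^ j * c j)"
    by (intro convergent_imp_Bseq convergentI [of _ 0] summable_LIMSEQ_zero)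
  then obtain K where K: "\<And>n. norm (e ^ n * c n) \<le> K" by (auto simp: Bseq_def)
  have inv: "(- e) ^ n * e ^ n = of_real (R ^ (2 * n))" for n
  proof (induction n)
    case (Suc n)
    have "(- e) * e = of_real (R\<^sup>2)"
      by (simp add: e_def gen_square power2_eq_square of_real_def)
    then have "(- e) ^ Suc n * e ^ Suc n = (- e) ^ n * of_real (R\<^sup>2) * e ^ n"
      by (simp only: power_Suc2 [of "- e"] power_Suc [of e] mult.assoc) (simp only: mult.assoc [symmetric])
    also have "\<dots> = of_real (R\<^sup>2) * ((- e) ^ n * e ^ n)"
      by (simp only: of_real_commute_cliff [symmetric] mult.assoc)
    also have "\<dots> = of_real (R\<^sup>2 * R ^ (2 * n))"
      unfolding Suc by (rule of_real_mult [symmetric])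
    also have "R\<^sup>2 * R ^ (2 * n) = R ^ (2 * Suc n)" by (simp add: power2_eq_square)
    finally show ?case .
  qed simp
  have "R ^ n * norm (c n) \<le> real CARD('n set) * K" for n
  proof -
    have "R ^ n * (R ^ n * cnorm1 (c n)) = cnorm1 ((- e) ^ n * e ^ n * c n)"
      using \<open>0 < R\<close> unfolding inv by (simp add: of_real_def mult_2 power_add)
    also have "\<dots> \<le> cnorm1 (- e) ^ n * cnorm1 (e ^ n * c n)"
      unfolding mult.assoc by (rule order_trans [OF cnorm1_times]) (intro mult_right_mono cnorm1_power, simp)
    also have "cnorm1 (- e) = R"
      using \<open>0 < R\<close> cnorm1_scaleR [of "- R" "gen undefined :: 'n cliff"] by (simp add: e_def del: cnorm1_scaleR) 
    also have "R ^ n * cnorm1 (e ^ n * c n) \<le> R ^ n * (real CARD('n set) * K)"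
      using \<open>0 < R\<close> order_trans [OF cnorm1_le_norm mult_left_mono [OF K [of n]]] by (intro mult_left_mono) simp_all
    finally have "cnorm1 (c n) * R ^ n \<le> real CARD('n set) * K"
      using \<open>0 < R\<close> by (simp add: mult.commute)
    moreover have "norm (c n) * R ^ n \<le> cnorm1 (c n) * R ^ n"
      using \<open>0 < R\<close> by (intro mult_right_mono norm_le_cnorm1) simp
    ultimately show ?thesis by (simp add: mult.commute)
  qed
  then show "\<exists>K. \<forall>n. R ^ n * norm (c n) \<le> K" by blast
qed

lemma entire_coeffs_even_odd:
  fixes c :: "nat \<Rightarrow> 'b::real_normed_vector"
  assumes c: "entire_coeffs c"
  shows "entire_coeffs (\<lambda>l. (-1) ^ l *\<^sub>R c (2 * l))" "entire_coeffs (\<lambda>l. (-1) ^ l *\<^sub>R c (2 * l + 1))"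
proof -
  show "entire_coeffs (\<lambda>l. (-1) ^ l *\<^sub>R c (2 * l))"
  proof (rule entire_coeffs_if_bounded)
    fix R :: real assume "0 < R"
    obtain K where K: "\<And>n. sqrt R ^ n * norm (c n) \<le> K" using entire_coeffs_bounded [OF c] by blast
    have "R ^ l * norm ((-1) ^ l *\<^sub>R c (2 * l)) \<le> K" for l
      using K [of "2 * l"] \<open>0 < R\<close> by (simp add: power_mult)
    then show "\<exists>K. \<forall>n. R ^ n * norm ((-1) ^ n *\<^sub>R c (2 * n)) \<le> K" by blast
  qed
  show "entire_coeffs (\<lambda>l. (-1) ^ l *\<^sub>R c (2 * l + 1))"
  proof (rule entire_coeffs_if_bounded)
    fix R :: real assume "0 < R"
    obtain K where K: "\<And>n. sqrt R ^ n * norm (c n) \<le> K" using entire_coeffs_bounded [OF c] by blast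
    have "R ^ l * norm ((-1) ^ l *\<^sub>R c (2 * l + 1)) \<le> K / sqrt R" for l
    proof -
      have "sqrt R ^ (2 * l + 1) = R ^ l * sqrt R" using \<open>0 < R\<close> by (simp add: power_mult)
      then show ?thesis using K [of "2 * l + 1"] \<open>0 < R\<close> by (simp add: field_simps)
    qed
    then show "\<exists>K. \<forall>n. R ^ n * norm ((-1) ^ n *\<^sub>R c (2 * n + 1)) \<le> K" by blast
  qed
qed

text \<open>
  Even powers of a vector are real.  A series in \<open>v\<close> therefore consists of two real power series in
  \<open>\<bar>v\<bar>\<^sup>2\<close>, one of them multiplied by \<open>v\<close>; this reduces differentiation in \<open>v\<close> to real calculus.
\<close>

definition even_part :: "(nat \<Rightarrow> 'b::real_normed_vector) \<Rightarrow> real \<Rightarrow> 'b" where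
  "even_part c = pseries (\<lambda>l. (-1) ^ l *\<^sub>R c (2 * l))"

definition odd_part :: "(nat \<Rightarrow> 'b::real_normed_vector) \<Rightarrow> real \<Rightarrow> 'b" where
  "odd_part c = pseries (\<lambda>l. (-1) ^ l *\<^sub>R c (2 * l + 1))"

lemma sums_even_odd:
  fixes f :: "nat \<Rightarrow> 'b::banach"
  assumes "summable f" "(\<lambda>l. f (2 * l)) sums x" "(\<lambda>l. f (2 * l + 1)) sums y"
  shows "f sums (x + y)"
proof -
  have "(\<lambda>n. sum f {n * 2..<n * 2 + 2}) sums suminf f"
    using assms(1) by (intro sums_group summable_sums) simp_all
  moreover have "sum f {n * 2..<n * 2 + 2} = f (2 * n) + f (2 * n + 1)" for n
    by (simp add: numeral_2_eq_2 mult.commute)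
  ultimately have "(\<lambda>n. f (2 * n) + f (2 * n + 1)) sums suminf f" by simp
  then show ?thesis
    using sums_add [OF assms(2,3)] assms(1) sums_unique2 summable_sums by metis
qed

lemma vecpart_even_odd:
  fixes c :: "nat \<Rightarrow> 'n::{finite,linorder} cliff"
  shows "vecpart v ^ (2 * l) * c (2 * l) = ((norm v)\<^sup>2) ^ l *\<^sub>R (-1) ^ l *\<^sub>R c (2 * l)"
    and "vecpart v ^ (2 * l + 1) * c (2 * l + 1) = vecpart v * (((norm v)\<^sup>2) ^ l *\<^sub>R (-1) ^ l *\<^sub>R c (2 * l + 1))"
proof -
  have p: "(- (norm v)\<^sup>2) ^ l = ((norm v)\<^sup>2) ^ l * (-1) ^ l"
    by (simp flip: power_mult_distrib)
  show "vecpart v ^ (2 * l) * c (2 * l) = ((norm v)\<^sup>2) ^ l *\<^sub>R (-1) ^ l *\<^sub>R c (2 * l)"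
    unfolding vecpart_power_even p by (simp add: of_real_def)
  have "vecpart v ^ (2 * l + 1) = ((norm v)\<^sup>2 ^ l * (-1) ^ l) *\<^sub>R vecpart v"
    using vecpart_power_odd [of v l] unfolding p by simp
  then show "vecpart v ^ (2 * l + 1) * c (2 * l + 1) = vecpart v * (((norm v)\<^sup>2) ^ l *\<^sub>R (-1) ^ l *\<^sub>R c (2 * l + 1))"
    by simp
qed

lemma summable_vecpart_series:
  fixes c :: "nat \<Rightarrow> 'n::{finite,linorder} cliff"
  assumes c: "entire_coeffs c"
  shows "summable (\<lambda>j. vecpart v ^ j * c j)"
proof (rule summable_norm_cancel, rule summable_cnorm1_imp_summable_norm)
  show "summable (\<lambda>j. cnorm1 (vecpart v) ^ j * cnorm1 (c j))"
    using c by (intro entire_coeffs_cnorm1) simp_all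
  show "cnorm1 (vecpart v ^ j * c j) \<le> cnorm1 (vecpart v) ^ j * cnorm1 (c j)" for j
    by (rule order_trans [OF cnorm1_times]) (intro mult_right_mono cnorm1_power, simp)
qed

lemma vecpart_series_sums:
  fixes c :: "nat \<Rightarrow> 'n::{finite,linorder} cliff"
  assumes c: "entire_coeffs c"
  shows "(\<lambda>j. vecpart v ^ j * c j) sums (even_part c ((norm v)\<^sup>2) + vecpart v * odd_part c ((norm v)\<^sup>2))"
proof (rule sums_even_odd)
  show "summable (\<lambda>j. vecpart v ^ j * c j)" by (rule summable_vecpart_series [OF c])
  show "(\<lambda>l. vecpart v ^ (2 * l) * c (2 * l)) sums even_part c ((norm v)\<^sup>2)"
    unfolding vecpart_even_odd even_part_def
    by (rule pseries_sums) (rule entire_coeffs_even_odd [OF c])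
  show "(\<lambda>l. vecpart v ^ (2 * l + 1) * c (2 * l + 1)) sums (vecpart v * odd_part c ((norm v)\<^sup>2))"
    unfolding vecpart_even_odd odd_part_def
    by (rule bounded_linear.sums [OF bounded_linear_times_right_cliff pseries_sums])
      (rule entire_coeffs_even_odd [OF c])
qed

lemma sum_gen_vecpart: "(\<Sum>k\<in>UNIV. gen k * (v $ k *\<^sub>R u)) = vecpart v * u"
  by (simp add: vecpart_def sum_distrib_right)

text \<open>
  With \<open>F = A(\<rho>) + v B(\<rho>)\<close> and \<open>\<rho> = \<bar>v\<bar>\<^sup>2\<close>, the product rule and \<open>e_k e_k = -1\<close> give
  \<open>\<Sum>k. e_k \<partial>_k F = 2 v A' - m B - 2 \<rho> B'\<close>.  Reading this as a power series again, \<open>m B + 2 \<rho> B'\<close>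
  contributes the factor \<open>m + 2 l\<close> to \<open>v ^ (2 l)\<close>, and \<open>- 2 v A'\<close> contributes \<open>2 l + 2\<close> to
  \<open>v ^ (2 l + 1)\<close>.
\<close>

lemma dirac_vecpart_series:
  fixes c :: "nat \<Rightarrow> 'n::{finite,linorder} cliff"
  assumes F: "\<And>v. (\<lambda>j. vecpart v ^ j * c j) sums F (s, v)"
  shows "(\<lambda>j. dirac_factor CARD('n) (Suc j) *\<^sub>R (vecpart v ^ j * c (Suc j))) sums
    (- (\<Sum>k\<in>UNIV. gen k * partial (0, axis k 1) F (s, v)))"
proof -
  have c: "entire_coeffs c"
    by (rule entire_coeffs_if_vecpart_sums) (rule sums_summable [OF F])
  define a where "a = (\<lambda>l. (-1) ^ l *\<^sub>R c (2 * l))"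
  define b where "b = (\<lambda>l. (-1) ^ l *\<^sub>R c (2 * l + 1))"
  have a: "entire_coeffs a" and b: "entire_coeffs b"
    unfolding a_def b_def by (rule entire_coeffs_even_odd [OF c])+
  define \<rho> where "\<rho> = (norm v)\<^sup>2"
  define A' where "A' = pseries (\<lambda>n. real (Suc n) *\<^sub>R a (Suc n)) \<rho>"
  define B' where "B' = pseries (\<lambda>n. real (Suc n) *\<^sub>R b (Suc n)) \<rho>"
  define B where "B = pseries b \<rho>"
  have Feq: "F (s, w) = pseries a ((norm w)\<^sup>2) + vecpart w * pseries b ((norm w)\<^sup>2)" for w
    using sums_unique2 [OF F vecpart_series_sums [OF c]] by (simp add: even_part_def odd_part_def a_def b_def)
  have partial: "partial (0, axis k 1) F (s, v) = (2 * v $ k) *\<^sub>R A' + gen k * B + (2 * v $ k) *\<^sub>R (vecpart v * B')" for k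
  proof -
    have n2: "(norm (v + t *\<^sub>R axis k 1))\<^sup>2 = \<rho> + 2 * t * v $ k + t\<^sup>2" for t
      by (simp add: power2_norm_eq_inner \<rho>_def inner_simps inner_commute inner_axis_axis)
        (simp add: inner_axis algebra_simps power2_eq_square)
    have d\<rho>: "((\<lambda>t. \<rho> + 2 * t * v $ k + t\<^sup>2) has_vector_derivative 2 * v $ k) (at 0)"
      by (auto intro!: derivative_eq_intros simp flip: has_real_derivative_iff_has_vector_derivative)
    have dp: "((\<lambda>t. pseries u (\<rho> + 2 * t * v $ k + t\<^sup>2)) has_vector_derivative
        (2 * v $ k) *\<^sub>R pseries (\<lambda>n. real (Suc n) *\<^sub>R u (Suc n)) \<rho>) (at 0)"
      if "entire_coeffs u" for u :: "nat \<Rightarrow> 'n cliff"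
      using vector_diff_chain_at [OF d\<rho>, of "pseries u"] has_vector_derivative_pseries [OF that, of \<rho>]
      by (simp add: o_def)
    have dv: "((\<lambda>t. vecpart v + t *\<^sub>R gen k) has_vector_derivative gen k) (at 0)"
      by (auto intro!: derivative_eq_intros)
    have "((\<lambda>t. pseries a (\<rho> + 2 * t * v $ k + t\<^sup>2) +
        (vecpart v + t *\<^sub>R gen k) * pseries b (\<rho> + 2 * t * v $ k + t\<^sup>2)) has_vector_derivative
        ((2 * v $ k) *\<^sub>R A' + (vecpart v * ((2 * v $ k) *\<^sub>R B') + gen k * B))) (at 0)"
      using has_vector_derivative_add [OF dp [OF a]
          bounded_bilinear.has_vector_derivative [OF bounded_bilinear_times_cliff dv dp [OF b]]]
      by (simp add: A'_def B'_def B_def)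
    then show ?thesis
      unfolding partial_def
      by (intro vector_derivative_at) (simp add: Feq n2 vecpart_add vecpart_scaleR vecpart_axis add_ac)
  qed
  have "(\<Sum>k\<in>UNIV. gen k * partial (0, axis k 1) F (s, v)) =
      vecpart v * (2 *\<^sub>R A') + (\<Sum>k\<in>(UNIV :: 'n set). - B) + vecpart v * (2 *\<^sub>R (vecpart v * B'))"
  proof -
    have "gen k * partial (0, axis k 1) F (s, v) =
        gen k * (v $ k *\<^sub>R (2 *\<^sub>R A')) + - B + gen k * (v $ k *\<^sub>R (2 *\<^sub>R (vecpart v * B')))" for k
      by (simp add: partial distrib_left mult.assoc [symmetric] gen_square mult.commute [of 2])
    then show ?thesis by (simp only: sum.distrib sum_gen_vecpart)
  qed
  also have "\<dots> = - (real CARD('n) *\<^sub>R B + (2 * \<rho>) *\<^sub>R B' + - 2 *\<^sub>R (vecpart v * A'))"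
  proof -
    have "(\<Sum>k\<in>(UNIV :: 'n set). - B) = - (real CARD('n) *\<^sub>R B)"
      by (simp only: sum_constant_scaleR scaleR_minus_right)
    then show ?thesis
      by (simp add: mult.assoc [symmetric] vecpart_square \<rho>_def of_real_def)
  qed
  finally have target: "- (\<Sum>k\<in>UNIV. gen k * partial (0, axis k 1) F (s, v)) =
      (real CARD('n) *\<^sub>R B + (2 * \<rho>) *\<^sub>R B') + - 2 *\<^sub>R (vecpart v * A')" by simp
  show ?thesis
    unfolding target
  proof (rule sums_even_odd)
    show "summable (\<lambda>j. dirac_factor CARD('n) (Suc j) *\<^sub>R (vecpart v ^ j * c (Suc j)))"
    proof (rule summable_norm_cancel, rule summable_cnorm1_imp_summable_norm)
      show "summable (\<lambda>j. real CARD('n) * (cnorm1 (vecpart v) ^ j * cnorm1 (real (Suc j) *\<^sub>R c (Suc j))))"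
        by (intro summable_mult entire_coeffs_cnorm1 entire_coeffs_shift c cnorm1_nonneg)
      fix j
      have "\<bar>dirac_factor CARD('n) (Suc j)\<bar> * cnorm1 (vecpart v ^ j * c (Suc j))
          \<le> (real CARD('n) * real (Suc j)) * (cnorm1 (vecpart v) ^ j * cnorm1 (c (Suc j)))"
      proof (rule mult_mono)
        show "\<bar>dirac_factor CARD('n) (Suc j)\<bar> \<le> real CARD('n) * real (Suc j)"
          using dirac_factor_le [OF one_le_card [where 'n = 'n], of j] by (simp add: dirac_factor_def)
        show "cnorm1 (vecpart v ^ j * c (Suc j)) \<le> cnorm1 (vecpart v) ^ j * cnorm1 (c (Suc j))"
          by (rule order_trans [OF cnorm1_times]) (intro mult_right_mono cnorm1_power, simp)
      qed simp_all
      then show "cnorm1 (dirac_factor CARD('n) (Suc j) *\<^sub>R (vecpart v ^ j * c (Suc j)))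
          \<le> real CARD('n) * (cnorm1 (vecpart v) ^ j * cnorm1 (real (Suc j) *\<^sub>R c (Suc j)))"
        by (simp add: mult_ac)
    qed
    have nb: "(\<lambda>n. \<rho> ^ n *\<^sub>R real n *\<^sub>R b n) sums (\<rho> *\<^sub>R B')"
    proof -
      have "(\<lambda>n. \<rho> *\<^sub>R (\<rho> ^ n *\<^sub>R real (Suc n) *\<^sub>R b (Suc n))) sums (\<rho> *\<^sub>R B')"
        unfolding B'_def by (intro sums_scaleR_right pseries_sums entire_coeffs_shift b)
      then have "(\<lambda>n. \<rho> ^ Suc n *\<^sub>R real (Suc n) *\<^sub>R b (Suc n)) sums (\<rho> *\<^sub>R B')" by (simp add: mult.assoc)
      then show ?thesis by (subst (asm) sums_Suc_iff) simp
    qed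
    have "(\<lambda>l. real CARD('n) *\<^sub>R (\<rho> ^ l *\<^sub>R b l) + 2 *\<^sub>R (\<rho> ^ l *\<^sub>R real l *\<^sub>R b l)) sums
        (real CARD('n) *\<^sub>R B + 2 *\<^sub>R (\<rho> *\<^sub>R B'))"
      unfolding B_def by (intro sums_add sums_scaleR_right pseries_sums b nb)
    moreover have "dirac_factor CARD('n) (Suc (2 * l)) *\<^sub>R (vecpart v ^ (2 * l) * c (Suc (2 * l))) =
        real CARD('n) *\<^sub>R (\<rho> ^ l *\<^sub>R b l) + 2 *\<^sub>R (\<rho> ^ l *\<^sub>R real l *\<^sub>R b l)" for l
      using vecpart_even_odd(1) [of v l "\<lambda>_. c (Suc (2 * l))"]
      by (simp add: dirac_factor_def b_def \<rho>_def algebra_simps)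
    ultimately show "(\<lambda>l. dirac_factor CARD('n) (Suc (2 * l)) *\<^sub>R (vecpart v ^ (2 * l) * c (Suc (2 * l)))) sums
        (real CARD('n) *\<^sub>R B + (2 * \<rho>) *\<^sub>R B')"
      by simp
    have "(\<lambda>l. - 2 *\<^sub>R (vecpart v * (\<rho> ^ l *\<^sub>R real (Suc l) *\<^sub>R a (Suc l)))) sums (- 2 *\<^sub>R (vecpart v * A'))"
      unfolding A'_def
      by (intro sums_scaleR_right bounded_linear.sums [OF bounded_linear_times_right_cliff] pseries_sums
          entire_coeffs_shift a)
    moreover have "dirac_factor CARD('n) (Suc (2 * l + 1)) *\<^sub>R (vecpart v ^ (2 * l + 1) * c (Suc (2 * l + 1))) =
        - 2 *\<^sub>R (vecpart v * (\<rho> ^ l *\<^sub>R real (Suc l) *\<^sub>R a (Suc l)))" for l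
      using vecpart_even_odd(2) [of v l "\<lambda>_. c (Suc (2 * l + 1))"]
      by (simp add: dirac_factor_def a_def \<rho>_def algebra_simps)
    ultimately show "(\<lambda>l. dirac_factor CARD('n) (Suc (2 * l + 1)) *\<^sub>R (vecpart v ^ (2 * l + 1) * c (Suc (2 * l + 1)))) sums
        (- 2 *\<^sub>R (vecpart v * A'))"
      by simp
  qed
qed

lemma ck_series_vecpart_sums:
  fixes a :: "nat \<Rightarrow> 'n::{finite,linorder} cliff"
  assumes a: "entire_coeffs a"
  shows "(\<lambda>j. vecpart v ^ j * (nderiv j (pseries a) s /\<^sub>R dirac_fact CARD('n) j)) sums ck_series a (s, v)"
  using ck_series_sums(2) [OF a, of "(s, v)"] by simp

text \<open>
  The real partial derivative replaces the coefficient function by its derivative, and the denominators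
  are such that the Dirac operator produces the same series with the opposite sign.
\<close>

lemma monogenic_ck_series:
  fixes a :: "nat \<Rightarrow> 'n::{finite,linorder} cliff"
  assumes a: "entire_coeffs a"
  shows "monogenic (ck_series a)"
  unfolding monogenic_def
proof
  fix x :: "'n para"
  obtain s v where x: "x = (s, v)" by (cases x)
  define a' where "a' = (\<lambda>n. real (Suc n) *\<^sub>R a (Suc n))"
  have a': "entire_coeffs a'" unfolding a'_def by (rule entire_coeffs_shift [OF a])
  have pa': "pseries a' = nderiv 1 (pseries a)"
    by (simp add: nderiv_pseries [OF a] a'_def)
  have "partial (1, 0) (ck_series a) (s, v) = ck_series a' (s, v)"
    unfolding partial_def
    using ck_series_derivative_real [OF a, of v s] has_vector_derivative_shift [of "\<lambda>t. ck_series a (t, v)" s _ 0]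
    by (intro vector_derivative_at) (simp add: a'_def)
  moreover have "(\<lambda>j. vecpart v ^ j * (nderiv j (pseries a') s /\<^sub>R dirac_fact CARD('n) j)) sums ck_series a' (s, v)"
    by (rule ck_series_vecpart_sums [OF a'])
  moreover have "dirac_factor CARD('n) (Suc j) *\<^sub>R (vecpart v ^ j * (nderiv (Suc j) (pseries a) s /\<^sub>R dirac_fact CARD('n) (Suc j)))
      = vecpart v ^ j * (nderiv j (pseries a') s /\<^sub>R dirac_fact CARD('n) j)" for j
  proof -
    have "dirac_factor CARD('n) (Suc j) \<noteq> 0"
      using dirac_factor_ge [OF one_le_card [where 'n = 'n], of "Suc j"] by auto
    then show ?thesis by (simp add: pa' nderiv_nderiv)
  qed
  ultimately have "- (\<Sum>k\<in>UNIV. gen k * partial (0, axis k 1) (ck_series a) (s, v)) = partial (1, 0) (ck_series a) (s, v)"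
    using dirac_vecpart_series [OF ck_series_vecpart_sums [OF a], of v s] sums_unique2 by simp
  then show "partial (1, 0) (ck_series a) x + (\<Sum>j\<in>UNIV. gen j * partial (0, axis j 1) (ck_series a) x) = 0"
    by (simp add: x neg_eq_iff_add_eq_0 add.commute)
qed

lemma axial_ck_series:
  fixes a :: "nat \<Rightarrow> 'n::{finite,linorder} cliff"
  assumes a: "entire_coeffs a"
  shows "axial (ck_series a)"
proof -
  define c where "c = (\<lambda>s j. nderiv j (pseries a) s /\<^sub>R dirac_fact CARD('n) j)"
  define A where "A = (\<lambda>s r :: real. even_part (c s) (r\<^sup>2))"
  define B where "B = (\<lambda>s r :: real. r *\<^sub>R odd_part (c s) (r\<^sup>2))"
  have "ck_series a (s, v) = A s (norm v) + (vecpart v /\<^sub>R norm v) * B s (norm v)" for s v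
  proof -
    have cs: "(\<lambda>j. vecpart w ^ j * c s j) sums ck_series a (s, w)" for w
      unfolding c_def by (rule ck_series_vecpart_sums [OF a])
    have "entire_coeffs (c s)"
      by (rule entire_coeffs_if_vecpart_sums) (rule sums_summable [OF cs])
    then have "ck_series a (s, v) = even_part (c s) ((norm v)\<^sup>2) + vecpart v * odd_part (c s) ((norm v)\<^sup>2)"
      using sums_unique2 [OF cs vecpart_series_sums] by blast
    then show ?thesis by (cases "v = 0") (simp_all add: A_def B_def)
  qed
  then show ?thesis
    unfolding axial_def by (intro exI [of _ A] exI [of _ B]) (simp add: A_def B_def)
qed

section \<open>Real analyticity of the series\<close>

definition basis_vec :: "'n option \<Rightarrow> 'n::{finite,linorder} para" where
  "basis_vec k = (case k of None \<Rightarrow> (1, 0) | Some i \<Rightarrow> (0, axis i 1))"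

definition basis_gen :: "'n option \<Rightarrow> 'n::{finite,linorder} cliff" where
  "basis_gen k = (case k of None \<Rightarrow> 1 | Some i \<Rightarrow> gen i)"

lemma range_basis_vec: "range basis_vec = Basis"
proof -
  have "range basis_vec = insert (basis_vec None) (range (\<lambda>i. basis_vec (Some i)))"
    unfolding UNIV_option_conv by auto
  then show ?thesis
    by (auto simp: basis_vec_def Basis_prod_def Basis_vec_def)
qed

lemma inj_basis_vec: "inj basis_vec"
  by (rule injI) (auto simp: basis_vec_def axis_eq_axis split: option.splits)

lemma inner_basis_vec [simp]: "h \<bullet> basis_vec None = fst h" "h \<bullet> basis_vec (Some i) = snd h $ i"
  by (cases h; simp add: basis_vec_def inner_axis)+

lemma finite_words_length: "finite {w :: 'a::finite list. length w = n}"
  using finite_lists_length_eq [of "UNIV :: 'a set" n] by simp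

lemma sum_words_Suc:
  fixes f :: "'a::finite list \<Rightarrow> 'b::comm_monoid_add"
  shows "(\<Sum>w | length w = Suc n. f w) = (\<Sum>x\<in>UNIV. \<Sum>w | length w = n. f (x # w))"
proof -
  have "(\<Sum>w | length w = Suc n. f w) = (\<Sum>(x, w)\<in>UNIV \<times> {w. length w = n}. f (x # w))"
    by (rule sum.reindex_bij_witness [of _ "\<lambda>(x, w). x # w" "\<lambda>w. (hd w, tl w)"])
      (auto simp: length_Suc_conv)
  also have "\<dots> = (\<Sum>x\<in>UNIV. \<Sum>w | length w = n. f (x # w))"
    by (rule sum.cartesian_product [symmetric])
  finally show ?thesis .
qed

text \<open>
  To expand \<open>ck_poly n (a + h)\<close> in powers of \<open>h\<close>, every factor is split into its \<open>2 (m + 1)\<close> summands: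
  a letter \<open>(c, k)\<close> selects the coordinate \<open>k\<close>, where \<open>None\<close> stands for the real one, of \<open>h\<close> if \<open>c\<close>
  holds and of \<open>a\<close> otherwise.  A product of \<open>n\<close> factors becomes a sum over the words of length \<open>n\<close>.
  The power series at \<open>a\<close> arises by collecting the words with the same exponents of \<open>h\<close>.  Absolute
  convergence is easy in this form, since the absolute values of all words of length \<open>n\<close> add up to an
  \<open>n\<close>-th power.
\<close>

type_synonym 'n word = "(bool \<times> 'n option) list"

definition letter_value :: "'n::{finite,linorder} para \<Rightarrow> 'n para \<Rightarrow> bool \<times> 'n option \<Rightarrow> real" where
  "letter_value a h l = (if fst l then h else a) \<bullet> basis_vec (snd l)"

definition vec_count :: "'n word \<Rightarrow> nat" where
  "vec_count w = length (filter (\<lambda>l. snd l \<noteq> None) w)"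

definition word_gen :: "'n::{finite,linorder} word \<Rightarrow> 'n cliff" where
  "word_gen w = prod_list (map (\<lambda>l. basis_gen (snd l)) w)"

definition word_value :: "'n::{finite,linorder} para \<Rightarrow> 'n para \<Rightarrow> 'n word \<Rightarrow> real" where
  "word_value a h w = prod_list (map (letter_value a h) w)"

lemma sum_letters:
  fixes g :: "bool \<Rightarrow> 'n::{finite,linorder} option \<Rightarrow> 'b::real_vector"
  shows "(\<Sum>l\<in>UNIV. g (fst l) (snd l)) = (g True None + g False None) + (\<Sum>i\<in>UNIV. g True (Some i) + g False (Some i))"
proof -
  have "(\<Sum>l\<in>UNIV. g (fst l) (snd l)) = (\<Sum>f\<in>UNIV. \<Sum>k\<in>UNIV. g f k)"
    by (subst sum.cartesian_product) (simp add: case_prod_unfold)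
  also have "\<dots> = (\<Sum>k\<in>UNIV. g True k + g False k)"
    by (simp add: UNIV_bool sum.distrib add.commute)
  also have "\<dots> = (g True None + g False None) + (\<Sum>i\<in>UNIV. g True (Some i) + g False (Some i))"
    by (simp add: UNIV_option_conv sum.reindex)
  finally show ?thesis .
qed

lemma binomial_sum_words:
  "(\<Sum>j\<le>n. (real (n choose j) * \<kappa> j * fst (a + h) ^ (n - j)) *\<^sub>R vecpart (snd (a + h)) ^ j) =
   (\<Sum>w | length w = n. (\<kappa> (vec_count w) * word_value a h w) *\<^sub>R word_gen w)"
proof (induction n arbitrary: \<kappa>)
  case 0
  then show ?case by (simp add: vec_count_def word_value_def word_gen_def)
next
  case (Suc n)
  define Z where "Z = (\<lambda>\<kappa>. \<Sum>w | length w = n. (\<kappa> (vec_count w) * word_value a h w) *\<^sub>R word_gen w)"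
  define g where "g = (\<lambda>f k. ((if f then h else a) \<bullet> basis_vec k) *\<^sub>R
      (basis_gen k * Z (if k = None then \<kappa> else (\<lambda>j. \<kappa> (Suc j)))))"
  have "(\<Sum>w | length w = Suc n. (\<kappa> (vec_count w) * word_value a h w) *\<^sub>R word_gen w) =
      (\<Sum>l\<in>UNIV. g (fst l) (snd l))"
    unfolding sum_words_Suc
  proof (rule sum.cong [OF refl])
    fix l :: "bool \<times> 'a option"
    show "(\<Sum>w | length w = n. (\<kappa> (vec_count (l # w)) * word_value a h (l # w)) *\<^sub>R word_gen (l # w)) = g (fst l) (snd l)"
      unfolding g_def Z_def sum_distrib_left scaleR_sum_right
      by (rule sum.cong) (auto simp: vec_count_def word_value_def word_gen_def letter_value_def mult_ac)
  qed
  also have "\<dots> = (g True None + g False None) + (\<Sum>i\<in>UNIV. g True (Some i) + g False (Some i))"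
    by (rule sum_letters)
  also have "g True None + g False None = fst (a + h) *\<^sub>R Z \<kappa>"
    by (simp add: g_def basis_gen_def algebra_simps)
  also have "(\<Sum>i\<in>UNIV. g True (Some i) + g False (Some i)) = vecpart (snd (a + h)) * Z (\<lambda>j. \<kappa> (Suc j))"
    by (simp add: g_def basis_gen_def vecpart_def sum_distrib_right algebra_simps)
  finally show ?case
    unfolding binomial_Suc_sum Suc Z_def ..
qed

text \<open>
  The restriction makes this an extensional function, as the index set of the power series requires.
\<close>

definition h_exponent :: "'n::{finite,linorder} word \<Rightarrow> 'n para \<Rightarrow> nat" where
  "h_exponent w = restrict (\<lambda>b. length (filter (\<lambda>l. fst l \<and> basis_vec (snd l) = b) w)) Basis"

lemma h_exponent_mem: "h_exponent w \<in> Basis \<rightarrow>\<^sub>E UNIV"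
  by (simp add: h_exponent_def)

text \<open>
  Substituting it for \<open>h\<close> leaves the coefficient of the monomial in \<open>h\<close>.
\<close>

definition all_ones :: "'n::{finite,linorder} para" where
  "all_ones = (\<Sum>b\<in>Basis. b)"

lemma all_ones_inner: "b \<in> Basis \<Longrightarrow> all_ones \<bullet> b = 1"
proof -
  assume b: "b \<in> Basis"
  have "all_ones \<bullet> b = (\<Sum>c\<in>Basis. if c = b then 1 else 0)"
    unfolding all_ones_def inner_sum_left by (rule sum.cong) (use b in \<open>auto simp: inner_Basis\<close>)
  then show ?thesis using b by simp
qed

lemma word_value_split:
  fixes a h :: "'n::{finite,linorder} para"
  shows "word_value a h w = (\<Prod>b\<in>Basis. (h \<bullet> b) ^ h_exponent w b) * word_value a all_ones w"
proof -
  define N where "N = (\<lambda>(w :: 'n word) b. length (filter (\<lambda>l. fst l \<and> basis_vec (snd l) = b) w))"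
  have "word_value a h w = (\<Prod>b\<in>Basis. (h \<bullet> b) ^ N w b) * word_value a all_ones w"
  proof (induction w)
    case (Cons l w)
    have mem: "basis_vec (snd l) \<in> Basis" using range_basis_vec by blast
    have "(\<Prod>b\<in>Basis. (h \<bullet> b) ^ N (l # w) b) =
        (\<Prod>b\<in>Basis. (if b = basis_vec (snd l) then (if fst l then h \<bullet> b else 1) else 1) * (h \<bullet> b) ^ N w b)"
      by (rule prod.cong) (auto simp: N_def)
    also have "\<dots> = (if fst l then h \<bullet> basis_vec (snd l) else 1) * (\<Prod>b\<in>Basis. (h \<bullet> b) ^ N w b)"
      using mem by (simp add: prod.distrib)
    finally show ?case
      using Cons by (simp add: word_value_def letter_value_def all_ones_inner [OF mem])
  qed (simp add: N_def word_value_def)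
  then show ?thesis by (simp add: h_exponent_def N_def)
qed

lemma cnorm1_word_gen: "cnorm1 (word_gen w) \<le> 1"
proof (induction w)
  case (Cons l w)
  have "cnorm1 (word_gen (l # w)) \<le> cnorm1 (basis_gen (snd l)) * cnorm1 (word_gen w)"
    unfolding word_gen_def by (simp add: cnorm1_times)
  also have "cnorm1 (basis_gen (snd l)) = 1" by (simp add: basis_gen_def split: option.split)
  finally show ?case using Cons by simp
qed (simp add: word_gen_def)

lemma sum_abs_word_value:
  "(\<Sum>w | length w = n. \<bar>word_value a h w\<bar>) = (\<Sum>l\<in>UNIV. \<bar>letter_value a h l\<bar>) ^ n"
proof (induction n)
  case (Suc n)
  have "(\<Sum>w | length w = Suc n. \<bar>word_value a h w\<bar>) =
      (\<Sum>l\<in>UNIV. \<bar>letter_value a h l\<bar> * (\<Sum>w | length w = n. \<bar>word_value a h w\<bar>))"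
    unfolding sum_words_Suc sum_distrib_left by (simp add: word_value_def abs_mult)
  then show ?case by (simp only: Suc power_Suc sum_distrib_right)
qed (simp add: word_value_def)

lemma has_sum_words:
  fixes f :: "'a::finite list \<Rightarrow> 'b::banach"
  assumes f: "(\<lambda>w. norm (f w)) summable_on UNIV" and s: "(\<lambda>n. \<Sum>w | length w = n. f w) sums S"
  shows "(f has_sum S) UNIV"
proof -
  have bij: "bij_betw snd (Sigma UNIV (\<lambda>n. {w :: 'a list. length w = n})) UNIV"
    by (rule bij_betwI [where g = "\<lambda>w. (length w, w)"]) auto
  obtain S' where S': "(f has_sum S') UNIV"
    using abs_summable_summable [OF f] by (auto simp: summable_on_def)
  then have "((\<lambda>p. f (snd p)) has_sum S') (Sigma UNIV (\<lambda>n. {w :: 'a list. length w = n}))"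
    by (simp add: has_sum_reindex_bij_betw [OF bij])
  then have "((\<lambda>n. \<Sum>w | length w = n. f w) has_sum S') UNIV"
    by (rule has_sum_SigmaD) (auto intro: has_sum_finite finite_words_length)
  then have "S' = S" using s has_sum_imp_sums sums_unique2 by blast
  then show ?thesis using S' by simp
qed

lemma summable_on_words:
  fixes f :: "'a::finite list \<Rightarrow> real"
  assumes f: "\<And>w. 0 \<le> f w" and s: "summable (\<lambda>n. \<Sum>w | length w = n. f w)"
  shows "f summable_on UNIV"
proof -
  have bij: "bij_betw snd (Sigma UNIV (\<lambda>n. {w :: 'a list. length w = n})) UNIV"
    by (rule bij_betwI [where g = "\<lambda>w. (length w, w)"]) auto
  have "(\<lambda>p. f (snd p)) summable_on (Sigma UNIV (\<lambda>n. {w :: 'a list. length w = n}))"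
  proof (rule summable_on_SigmaI)
    show "(\<lambda>n. \<Sum>w | length w = n. f w) summable_on UNIV"
      using s by (subst summable_on_UNIV_nonneg_real_iff) (auto intro: sum_nonneg f)
  qed (auto intro: has_sum_finite finite_words_length f)
  then show ?thesis by (simp add: summable_on_reindex_bij_betw [OF bij])
qed

text \<open>
  The radius \<open>1\<close> serves at every point: then the monomials in \<open>h\<close> are bounded by \<open>1\<close>, and the family
  of all words is absolutely summable for \<open>h = all_ones\<close>.
\<close>

lemma real_analytic_ck_series:
  fixes a :: "nat \<Rightarrow> 'n::{finite,linorder} cliff"
  assumes a: "entire_coeffs a"
  shows "real_analytic (ck_series a)"
  unfolding real_analytic_def
proof (intro allI exI conjI impI)
  fix p :: "'n para"
  define U where "U = (\<lambda>w. (ck_weight CARD('n) (vec_count w) * word_value p all_ones w) *\<^sub>R (word_gen w * a (length w)))"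
  define \<rho> where "\<rho> = (\<Sum>l\<in>UNIV. \<bar>letter_value p all_ones l\<bar>)"
  have "(\<lambda>w. \<bar>word_value p all_ones w\<bar> * cnorm1 (a (length w))) summable_on UNIV"
  proof (rule summable_on_words)
    have "(\<Sum>w | length w = n. \<bar>word_value p all_ones w\<bar> * cnorm1 (a (length w))) = \<rho> ^ n * cnorm1 (a n)" for n
      by (simp add: \<rho>_def sum_abs_word_value [symmetric] sum_distrib_right)
    moreover have "summable (\<lambda>n. \<rho> ^ n * cnorm1 (a n))"
      by (rule entire_coeffs_cnorm1 [OF a]) (simp add: \<rho>_def sum_nonneg)
    ultimately show "summable (\<lambda>n. \<Sum>w | length w = n. \<bar>word_value p all_ones w\<bar> * cnorm1 (a (length w)))"
      by simp
  qed simp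
  moreover have "norm (U w) \<le> \<bar>word_value p all_ones w\<bar> * cnorm1 (a (length w))" for w
  proof -
    have "cnorm1 (word_gen w * a (length w)) \<le> 1 * cnorm1 (a (length w))"
      by (rule order_trans [OF cnorm1_times]) (intro mult_right_mono cnorm1_word_gen cnorm1_nonneg)
    moreover have "\<bar>ck_weight CARD('n) (vec_count w)\<bar> \<le> 1"
      using ck_weight_bounds [OF one_le_card [where 'n = 'n], of "vec_count w"] by simp
    ultimately have "\<bar>ck_weight CARD('n) (vec_count w)\<bar> * (\<bar>word_value p all_ones w\<bar> * cnorm1 (word_gen w * a (length w)))
        \<le> 1 * (\<bar>word_value p all_ones w\<bar> * cnorm1 (a (length w)))"
      by (intro mult_mono) simp_all
    then have "cnorm1 (U w) \<le> \<bar>word_value p all_ones w\<bar> * cnorm1 (a (length w))"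
      by (simp add: U_def abs_mult)
    then show ?thesis by (rule order_trans [OF norm_le_cnorm1])
  qed
  ultimately have U: "(\<lambda>w. norm (U w)) summable_on UNIV"
    by (rule summable_on_comparison_test) simp_all
  define c where "c = (\<lambda>\<alpha>. infsum U {w. h_exponent w = \<alpha>})"
  show "0 < (1 :: real)" by simp
  fix h :: "'n para" assume h: "norm h < 1"
  define m where "m = (\<lambda>\<alpha> :: 'n para \<Rightarrow> nat. \<Prod>b\<in>Basis. (h \<bullet> b) ^ \<alpha> b)"
  have m1: "\<bar>m \<alpha>\<bar> \<le> 1" for \<alpha>
    unfolding m_def abs_prod power_abs
  proof (intro prod_le_1 conjI power_le_one zero_le_power abs_ge_zero)
    fix b :: "'n para" assume "b \<in> Basis"
    from Basis_le_norm [OF this, of h] h show "\<bar>h \<bullet> b\<bar> \<le> 1" by linarith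
  qed
  have mU: "(\<lambda>w. norm (m (h_exponent w) *\<^sub>R U w)) summable_on UNIV"
    by (rule summable_on_comparison_test [OF U]) (simp_all add: mult_left_le_one_le m1)
  have "((\<lambda>w. m (h_exponent w) *\<^sub>R U w) has_sum ck_series a (p + h)) UNIV"
  proof (rule has_sum_words [OF mU])
    have "ck_poly n (p + h) * a n = (\<Sum>w | length w = n. m (h_exponent w) *\<^sub>R U w)" for n
      unfolding ck_poly_def binomial_sum_words sum_distrib_right
      by (rule sum.cong) (auto simp: U_def word_value_split [of p h] m_def mult_ac)
    then show "(\<lambda>n. \<Sum>w | length w = n. m (h_exponent w) *\<^sub>R U w) sums ck_series a (p + h)"
      using ck_series_sums(1) [OF a, of "p + h"] by simp
  qed
  moreover have bij: "bij_betw snd (Sigma (Basis \<rightarrow>\<^sub>E UNIV) (\<lambda>\<alpha>. {w :: 'n word. h_exponent w = \<alpha>})) UNIV"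
    by (rule bij_betwI [where g = "\<lambda>w. (h_exponent w, w)"]) (auto simp: h_exponent_mem)
  ultimately have "((\<lambda>q. m (h_exponent (snd q)) *\<^sub>R U (snd q)) has_sum ck_series a (p + h))
      (Sigma (Basis \<rightarrow>\<^sub>E UNIV) (\<lambda>\<alpha>. {w :: 'n word. h_exponent w = \<alpha>}))"
    by (simp add: has_sum_reindex_bij_betw [OF bij, of "\<lambda>w. m (h_exponent w) *\<^sub>R U w"])
  then have "((\<lambda>\<alpha>. m \<alpha> *\<^sub>R c \<alpha>) has_sum ck_series a (p + h)) (Basis \<rightarrow>\<^sub>E UNIV)"
  proof (rule has_sum_SigmaD)
    fix \<alpha> :: "'n para \<Rightarrow> nat"
    have "U summable_on {w. h_exponent w = \<alpha>}"
      by (rule abs_summable_summable) (rule summable_on_subset_banach [OF U], simp)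
    then have "(U has_sum c \<alpha>) {w. h_exponent w = \<alpha>}" by (simp add: c_def)
    then have "((\<lambda>w. m \<alpha> *\<^sub>R U w) has_sum m \<alpha> *\<^sub>R c \<alpha>) {w. h_exponent w = \<alpha>}"
      by (rule has_sum_scaleR)
    moreover have "((\<lambda>w. m (h_exponent w) *\<^sub>R U w) has_sum m \<alpha> *\<^sub>R c \<alpha>) {w. h_exponent w = \<alpha>} \<longleftrightarrow>
        ((\<lambda>w. m \<alpha> *\<^sub>R U w) has_sum m \<alpha> *\<^sub>R c \<alpha>) {w. h_exponent w = \<alpha>}"
      by (rule has_sum_cong) simp
    ultimately show "((\<lambda>w. m (h_exponent (snd (\<alpha>, w))) *\<^sub>R U (snd (\<alpha>, w))) has_sum m \<alpha> *\<^sub>R c \<alpha>) {w. h_exponent w = \<alpha>}"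
      by simp
  qed
  then show "((\<lambda>\<alpha>. (\<Prod>b\<in>Basis. (h \<bullet> b) ^ \<alpha> b) *\<^sub>R c \<alpha>) has_sum ck_series a (p + h)) (Basis \<rightarrow>\<^sub>E UNIV)"
    by (simp add: m_def)
qed

section \<open>Uniqueness of the axially monogenic extension\<close>

text \<open>
  The inner sums converge because a summable family is summable on every row; the row is taken at
  \<open>t = \<rho> / 2\<close>, where the factor \<open>t ^ q\<close> can be divided out.
\<close>

lemma double_powser_rows:
  fixes D :: "nat \<Rightarrow> nat \<Rightarrow> 'b::banach"
  assumes "0 < \<rho>"
    and f: "\<And>h t. \<bar>h\<bar> < \<rho> \<Longrightarrow> \<bar>t\<bar> < \<rho> \<Longrightarrow> ((\<lambda>(p, q). (h ^ p * t ^ q) *\<^sub>R D p q) has_sum f h t) UNIV"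
  shows "\<exists>G. \<forall>h t. \<bar>h\<bar> < \<rho> \<longrightarrow> \<bar>t\<bar> < \<rho> \<longrightarrow>
    (\<forall>q. (\<lambda>p. h ^ p *\<^sub>R D p q) sums G h q) \<and> (\<lambda>q. t ^ q *\<^sub>R G h q) sums f h t"
proof -
  define G where "G = (\<lambda>h q. \<Sum>\<^sub>\<infinity>p. h ^ p *\<^sub>R D p q)"
  have sw: "((\<lambda>(q, p). (h ^ p * t ^ q) *\<^sub>R D p q) has_sum f h t) (UNIV \<times> UNIV)"
    if "\<bar>h\<bar> < \<rho>" "\<bar>t\<bar> < \<rho>" for h t
    using f [OF that] has_sum_swap [where f = "\<lambda>(p, q). (h ^ p * t ^ q) *\<^sub>R D p q" and S = "f h t" and A = UNIV and B = UNIV]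
    by simp
  have G: "((\<lambda>p. h ^ p *\<^sub>R D p q) has_sum G h q) UNIV" if "\<bar>h\<bar> < \<rho>" for h q
  proof -
    have "(\<lambda>(q, p). (h ^ p * (\<rho> / 2) ^ q) *\<^sub>R D p q) summable_on (UNIV \<times> UNIV)"
      using sw [OF that, of "\<rho> / 2"] \<open>0 < \<rho>\<close> by (auto simp: summable_on_def)
    then have "(\<lambda>(q, p). (h ^ p * (\<rho> / 2) ^ q) *\<^sub>R D p q) summable_on (Pair q ` UNIV)"
      by (rule summable_on_subset_banach) auto
    then have "(\<lambda>p. (h ^ p * (\<rho> / 2) ^ q) *\<^sub>R D p q) summable_on UNIV"
      by (subst (asm) summable_on_reindex) (auto simp: o_def inj_on_def)
    then have "(\<lambda>p. (1 / (\<rho> / 2) ^ q) *\<^sub>R ((h ^ p * (\<rho> / 2) ^ q) *\<^sub>R D p q)) summable_on UNIV"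
      by (intro summable_on_scaleR_right)
    moreover have "(1 / (\<rho> / 2) ^ q) *\<^sub>R ((h ^ p * (\<rho> / 2) ^ q) *\<^sub>R D p q) = h ^ p *\<^sub>R D p q" for p
      using \<open>0 < \<rho>\<close> by simp
    ultimately have "(\<lambda>p. h ^ p *\<^sub>R D p q) summable_on UNIV" by (simp only:)
    then show ?thesis by (simp add: G_def)
  qed
  have "(\<lambda>q. t ^ q *\<^sub>R G h q) sums f h t" if "\<bar>h\<bar> < \<rho>" "\<bar>t\<bar> < \<rho>" for h t
  proof (rule has_sum_imp_sums, rule has_sum_SigmaD [OF sw [OF that]])
    fix q :: nat
    have "((\<lambda>p. t ^ q *\<^sub>R (h ^ p *\<^sub>R D p q)) has_sum t ^ q *\<^sub>R G h q) UNIV"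
      by (intro has_sum_scaleR G that)
    then show "((\<lambda>p. case (q, p) of (q, p) \<Rightarrow> (h ^ p * t ^ q) *\<^sub>R D p q) has_sum t ^ q *\<^sub>R G h q) UNIV"
      by (simp add: mult.commute)
  qed
  then show ?thesis using has_sum_imp_sums [OF G] by blast
qed

text \<open>
  In the plane of the real axis and one coordinate axis, every monomial involving another coordinate
  vanishes.
\<close>

lemma real_analytic_plane:
  fixes F :: "'n::{finite,linorder} para \<Rightarrow> 'n cliff" and i :: 'n
  assumes "real_analytic F"
  shows "\<exists>\<rho>>0. \<exists>D. \<forall>h t. \<bar>h\<bar> < \<rho> \<longrightarrow> \<bar>t\<bar> < \<rho> \<longrightarrow>
    ((\<lambda>(p, q). (h ^ p * t ^ q) *\<^sub>R D p q) has_sum F (s + h, t *\<^sub>R axis i 1)) UNIV"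
proof -
  obtain r C where "0 < r" and C0: "\<forall>h. norm h < r \<longrightarrow>
      ((\<lambda>\<alpha>. (\<Prod>b\<in>Basis. (h \<bullet> b) ^ \<alpha> b) *\<^sub>R C \<alpha>) has_sum F ((s, 0) + h)) (Basis \<rightarrow>\<^sub>E UNIV)"
    using assms [unfolded real_analytic_def, THEN spec, of "(s, 0)"] by (elim exE conjE) (rule that)
  then have C: "norm h < r \<Longrightarrow>
      ((\<lambda>\<alpha>. (\<Prod>b\<in>Basis. (h \<bullet> b) ^ \<alpha> b) *\<^sub>R C \<alpha>) has_sum F ((s, 0) + h)) (Basis \<rightarrow>\<^sub>E UNIV)" for h
    by blast
  define ab :: "nat \<times> nat \<Rightarrow> 'n para \<Rightarrow> nat" where
    "ab = (\<lambda>(p, q). restrict (\<lambda>b. if b = basis_vec None then p else if b = basis_vec (Some i) then q else 0) Basis)"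
  have mem: "basis_vec k \<in> (Basis :: 'n para set)" for k using range_basis_vec by blast
  have neq: "basis_vec k = (basis_vec l :: 'n para) \<longleftrightarrow> k = l" for k l
    using inj_basis_vec by (auto simp: inj_def)
  have ab_simps: "ab (p, q) (basis_vec None) = p" "ab (p, q) (basis_vec (Some j)) = (if j = i then q else 0)" for p q j
    by (simp_all add: ab_def mem neq)
  have inj: "inj ab"
  proof (rule injI, clarify)
    fix p q p' q'
    assume "ab (p, q) = ab (p', q')"
    then have "ab (p, q) (basis_vec None) = ab (p', q') (basis_vec None)"
      and "ab (p, q) (basis_vec (Some i)) = ab (p', q') (basis_vec (Some i))" by (simp_all only:)
    then show "p = p' \<and> q = q'" by (simp add: ab_simps)
  qed
  define P where "P = (\<lambda>h t \<alpha>. h ^ \<alpha> (basis_vec None) * (\<Prod>j\<in>UNIV. (if j = i then t else 0 :: real) ^ \<alpha> (basis_vec (Some j))))"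
  have P: "(\<Prod>b\<in>Basis. ((h, t *\<^sub>R axis i 1) \<bullet> b) ^ \<alpha> b) = P h t \<alpha>" for h t and \<alpha> :: "'n para \<Rightarrow> nat"
  proof -
    have "(\<Prod>b\<in>Basis. ((h, t *\<^sub>R axis i 1) \<bullet> b) ^ \<alpha> b) =
        (\<Prod>k\<in>UNIV. ((h, t *\<^sub>R axis i 1) \<bullet> basis_vec k) ^ \<alpha> (basis_vec k))"
      unfolding range_basis_vec [symmetric] by (subst prod.reindex) (simp_all add: inj_basis_vec)
    also have "\<dots> = P h t \<alpha>"
    proof -
      have "(t *\<^sub>R axis i 1) $ j = (if j = i then t else 0)" for j by (simp add: axis_def)
      then show ?thesis
        by (simp add: P_def UNIV_option_conv prod.reindex del: vector_scaleR_component)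
    qed
    finally show ?thesis .
  qed
  have P_ab: "P h t (ab (p, q)) = h ^ p * t ^ q" for h t p q
  proof -
    have "(\<Prod>j\<in>UNIV. (if j = i then t else 0 :: real) ^ (if j = i then q else 0)) = (\<Prod>j\<in>UNIV. if j = i then t ^ q else 1)"
      by (rule prod.cong) auto
    then show ?thesis by (simp add: P_def ab_simps)
  qed
  have P_zero: "P h t \<alpha> = 0" if \<alpha>: "\<alpha> \<in> (Basis \<rightarrow>\<^sub>E UNIV) - range ab" for h t \<alpha>
  proof -
    have "\<exists>j. j \<noteq> i \<and> \<alpha> (basis_vec (Some j)) \<noteq> 0"
    proof (rule ccontr)
      assume *: "\<not> ?thesis"
      have "\<alpha> = ab (\<alpha> (basis_vec None), \<alpha> (basis_vec (Some i)))"
      proof (rule PiE_ext)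
        show "\<alpha> \<in> Basis \<rightarrow>\<^sub>E UNIV" using \<alpha> by simp
        show "ab (\<alpha> (basis_vec None), \<alpha> (basis_vec (Some i))) \<in> Basis \<rightarrow>\<^sub>E UNIV" by (simp add: ab_def)
        fix b :: "'n para" assume "b \<in> Basis"
        then obtain k where k: "b = basis_vec k" using range_basis_vec by blast
        show "\<alpha> b = ab (\<alpha> (basis_vec None), \<alpha> (basis_vec (Some i))) b"
          using * unfolding k by (cases k) (auto simp: ab_simps)
      qed
      then show False using \<alpha> by blast
    qed
    then obtain j where "j \<noteq> i" "\<alpha> (basis_vec (Some j)) \<noteq> 0" by blast
    then have "(\<Prod>j\<in>UNIV. (if j = i then t else 0 :: real) ^ \<alpha> (basis_vec (Some j))) = 0"
      by (intro prod_zero) auto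
    then show ?thesis by (simp add: P_def)
  qed
  have "((\<lambda>(p, q). (h ^ p * t ^ q) *\<^sub>R C (ab (p, q))) has_sum F (s + h, t *\<^sub>R axis i 1)) UNIV"
    if "\<bar>h\<bar> < r / 2" "\<bar>t\<bar> < r / 2" for h t
  proof -
    have "norm (h, t *\<^sub>R axis i (1 :: real)) \<le> norm h + norm (t *\<^sub>R axis i (1 :: real))"
      by (rule norm_Pair_le)
    also have "\<dots> < r" using that by simp
    finally have "((\<lambda>\<alpha>. P h t \<alpha> *\<^sub>R C \<alpha>) has_sum F (s + h, t *\<^sub>R axis i 1)) (Basis \<rightarrow>\<^sub>E UNIV)"
      using C [of "(h, t *\<^sub>R axis i 1)"] unfolding P by simp
    also have "?this \<longleftrightarrow> ((\<lambda>\<alpha>. P h t \<alpha> *\<^sub>R C \<alpha>) has_sum F (s + h, t *\<^sub>R axis i 1)) (range ab)"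
      by (rule has_sum_cong_neutral) (auto simp: P_zero, auto simp: ab_def)
    also have "\<dots> \<longleftrightarrow> (((\<lambda>\<alpha>. P h t \<alpha> *\<^sub>R C \<alpha>) \<circ> ab) has_sum F (s + h, t *\<^sub>R axis i 1)) UNIV"
      by (rule has_sum_reindex [OF inj])
    also have "((\<lambda>\<alpha>. P h t \<alpha> *\<^sub>R C \<alpha>) \<circ> ab) = (\<lambda>(p, q). (h ^ p * t ^ q) *\<^sub>R C (ab (p, q)))"
      by (auto simp: fun_eq_iff P_ab)
    finally show ?thesis .
  qed
  then show ?thesis
    using \<open>0 < r\<close> by (intro exI [of _ "r / 2"] conjI exI [of _ "\<lambda>p q. C (ab (p, q))"]) simp_all
qed

text \<open>
  This is the uniqueness of the monogenic extension.  Let \<open>D p q\<close> be the coefficient of \<open>h ^ p t ^ q\<close> in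
  \<open>F(s + h, t e_i)\<close>.  Ordering by powers of \<open>t\<close> identifies the power series \<open>\<Sum>p. h ^ p D p q\<close> with
  \<open>e_i ^ q c q (s + h)\<close>, so \<open>c q\<close> is differentiable and its derivative is \<open>D 1 q\<close> up to the factor
  \<open>e_i ^ q\<close>.  Ordering by powers of \<open>h\<close> shows that the real partial derivative of \<open>F\<close> on the axis of
  \<open>e_i\<close> is \<open>\<Sum>q. t ^ q D 1 q\<close>.  By monogenicity this is minus the Dirac operator applied to \<open>F\<close>, whose
  coefficients are known in terms of \<open>c (Suc q)\<close>.
\<close>

lemma coefficient_derivative:
  fixes F :: "'n::{finite,linorder} para \<Rightarrow> 'n cliff"
  assumes ra: "real_analytic F" and mono: "monogenic F"
    and sums: "\<And>x. (\<lambda>j. vecpart (snd x) ^ j * c j (fst x)) sums F x"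
  shows "(c q has_vector_derivative dirac_factor CARD('n) (Suc q) *\<^sub>R c (Suc q) s) (at s)"
proof -
  define i :: 'n where "i = undefined"
  define g :: "'n cliff" where "g = gen i"
  \<comment> \<open>allows the factor \<open>e_i ^ q\<close> to be removed from the left\<close>
  have g_inv: "(- g) ^ q * (g ^ q * u) = u" for q u
  proof (induction q arbitrary: u)
    case (Suc q)
    have "(- g) ^ Suc q * (g ^ Suc q * u) = (- g) ^ q * ((- g) * g * (g ^ q * u))"
      by (simp only: power_Suc2 [of "- g"] power_Suc [of g] mult.assoc)
    also have "(- g) * g = 1" by (simp add: g_def gen_square)
    finally show ?case using Suc by simp
  qed simp
  have vp: "vecpart (t *\<^sub>R axis i 1) ^ q = t ^ q *\<^sub>R g ^ q" for t q
    by (simp add: vecpart_scaleR vecpart_axis g_def scaleR_power_cliff)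
  obtain \<rho> D where "0 < \<rho>" and D: "\<And>h t. \<bar>h\<bar> < \<rho> \<Longrightarrow> \<bar>t\<bar> < \<rho> \<Longrightarrow>
      ((\<lambda>(p, q). (h ^ p * t ^ q) *\<^sub>R D p q) has_sum F (s + h, t *\<^sub>R axis i 1)) UNIV"
    using real_analytic_plane [OF ra] by blast
  obtain G where G: "\<forall>h t. \<bar>h\<bar> < \<rho> \<longrightarrow> \<bar>t\<bar> < \<rho> \<longrightarrow>
      (\<forall>q. (\<lambda>p. h ^ p *\<^sub>R D p q) sums G h q) \<and> (\<lambda>q. t ^ q *\<^sub>R G h q) sums F (s + h, t *\<^sub>R axis i 1)"
    using double_powser_rows [OF \<open>0 < \<rho>\<close> D] by (rule exE)
  have "((\<lambda>(q, p). (t ^ q * h ^ p) *\<^sub>R D p q) has_sum F (s + h, t *\<^sub>R axis i 1)) UNIV"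
    if "\<bar>t\<bar> < \<rho>" "\<bar>h\<bar> < \<rho>" for h t
    using D [OF that(2,1)] has_sum_swap [where f = "\<lambda>(p, q). (h ^ p * t ^ q) *\<^sub>R D p q" and A = UNIV and B = UNIV]
    by (simp add: mult.commute)
  from double_powser_rows [OF \<open>0 < \<rho>\<close> this]
  obtain K where K: "\<forall>t h. \<bar>t\<bar> < \<rho> \<longrightarrow> \<bar>h\<bar> < \<rho> \<longrightarrow>
      (\<forall>p. (\<lambda>q. t ^ q *\<^sub>R D p q) sums K t p) \<and> (\<lambda>p. h ^ p *\<^sub>R K t p) sums F (s + h, t *\<^sub>R axis i 1)"
    by (rule exE)
  have Gc: "G h q = g ^ q * c q (s + h)" if h: "\<bar>h\<bar> < \<rho>" for h q
  proof -
    have "G h q - g ^ q * c q (s + h) = 0"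
    proof (rule powser_zero_imp_coeff_zero [OF \<open>0 < \<rho>\<close>])
      fix t :: real assume t: "t \<noteq> 0" "\<bar>t\<bar> < \<rho>"
      have "(\<lambda>q. t ^ q *\<^sub>R (g ^ q * c q (s + h))) sums F (s + h, t *\<^sub>R axis i 1)"
        using sums [of "(s + h, t *\<^sub>R axis i 1)"] by (simp add: vp)
      moreover have "(\<lambda>q. t ^ q *\<^sub>R G h q) sums F (s + h, t *\<^sub>R axis i 1)" using G h t by simp
      ultimately have "(\<lambda>q. t ^ q *\<^sub>R G h q - t ^ q *\<^sub>R (g ^ q * c q (s + h))) sums
          (F (s + h, t *\<^sub>R axis i 1) - F (s + h, t *\<^sub>R axis i 1))"
        by (intro sums_diff)
      then show "(\<lambda>q. t ^ q *\<^sub>R (G h q - g ^ q * c q (s + h))) sums 0"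
        by (simp add: scaleR_diff_right)
    qed
    then show ?thesis by simp
  qed
  have "((\<lambda>h. g ^ q * c q (s + h)) has_vector_derivative D 1 q) (at 0)"
    by (rule has_vector_derivative_powser_0 [OF \<open>0 < \<rho>\<close>, of "\<lambda>p. D p q"])
      (use G [THEN spec, THEN spec [of _ 0]] \<open>0 < \<rho>\<close> in \<open>simp add: Gc\<close>)
  from bounded_linear.has_vector_derivative [OF bounded_linear_times_right_cliff this, of "(- g) ^ q"]
  have "((\<lambda>h. c q (s + h)) has_vector_derivative (- g) ^ q * D 1 q) (at 0)"
    by (simp add: g_inv)
  then have dc: "(c q has_vector_derivative (- g) ^ q * D 1 q) (at s)"
    using has_vector_derivative_shift [of "c q" s _ 0] by simp
  have "D 1 q - dirac_factor CARD('n) (Suc q) *\<^sub>R (g ^ q * c (Suc q) s) = 0"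
  proof (rule powser_zero_imp_coeff_zero [OF \<open>0 < \<rho>\<close>,
        where b = "\<lambda>q. D 1 q - dirac_factor CARD('n) (Suc q) *\<^sub>R (g ^ q * c (Suc q) s)"])
    fix t :: real assume t: "t \<noteq> 0" "\<bar>t\<bar> < \<rho>"
    define v :: "(real, 'n) vec" where "v = t *\<^sub>R axis i 1"
    have "((\<lambda>h. F (s + h, v)) has_vector_derivative K t 1) (at 0)"
      unfolding v_def
      by (rule has_vector_derivative_powser_0 [OF \<open>0 < \<rho>\<close>]) (use K t in simp)
    then have "partial (1, 0) F (s, v) = K t 1"
      unfolding partial_def by (intro vector_derivative_at) simp
    moreover have "partial (1, 0) F (s, v) + (\<Sum>j\<in>UNIV. gen j * partial (0, axis j 1) F (s, v)) = 0"
      using mono by (simp add: monogenic_def)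
    ultimately have "- (\<Sum>j\<in>UNIV. gen j * partial (0, axis j 1) F (s, v)) = K t 1"
      by (simp add: neg_eq_iff_add_eq_0 add.commute)
    moreover have "(\<lambda>j. vecpart w ^ j * c j s) sums F (s, w)" for w
      using sums [of "(s, w)"] by simp
    ultimately have "(\<lambda>j. dirac_factor CARD('n) (Suc j) *\<^sub>R (vecpart v ^ j * c (Suc j) s)) sums K t 1"
      using dirac_vecpart_series [of "\<lambda>j. c j s" F s v] by simp
    then have "(\<lambda>q. t ^ q *\<^sub>R (dirac_factor CARD('n) (Suc q) *\<^sub>R (g ^ q * c (Suc q) s))) sums K t 1"
      by (simp add: v_def vp mult_ac)
    moreover have "(\<lambda>q. t ^ q *\<^sub>R D 1 q) sums K t 1"
      using K [THEN spec [of _ t], THEN spec [of _ 0]] t \<open>0 < \<rho>\<close> by simp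
    ultimately have "(\<lambda>q. t ^ q *\<^sub>R D 1 q - t ^ q *\<^sub>R (dirac_factor CARD('n) (Suc q) *\<^sub>R (g ^ q * c (Suc q) s))) sums (K t 1 - K t 1)"
      by (intro sums_diff)
    then show "(\<lambda>q. t ^ q *\<^sub>R (D 1 q - dirac_factor CARD('n) (Suc q) *\<^sub>R (g ^ q * c (Suc q) s))) sums 0"
      by (simp add: scaleR_diff_right)
  qed
  then have "(- g) ^ q * D 1 q = dirac_factor CARD('n) (Suc q) *\<^sub>R c (Suc q) s"
    by (simp add: g_inv)
  with dc show ?thesis by simp
qed

lemma ck_series_real_axis:
  fixes a :: "nat \<Rightarrow> 'n::{finite,linorder} cliff"
  assumes a: "entire_coeffs a"
  shows "ck_series a (s, 0) = pseries a s"
proof -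
  have "(\<lambda>j. (vecpart 0 :: 'n cliff) ^ j * (nderiv j (pseries a) s /\<^sub>R dirac_fact CARD('n) j)) sums
      (\<Sum>j\<in>{0}. (vecpart 0 :: 'n cliff) ^ j * (nderiv j (pseries a) s /\<^sub>R dirac_fact CARD('n) j))"
    by (rule sums_finite) (simp_all add: power_0_left)
  then show ?thesis
    using sums_unique2 [OF ck_series_vecpart_sums [OF a, of 0 s]] by (simp add: nderiv_def)
qed

theorem GCK_pseries:
  fixes a :: "nat \<Rightarrow> 'n::{finite,linorder} cliff"
  assumes a: "entire_coeffs a"
  shows "GCK (pseries a) = ck_series a"
  unfolding GCK_def
proof (rule the_equality)
  show "axially_monogenic (ck_series a) \<and>
    (\<exists>c. \<forall>x. (\<lambda>j. vecpart (snd x) ^ j * c j (fst x)) sums ck_series a x) \<and> (\<forall>s. ck_series a (s, 0) = pseries a s)"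
    using real_analytic_ck_series [OF a] monogenic_ck_series [OF a] axial_ck_series [OF a]
      ck_series_sums(2) [OF a] ck_series_real_axis [OF a]
    by (auto simp: axially_monogenic_def
        intro!: exI [of _ "\<lambda>j s. nderiv j (pseries a) s /\<^sub>R dirac_fact CARD('n) j"])
next
  fix F :: "'n para \<Rightarrow> 'n cliff"
  assume F: "axially_monogenic F \<and> (\<exists>c. \<forall>x. (\<lambda>j. vecpart (snd x) ^ j * c j (fst x)) sums F x) \<and>
    (\<forall>s. F (s, 0) = pseries a s)"
  then obtain c where c: "\<And>x. (\<lambda>j. vecpart (snd x) ^ j * c j (fst x)) sums F x" by blast
  have d: "(c q has_vector_derivative dirac_factor CARD('n) (Suc q) *\<^sub>R c (Suc q) s) (at s)" for q s
    using F by (intro coefficient_derivative [OF _ _ c]) (simp_all add: axially_monogenic_def)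
  have "c q = (\<lambda>s. nderiv q (pseries a) s /\<^sub>R dirac_fact CARD('n) q)" for q
  proof (induction q)
    case 0
    have "c 0 s = pseries a s" for s
    proof -
      have "(\<lambda>j. (vecpart 0 :: 'n cliff) ^ j * c j s) sums (\<Sum>j\<in>{0}. (vecpart 0 :: 'n cliff) ^ j * c j s)"
        by (rule sums_finite) (simp_all add: power_0_left)
      then have "F (s, 0) = c 0 s"
        using sums_unique2 [OF c [of "(s, 0)"]] by simp
      then show ?thesis using F by simp
    qed
    then show ?case by (simp add: nderiv_def fun_eq_iff)
  next
    case (Suc q)
    show ?case
    proof
      fix s
      have nz: "dirac_factor CARD('n) (Suc q) \<noteq> 0"
        using dirac_factor_ge [OF one_le_card [where 'n = 'n], of "Suc q"] by auto
      define d' where "d' = (\<lambda>n. (fact (n + q) / fact n :: real) *\<^sub>R a (n + q))"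
      have e': "entire_coeffs d'" unfolding d'_def by (rule nderiv_pseries [OF a])
      have 1: "nderiv q (pseries a) = pseries d'" unfolding d'_def by (rule nderiv_pseries [OF a])
      have 2: "nderiv (Suc q) (pseries a) s = pseries (\<lambda>n. real (Suc n) *\<^sub>R d' (Suc n)) s"
        unfolding nderiv_Suc 1 by (rule vector_derivative_at [OF has_vector_derivative_pseries [OF e']])
      have dq: "(nderiv q (pseries a) has_vector_derivative nderiv (Suc q) (pseries a) s) (at s)"
        unfolding 1 2 by (rule has_vector_derivative_pseries [OF e'])
      have "(c q has_vector_derivative nderiv (Suc q) (pseries a) s /\<^sub>R dirac_fact CARD('n) q) (at s)"
        unfolding Suc by (rule bounded_linear.has_vector_derivative [OF bounded_linear_scaleR_right dq])
      from vector_derivative_unique_at [OF d this]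
      have "dirac_factor CARD('n) (Suc q) *\<^sub>R c (Suc q) s = nderiv (Suc q) (pseries a) s /\<^sub>R dirac_fact CARD('n) q" .
      then have "inverse (dirac_factor CARD('n) (Suc q)) *\<^sub>R dirac_factor CARD('n) (Suc q) *\<^sub>R c (Suc q) s =
          inverse (dirac_factor CARD('n) (Suc q)) *\<^sub>R (nderiv (Suc q) (pseries a) s /\<^sub>R dirac_fact CARD('n) q)"
        by simp
      then show "c (Suc q) s = nderiv (Suc q) (pseries a) s /\<^sub>R dirac_fact CARD('n) (Suc q)"
        using nz by simp
    qed
  qed
  then show "F = ck_series a"
    using sums_unique2 [OF c] ck_series_sums(2) [OF a] by (intro ext) simp
qed

section \<open>Derivatives of the Cauchy kernel and their Kelvin transforms\<close>

definition half_binomial :: "nat \<Rightarrow> nat \<Rightarrow> real" where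
  "half_binomial m k = pochhammer ((real m + 1) / 2) k / fact k"

lemma half_binomial_Suc: "2 * real (Suc k) * half_binomial m (Suc k) = (real m + 1 + 2 * real k) * half_binomial m k"
proof -
  have "half_binomial m (Suc k) = half_binomial m k * (((real m + 1) / 2 + real k) / real (Suc k))"
    by (simp add: half_binomial_def pochhammer_Suc del: of_nat_Suc)
  then show ?thesis by (simp add: field_simps del: of_nat_Suc)
qed

text \<open>
  The coefficient of \<open>w ^ j\<close> in \<open>(1 + w) (1 - w\<^sup>2) powr (- (m + 1) / 2)\<close>.  This function is what remains
  of the Cauchy kernel at \<open>1 - t x\<close> after a power of \<open>1 - t s\<close> has been split off, with
  \<open>w = t v / (1 - t s)\<close>.
\<close>

definition axis_coeff :: "nat \<Rightarrow> nat \<Rightarrow> real" where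
  "axis_coeff m j = half_binomial m (j div 2)"

lemma axis_coeff_rec:
  "real (Suc (Suc n)) * axis_coeff m (Suc (Suc n)) = axis_coeff m (Suc n) + (real n + real m) * axis_coeff m n"
proof (cases "even n")
  case True
  then obtain k where n: "n = 2 * k" by blast
  then show ?thesis using half_binomial_Suc [of k m] by (simp add: axis_coeff_def algebra_simps)
next
  case False
  then obtain k where n: "n = 2 * k + 1" by (blast elim: oddE)
  then show ?thesis using half_binomial_Suc [of k m] by (simp add: axis_coeff_def algebra_simps)
qed

lemma axis_coeff_dirac_fact:
  assumes "1 \<le> m"
  shows "axis_coeff m j * dirac_fact m j = fact (m + j - 1) / fact (m - 1)"
proof (induction j)
  case 0
  then show ?case by (simp add: axis_coeff_def half_binomial_def)
next
  case (Suc j)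
  have "axis_coeff m (Suc j) * dirac_factor m (Suc j) = (real m + real j) * axis_coeff m j"
  proof (cases "even j")
    case True
    then obtain k where n: "j = 2 * k" by blast
    then show ?thesis by (simp add: axis_coeff_def dirac_factor_def algebra_simps)
  next
    case False
    then obtain k where n: "j = 2 * k + 1" by (blast elim: oddE)
    then show ?thesis using half_binomial_Suc [of k m] by (simp add: axis_coeff_def dirac_factor_def algebra_simps)
  qed
  then have "axis_coeff m (Suc j) * dirac_fact m (Suc j) = (real m + real j) * (axis_coeff m j * dirac_fact m j)"
    by (simp add: mult.assoc [symmetric])
  also have "\<dots> = (real m + real j) * fact (m + j - 1) / fact (m - 1)" using Suc by simp
  also have "(real m + real j) * fact (m + j - 1) = fact (m + Suc j - 1)"
  proof -
    obtain l where "m = Suc l" using assms by (cases m) auto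
    then show ?thesis by simp
  qed
  finally show ?case .
qed

definition kelvin_coeff :: "nat \<Rightarrow> nat \<Rightarrow> nat \<Rightarrow> real" where
  "kelvin_coeff m n j = axis_coeff m j * real ((n + m - 1) choose (n - j))"

text \<open>
  Both sides are the same quotient of factorials, by \<open>axis_coeff_dirac_fact\<close>.
\<close>

lemma kelvin_coeff_eq:
  assumes m: "1 \<le> m" and j: "j \<le> n"
  shows "kelvin_coeff m n j = real ((n + m - 1) choose n) * (real (n choose j) * ck_weight m j)"
proof -
  have pos: "dirac_fact m j \<noteq> 0" using dirac_fact_pos [OF m, of j] by simp
  have "kelvin_coeff m n j * dirac_fact m j = fact (m + j - 1) / fact (m - 1) * real ((n + m - 1) choose (n - j))"
    unfolding axis_coeff_dirac_fact [OF m, of j, symmetric] by (simp add: kelvin_coeff_def)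
  also have "real ((n + m - 1) choose (n - j)) = fact (n + m - 1) / (fact (n - j) * fact (m + j - 1))"
    using m j by (subst binomial_fact) (auto simp: algebra_simps)
  also have "fact (m + j - 1) / fact (m - 1) * (fact (n + m - 1) / (fact (n - j) * fact (m + j - 1))) =
      (fact (n + m - 1) / (fact n * fact (m - 1))) * (fact n / (fact j * fact (n - j)) * (fact j :: real))"
    by simp
  also have "fact (n + m - 1) / (fact n * fact (m - 1)) = real ((n + m - 1) choose n)"
    using m by (subst binomial_fact) auto
  also have "fact n / (fact j * fact (n - j)) = real (n choose j)"
    using j by (subst binomial_fact) auto
  finally show ?thesis using pos by (simp add: ck_weight_def field_simps)
qed

text \<open>
  For \<open>z = s + \<i> r\<close> and \<open>u = \<i> r\<close> this is the coefficient of \<open>t ^ n\<close> in the Cauchy kernel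
  \<open>cnj w / \<bar>w\<bar> ^ (m + 1)\<close> at \<open>w = 1 - t z\<close>.
\<close>

definition kelvin_poly :: "nat \<Rightarrow> nat \<Rightarrow> complex \<Rightarrow> real \<Rightarrow> complex" where
  "kelvin_poly m n u s = (\<Sum>j\<le>n. of_real (kelvin_coeff m n j * s ^ (n - j)) * u ^ j)"

definition kelvin_poly' :: "nat \<Rightarrow> nat \<Rightarrow> complex \<Rightarrow> real \<Rightarrow> complex" where
  "kelvin_poly' m n u s = (if n = 0 then 0 else of_nat (n + m - 1) * kelvin_poly m (n - 1) u s)"

lemma kelvin_poly_derivative:
  assumes "1 \<le> m"
  shows "(kelvin_poly m n u has_vector_derivative kelvin_poly' m n u s) (at s)"
proof (cases n)
  case 0
  then show ?thesis by (simp add: kelvin_poly_def [abs_def] kelvin_poly'_def)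
next
  case (Suc k)
  have "(kelvin_poly m n u has_vector_derivative
      (\<Sum>j\<le>n. of_real (kelvin_coeff m n j * (real (n - j) * s ^ (n - j - 1))) * u ^ j)) (at s)"
    unfolding kelvin_poly_def
    by (intro has_vector_derivative_sum has_vector_derivative_mult_left has_vector_derivative_of_real)
      (auto intro!: derivative_eq_intros simp flip: has_real_derivative_iff_has_vector_derivative)
  also have "(\<Sum>j\<le>n. of_real (kelvin_coeff m n j * (real (n - j) * s ^ (n - j - 1))) * u ^ j) =
      (\<Sum>j\<le>k. of_real (kelvin_coeff m n j * (real (n - j) * s ^ (n - j - 1))) * u ^ j)"
    by (simp add: Suc)
  also have "\<dots> = (\<Sum>j\<le>k. of_real (real (n + m - 1) * (kelvin_coeff m k j * s ^ (k - j))) * u ^ j)"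
  proof (rule sum.cong [OF refl])
    fix j assume "j \<in> {..k}"
    then have "n - j = Suc (k - j)" "n + m - 1 = Suc (k + m - 1)" using assms Suc by auto
    moreover have "real (Suc (k - j)) * real (Suc (k + m - 1) choose Suc (k - j)) =
        real (Suc (k + m - 1)) * real ((k + m - 1) choose (k - j))"
      by (simp only: of_nat_mult [symmetric] Suc_times_binomial)
    moreover have "kelvin_coeff m n j * real (n - j) = axis_coeff m j * (real (n - j) * real ((n + m - 1) choose (n - j)))"
      by (simp add: kelvin_coeff_def)
    ultimately have "kelvin_coeff m n j * real (n - j) = axis_coeff m j * (real (n + m - 1) * real ((k + m - 1) choose (k - j)))"
      by (simp only:)
    then have "kelvin_coeff m n j * real (n - j) = real (n + m - 1) * kelvin_coeff m k j"
      by (simp add: kelvin_coeff_def)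
    moreover have "n - j - 1 = k - j" using Suc by simp
    ultimately have e: "kelvin_coeff m n j * (real (n - j) * s ^ (n - j - 1)) = real (n + m - 1) * (kelvin_coeff m k j * s ^ (k - j))"
      by (simp only: mult.assoc [symmetric])
    show "of_real (kelvin_coeff m n j * (real (n - j) * s ^ (n - j - 1))) * u ^ j =
        of_real (real (n + m - 1) * (kelvin_coeff m k j * s ^ (k - j))) * u ^ j"
      unfolding e ..
  qed
  also have "\<dots> = kelvin_poly' m n u s"
    by (simp add: kelvin_poly'_def kelvin_poly_def Suc sum_distrib_left mult.assoc)
  finally show ?thesis .
qed

lemma kelvin_poly_0: "kelvin_poly m n u 0 = of_real (axis_coeff m n) * u ^ n"
proof -
  have "kelvin_poly m n u 0 = (\<Sum>j\<le>n. if j = n then of_real (axis_coeff m n) * u ^ n else 0)"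
    unfolding kelvin_poly_def by (rule sum.cong) (auto simp: kelvin_coeff_def)
  then show ?thesis by simp
qed

text \<open>
  In terms of the generating function this is its first-order differential equation in \<open>t\<close>.  It is
  proved by comparing derivatives with respect to \<open>s\<close>, which are proportional to the recurrence for the
  previous index, and values at \<open>s = 0\<close>, where it is \<open>axis_coeff_rec\<close>.
\<close>

lemma kelvin_poly_rec:
  assumes m: "1 \<le> m"
  shows "of_nat (Suc n) * kelvin_poly m (Suc n) u s =
    (of_real ((2 * real n + real m) * s) + u) * kelvin_poly m n u s - (of_real (s\<^sup>2) - u\<^sup>2) * kelvin_poly' m n u s"
proof (induction n arbitrary: s)
  case 0
  then show ?case using m by (simp add: kelvin_poly_def kelvin_poly'_def kelvin_coeff_def axis_coeff_def half_binomial_def)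
next
  case (Suc n)
  define \<phi> where "\<phi> = (\<lambda>s. of_nat (Suc (Suc n)) * kelvin_poly m (Suc (Suc n)) u s -
    ((of_real ((2 * real (Suc n) + real m) * s) + u) * kelvin_poly m (Suc n) u s -
     (of_real (s\<^sup>2) - u\<^sup>2) * (of_nat (n + m) * kelvin_poly m n u s)))"
  have p': "kelvin_poly' m (Suc n) u s = of_nat (n + m) * kelvin_poly m n u s" for s n
    by (simp add: kelvin_poly'_def)
  have "(\<phi> has_vector_derivative 0) (at s)" for s
  proof -
    have d: "(kelvin_poly m k u has_vector_derivative kelvin_poly' m k u s) (at s)" for k
      by (rule kelvin_poly_derivative [OF m])
    have l1: "((\<lambda>s. of_real ((2 * real (Suc n) + real m) * s) + u :: complex) has_vector_derivative
        of_real (2 * real (Suc n) + real m) + 0) (at s)"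
      by (intro has_vector_derivative_add has_vector_derivative_const has_vector_derivative_of_real)
        (auto intro!: derivative_eq_intros simp flip: has_real_derivative_iff_has_vector_derivative)
    have l2: "((\<lambda>s. of_real (s\<^sup>2) - u\<^sup>2 :: complex) has_vector_derivative of_real (2 * s) - 0) (at s)"
      by (intro has_vector_derivative_diff has_vector_derivative_const has_vector_derivative_of_real)
        (auto intro!: derivative_eq_intros simp flip: has_real_derivative_iff_has_vector_derivative)
    have "(\<phi> has_vector_derivative (of_nat (Suc (Suc n)) * kelvin_poly' m (Suc (Suc n)) u s -
        (((of_real ((2 * real (Suc n) + real m) * s) + u) * kelvin_poly' m (Suc n) u s +
          (of_real (2 * real (Suc n) + real m) + 0) * kelvin_poly m (Suc n) u s) -
         ((of_real (s\<^sup>2) - u\<^sup>2) * (of_nat (n + m) * kelvin_poly' m n u s) +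
          (of_real (2 * s) - 0) * (of_nat (n + m) * kelvin_poly m n u s))))) (at s)"
      unfolding \<phi>_def
      by (intro has_vector_derivative_diff has_vector_derivative_mult has_vector_derivative_mult_right d l1 l2)
    also have "(of_nat (Suc (Suc n)) * kelvin_poly' m (Suc (Suc n)) u s -
        (((of_real ((2 * real (Suc n) + real m) * s) + u) * kelvin_poly' m (Suc n) u s +
          (of_real (2 * real (Suc n) + real m) + 0) * kelvin_poly m (Suc n) u s) -
         ((of_real (s\<^sup>2) - u\<^sup>2) * (of_nat (n + m) * kelvin_poly' m n u s) +
          (of_real (2 * s) - 0) * (of_nat (n + m) * kelvin_poly m n u s)))) =
        of_nat (n + m) * (of_nat (Suc n) * kelvin_poly m (Suc n) u s -
          ((of_real ((2 * real n + real m) * s) + u) * kelvin_poly m n u s - (of_real (s\<^sup>2) - u\<^sup>2) * kelvin_poly' m n u s))"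
      unfolding p' by (simp add: algebra_simps)
    also have "\<dots> = 0" unfolding Suc by simp
    finally show ?thesis .
  qed
  then obtain K where "\<And>s. \<phi> s = K"
    using has_vector_derivative_zero_constant [of UNIV \<phi>] by auto
  then have "\<phi> s = \<phi> 0" for s by simp
  moreover have "\<phi> 0 = 0"
  proof -
    have "complex_of_real (real (Suc (Suc n)) * axis_coeff m (Suc (Suc n))) =
        of_real (axis_coeff m (Suc n) + (real n + real m) * axis_coeff m n)"
      by (simp only: axis_coeff_rec)
    then have "of_nat (Suc (Suc n)) * (of_real (axis_coeff m (Suc (Suc n))) * u ^ Suc (Suc n)) =
        u * (of_real (axis_coeff m (Suc n)) * u ^ Suc n) + u\<^sup>2 * (of_nat (n + m) * (of_real (axis_coeff m n) * u ^ n))"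
      by (simp add: power2_eq_square mult.assoc [symmetric] flip: distrib_right)
         (simp add: algebra_simps)
    then show ?thesis by (simp add: \<phi>_def kelvin_poly_0)
  qed
  ultimately have "\<phi> s = 0" by simp
  then show ?case by (simp add: \<phi>_def p')
qed

lemma kelvin_poly_homogeneous:
  "kelvin_poly m n (of_real c * u) (c * s) = of_real (c ^ n) * kelvin_poly m n u s"
  unfolding kelvin_poly_def sum_distrib_left
proof (rule sum.cong [OF refl])
  fix j assume "j \<in> {..n}"
  then have "c ^ n = c ^ (n - j) * c ^ j" by (simp flip: power_add)
  then show "of_real (kelvin_coeff m n j * (c * s) ^ (n - j)) * (of_real c * u) ^ j =
      complex_of_real (c ^ n) * (of_real (kelvin_coeff m n j * s ^ (n - j)) * u ^ j)"
    by (simp add: power_mult_distrib mult_ac)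
qed

text \<open>
  The \<open>n\<close>-th derivative of \<open>cnj z / \<bar>z\<bar> ^ (m + 1)\<close> with respect to the real part \<open>s\<close> of
  \<open>z = s + \<i> r\<close>.  The polynomial is evaluated at \<open>cnj z\<close>, whence the sign of \<open>\<i>\<close>.
\<close>

definition kernel_deriv :: "nat \<Rightarrow> nat \<Rightarrow> real \<Rightarrow> real \<Rightarrow> complex" where
  "kernel_deriv m n r s = of_real ((-1) ^ n * fact n) * (Complex s (- r) * kelvin_poly m n (- \<i> * of_real r) s *
     of_real (inverse (sqrt (s\<^sup>2 + r\<^sup>2) ^ (m + 1 + 2 * n))))"

text \<open>
  After a power of \<open>\<bar>z\<bar>\<close> and the factor \<open>cnj z\<close> have been removed, with \<open>\<bar>z\<bar>\<^sup>2 = z cnj z\<close>, the claim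
  is \<open>kelvin_poly_rec\<close>.
\<close>

lemma kernel_deriv_derivative:
  assumes m: "1 \<le> m" and pos: "0 < s\<^sup>2 + r\<^sup>2"
  shows "(kernel_deriv m n r has_vector_derivative kernel_deriv m (Suc n) r s) (at s)"
proof -
  define k where "k = m + 1 + 2 * n"
  define W where "W = s\<^sup>2 + r\<^sup>2"
  define u where "u = - \<i> * complex_of_real r"
  define q2 where "q2 = inverse (sqrt W ^ (k + 2))"
  define R where "R = kelvin_poly m n u s"
  define R' where "R' = kelvin_poly' m n u s"
  have W: "0 < W" using pos by (simp add: W_def)
  have q: "inverse (sqrt W ^ k) = W * q2"
    using W by (simp add: q2_def field_simps)
  have dq: "((\<lambda>s. inverse (sqrt (s\<^sup>2 + r\<^sup>2) ^ k)) has_real_derivative - real k * s * q2) (at s)"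
  proof -
    have "((\<lambda>s. sqrt (s\<^sup>2 + r\<^sup>2)) has_real_derivative s / sqrt W) (at s)"
      using W unfolding W_def by (auto intro!: derivative_eq_intros simp: field_simps)
    from DERIV_power [OF this, of k]
    have dk: "((\<lambda>s. sqrt (s\<^sup>2 + r\<^sup>2) ^ k) has_real_derivative real k * (s / sqrt W * sqrt W ^ (k - 1))) (at s)"
      by (simp add: W_def)
    have "sqrt W ^ k \<noteq> 0" using W by simp
    then have nz: "sqrt (s\<^sup>2 + r\<^sup>2) ^ k \<noteq> 0" unfolding W_def .
    have "((\<lambda>s. inverse (sqrt (s\<^sup>2 + r\<^sup>2) ^ k)) has_real_derivative
        - (inverse (sqrt W ^ k) * (real k * (s / sqrt W * sqrt W ^ (k - 1))) * inverse (sqrt W ^ k))) (at s)"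
      using DERIV_inverse' [OF dk nz] by (simp only: W_def)
    also have "real k * (s / sqrt W * sqrt W ^ (k - 1)) = real k * s * sqrt W ^ k * inverse W"
    proof -
      have "sqrt W ^ k = sqrt W ^ (k - 1) * sqrt W" by (cases k) (simp_all add: k_def)
      then show ?thesis using W by (simp add: field_simps)
    qed
    also have "- (inverse (sqrt W ^ k) * (real k * s * sqrt W ^ k * inverse W) * inverse (sqrt W ^ k)) = - real k * s * q2"
      using W unfolding q by (simp add: q2_def field_simps)
    finally show ?thesis .
  qed
  have dz: "((\<lambda>s. Complex s (- r)) has_vector_derivative 1) (at s)"
  proof -
    have "(\<lambda>s. Complex s (- r)) = (\<lambda>s. of_real s + Complex 0 (- r))" by (auto simp: complex_eq_iff)
    then show ?thesis by (auto intro!: derivative_eq_intros)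
  qed
  have "(kernel_deriv m n r has_vector_derivative of_real ((-1) ^ n * fact n) *
      (Complex s (- r) * R * of_real (- real k * s * q2) +
       (Complex s (- r) * R' + 1 * R) * of_real (inverse (sqrt W ^ k)))) (at s)"
    unfolding kernel_deriv_def k_def [symmetric] u_def [symmetric] R_def R'_def W_def
    by (intro has_vector_derivative_mult_right has_vector_derivative_mult kelvin_poly_derivative m dz
        has_vector_derivative_of_real dq)
  also have "of_real ((-1) ^ n * fact n) *
      (Complex s (- r) * R * of_real (- real k * s * q2) + (Complex s (- r) * R' + 1 * R) * of_real (inverse (sqrt W ^ k)))
    = kernel_deriv m (Suc n) r s"
  proof -
    have cW: "of_real W = Complex s (- r) * Complex s r"
      by (simp add: W_def complex_eq_iff power2_eq_square)
    have uW: "of_real (s\<^sup>2) - u\<^sup>2 = of_real W" by (simp add: W_def u_def power_mult_distrib)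
    have zu: "Complex s r = of_real s - u" by (simp add: u_def complex_eq_iff)
    have rec: "of_nat (Suc n) * kelvin_poly m (Suc n) u s = (of_real ((2 * real n + real m) * s) + u) * R - of_real W * R'"
      unfolding kelvin_poly_rec [OF m] R_def R'_def uW ..
    have "Complex s (- r) * R * of_real (- real k * s * q2) + (Complex s (- r) * R' + 1 * R) * of_real (inverse (sqrt W ^ k))
       = of_real q2 * Complex s (- r) * (of_real W * R' + Complex s r * R - of_real (real k * s) * R)"
      unfolding q of_real_mult [of W q2] cW by (simp add: algebra_simps)
    also have "of_real W * R' + Complex s r * R - of_real (real k * s) * R = - (of_nat (Suc n) * kelvin_poly m (Suc n) u s)"
      unfolding rec zu by (simp add: k_def algebra_simps)
    finally have E: "Complex s (- r) * R * of_real (- real k * s * q2) +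
        (Complex s (- r) * R' + 1 * R) * of_real (inverse (sqrt W ^ k)) =
        of_real q2 * Complex s (- r) * - (of_nat (Suc n) * kelvin_poly m (Suc n) u s)" .
    have "k + 2 = m + 1 + 2 * Suc n" by (simp add: k_def)
    then have "kernel_deriv m (Suc n) r s =
        of_real ((-1) ^ Suc n * fact (Suc n)) * (Complex s (- r) * kelvin_poly m (Suc n) u s * of_real q2)"
      by (simp only: kernel_deriv_def u_def W_def q2_def)
    then show ?thesis unfolding E by (simp add: algebra_simps)
  qed
  finally show ?thesis .
qed

text \<open>
  For a unit vector \<open>J\<close> the span of \<open>1\<close> and \<open>J\<close> is a copy of the complex numbers.  It contains the
  values of the Cauchy kernel at \<open>s + r J\<close> and of its derivatives along the real axis.
\<close>

definition plane :: "'n::{finite,linorder} cliff \<Rightarrow> complex \<Rightarrow> 'n cliff" where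
  "plane J z = Re z *\<^sub>R 1 + Im z *\<^sub>R J"

lemma bounded_linear_plane: "bounded_linear (plane J)"
  unfolding plane_def
  by (intro bounded_linear_add bounded_linear_compose [OF bounded_linear_scaleR_left] bounded_linear_Re bounded_linear_Im)

lemma plane_of_real [simp]: "plane J (of_real r) = r *\<^sub>R 1"
  by (simp add: plane_def)

lemma plane_mult: "J * J = - 1 \<Longrightarrow> plane J (z * w) = plane J z * plane J w"
  by (simp add: plane_def algebra_simps)

lemma plane_power: "J * J = - 1 \<Longrightarrow> plane J (z ^ n) = plane J z ^ n"
proof (induction n)
  case 0
  then show ?case using plane_of_real [of J 1] by simp
qed (simp add: plane_mult)

lemma plane_scaleR: "plane J (of_real r * z) = r *\<^sub>R plane J z"
  by (simp add: plane_def algebra_simps)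

lemma partial_kernel:
  fixes \<omega> :: "(real, 'n::{finite,linorder}) vec"
  assumes \<omega>: "norm \<omega> = 1" and pos: "0 < s\<^sup>2 + r\<^sup>2"
  shows "(partial (1, 0) ^^ n) (\<lambda>y :: 'n para. para (pconj y) /\<^sub>R norm y ^ (CARD('n) + 1)) (s, r *\<^sub>R \<omega>) =
    plane (vecpart \<omega>) (kernel_deriv CARD('n) n r s)"
  using pos
proof (induction n arbitrary: s)
  case 0
  have nrm: "norm (s, r *\<^sub>R \<omega>) = sqrt (s\<^sup>2 + r\<^sup>2)" using \<omega> by (simp add: norm_Pair)
  have "kernel_deriv CARD('n) 0 r s = of_real (inverse (sqrt (s\<^sup>2 + r\<^sup>2) ^ (CARD('n) + 1))) * Complex s (- r)"
    by (simp add: kernel_deriv_def kelvin_poly_def kelvin_coeff_def axis_coeff_def half_binomial_def)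
  then have "plane (vecpart \<omega>) (kernel_deriv CARD('n) 0 r s) =
      inverse (sqrt (s\<^sup>2 + r\<^sup>2) ^ (CARD('n) + 1)) *\<^sub>R plane (vecpart \<omega>) (Complex s (- r))"
    by (simp only: plane_scaleR)
  moreover have "plane (vecpart \<omega>) (Complex s (- r)) = para (pconj (s, r *\<^sub>R \<omega>))"
    using vecpart_scaleR [of "- r" \<omega>] by (simp add: plane_def para_def pconj_def of_real_def)
  ultimately show ?case unfolding nrm [symmetric] by simp
next
  case (Suc n)
  define E where "E = (partial (1, 0) ^^ n) (\<lambda>y :: 'n para. para (pconj y) /\<^sub>R norm y ^ (CARD('n) + 1))"
  have "((\<lambda>t. plane (vecpart \<omega>) (kernel_deriv CARD('n) n r (s + t))) has_vector_derivative
      plane (vecpart \<omega>) (kernel_deriv CARD('n) (Suc n) r s)) (at 0)"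
    using kernel_deriv_derivative [OF one_le_card [where 'n = 'n] Suc.prems, of n]
    by (intro bounded_linear.has_vector_derivative [OF bounded_linear_plane])
      (simp add: has_vector_derivative_shift)
  moreover have "open ((\<lambda>t. (s + t)\<^sup>2 + r\<^sup>2) -` {0<..})"
    by (intro open_vimage continuous_intros open_greaterThan)
  ultimately have "((\<lambda>t. E (s + t, r *\<^sub>R \<omega>)) has_vector_derivative
      plane (vecpart \<omega>) (kernel_deriv CARD('n) (Suc n) r s)) (at 0)"
    by (rule has_vector_derivative_transform_within_open) (use Suc in \<open>auto simp: E_def\<close>)
  then have "partial (1, 0) E (s, r *\<^sub>R \<omega>) = plane (vecpart \<omega>) (kernel_deriv CARD('n) (Suc n) r s)"
    unfolding partial_def by (intro vector_derivative_at) simp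
  then show ?case by (simp add: E_def)
qed

lemma plane_kelvin_poly:
  fixes \<omega> :: "(real, 'n::{finite,linorder}) vec"
  assumes J: "vecpart \<omega> * vecpart \<omega> = - 1"
  shows "plane (vecpart \<omega>) (kelvin_poly CARD('n) n (\<i> * of_real r) s) =
    real ((n + CARD('n) - 1) choose n) *\<^sub>R ck_poly n (s, r *\<^sub>R \<omega>)"
proof -
  have pi: "plane (vecpart \<omega>) (\<i> * of_real r) = vecpart (r *\<^sub>R \<omega>)"
    by (simp add: plane_def vecpart_scaleR)
  have "plane (vecpart \<omega>) (kelvin_poly CARD('n) n (\<i> * of_real r) s) =
      (\<Sum>j\<le>n. (kelvin_coeff CARD('n) n j * s ^ (n - j)) *\<^sub>R vecpart (r *\<^sub>R \<omega>) ^ j)"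
    unfolding kelvin_poly_def linear_sum [OF bounded_linear.linear [OF bounded_linear_plane]] plane_scaleR
      plane_power [OF J] pi ..
  also have "\<dots> = real ((n + CARD('n) - 1) choose n) *\<^sub>R ck_poly n (s, r *\<^sub>R \<omega>)"
    unfolding ck_poly_def scaleR_sum_right
    by (rule sum.cong) (simp_all add: kelvin_coeff_eq [OF one_le_card] mult_ac)
  finally show ?thesis .
qed

text \<open>
  The inversion maps \<open>z\<close> to \<open>1 / z\<close>, whose conjugate is \<open>z / \<bar>z\<bar>\<^sup>2\<close>.  Since \<open>kelvin_poly m n\<close> is
  homogeneous of degree \<open>n\<close>, all powers of \<open>\<bar>z\<bar>\<close> cancel.
\<close>

lemma kelvin_P_neg:
  fixes x :: "'n::{finite,linorder} para"
  assumes "x \<noteq> 0"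
  shows "kelvin (P_neg (n + 1)) x = (lambda_const CARD('n) * real ((n + CARD('n) - 1) choose n)) *\<^sub>R ck_poly n x"
proof -
  obtain s r and \<omega> :: "(real, 'n) vec" where \<omega>: "norm \<omega> = 1" and x: "x = (s, r *\<^sub>R \<omega>)"
  proof (cases "snd x = 0")
    case True
    then show thesis using that [of "axis undefined 1" "fst x" 0] by (cases x) simp
  next
    case False
    then show thesis using that [of "snd x /\<^sub>R norm (snd x)" "fst x" "norm (snd x)"] by (cases x) simp
  qed
  define J where "J = vecpart \<omega>"
  have J: "J * J = - 1" using \<omega> by (simp add: J_def vecpart_square)
  define m where "m = CARD('n)"
  define N where "N = s\<^sup>2 + r\<^sup>2"
  have N: "0 < N"
    using assms \<omega> unfolding x N_def by (auto simp: sum_power2_gt_zero_iff zero_prod_def)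
  have nrm: "norm x = sqrt N" using \<omega> by (simp add: x N_def norm_Pair)
  have inv: "pconj x /\<^sub>R (norm x)\<^sup>2 = (s / N, (- r / N) *\<^sub>R \<omega>)"
  proof -
    have "(norm x)\<^sup>2 = N" using N by (simp add: nrm)
    then show ?thesis by (simp add: x pconj_def divide_inverse mult.commute)
  qed
  have sq: "(s / N)\<^sup>2 + (- r / N)\<^sup>2 = 1 / N"
    using N by (simp add: power_divide N_def power2_eq_square add_divide_distrib [symmetric])
  have "0 < (s / N)\<^sup>2 + (- r / N)\<^sup>2" unfolding sq using N by simp
  from partial_kernel [OF \<omega> this, of n]
  have "P_neg (n + 1) (s / N, (- r / N) *\<^sub>R \<omega>) =
      ((-1) ^ n * lambda_const m / fact n) *\<^sub>R plane J (kernel_deriv m n (- r / N) (s / N))"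
    by (simp add: P_neg_def J_def m_def)
  also have "kernel_deriv m n (- r / N) (s / N) = of_real ((-1) ^ n * fact n) *
      (of_real (sqrt N ^ (m + 1) / N) * (Complex s r * kelvin_poly m n (\<i> * of_real r) s))"
  proof -
    have a: "kelvin_poly m n (- \<i> * of_real (- r / N)) (s / N) = of_real ((1 / N) ^ n) * kelvin_poly m n (\<i> * of_real r) s"
      using kelvin_poly_homogeneous [of m n "1 / N" "\<i> * of_real r" s] by simp
    have b: "Complex (s / N) (- (- r / N)) = of_real (1 / N) * Complex s r"
      by (simp add: complex_eq_iff)
    have c: "inverse (sqrt (1 / N) ^ (m + 1 + 2 * n)) = sqrt N ^ (m + 1) * N ^ n"
    proof -
      have "sqrt N ^ (2 * n) = N ^ n" using N by (simp add: power_mult)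
      then have "sqrt N ^ (m + 1 + 2 * n) = sqrt N ^ (m + 1) * N ^ n" by (simp only: power_add)
      then show ?thesis by (simp add: real_sqrt_divide power_divide)
    qed
    have "(1 / N) * (1 / N) ^ n * (sqrt N ^ (m + 1) * N ^ n) = sqrt N ^ (m + 1) / N"
      using N by (simp add: power_divide)
    from arg_cong [OF this, of complex_of_real]
    have "of_real (1 / N) * Complex s r * (of_real ((1 / N) ^ n) * K) * of_real (sqrt N ^ (m + 1) * N ^ n) =
        of_real (sqrt N ^ (m + 1) / N) * (Complex s r * K)" for K
      by (simp only: of_real_mult mult_ac)
    then show ?thesis unfolding kernel_deriv_def sq a b c by (simp only:)
  qed
  finally have P: "P_neg (n + 1) (s / N, (- r / N) *\<^sub>R \<omega>) = (lambda_const m * (sqrt N ^ (m + 1) / N)) *\<^sub>R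
      plane J (Complex s r * kelvin_poly m n (\<i> * of_real r) s)"
    unfolding plane_scaleR by (simp add: field_simps flip: power_mult_distrib)
  have "para (pconj x) = plane J (Complex s (- r))"
    using vecpart_scaleR [of "- r" \<omega>] by (simp add: x plane_def para_def pconj_def of_real_def J_def)
  then have "kelvin (P_neg (n + 1)) x = (lambda_const m * (sqrt N ^ (m + 1) / N) / sqrt N ^ (m + 1)) *\<^sub>R
      (plane J (Complex s (- r)) * plane J (Complex s r * kelvin_poly m n (\<i> * of_real r) s))"
    unfolding kelvin_def inv P unfolding nrm m_def [symmetric] by (simp add: divide_inverse)
  also have "plane J (Complex s (- r)) * plane J (Complex s r * kelvin_poly m n (\<i> * of_real r) s) =
      N *\<^sub>R plane J (kelvin_poly m n (\<i> * of_real r) s)"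
  proof -
    have "Complex s (- r) * (Complex s r * kelvin_poly m n (\<i> * of_real r) s) = of_real N * kelvin_poly m n (\<i> * of_real r) s"
      by (simp add: N_def complex_eq_iff power2_eq_square algebra_simps)
    then show ?thesis by (simp only: plane_mult [OF J, symmetric] plane_scaleR)
  qed
  also have "plane J (kelvin_poly m n (\<i> * of_real r) s) = real ((n + m - 1) choose n) *\<^sub>R ck_poly n x"
    using plane_kelvin_poly [of \<omega>] J by (simp add: J_def m_def x)
  finally show ?thesis using N by (simp add: m_def)
qed

lemma cnorm1_ck_poly:
  fixes x :: "'n::{finite,linorder} para"
  shows "cnorm1 (ck_poly n x) \<le> (cnorm1 (vecpart (snd x) :: 'n cliff) + \<bar>fst x\<bar>) ^ n"
proof -
  have "cnorm1 (ck_poly n x) \<le> (\<Sum>j\<le>n. real (n choose j) * cnorm1 (vecpart (snd x) :: 'n cliff) ^ j * \<bar>fst x\<bar> ^ (n - j))"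
    unfolding ck_poly_def
    by (intro order_trans [OF cnorm1_sum] sum_mono cnorm1_binomial_term ck_weight_bounds one_le_card)
  then show ?thesis by (simp add: binomial_ring)
qed

lemma tendsto_ck_poly_0: "(ck_poly n \<longlongrightarrow> ck_poly n (0 :: 'n::{finite,linorder} para)) (at 0)"
proof (cases "n = 0")
  case True
  have "ck_poly 0 = (\<lambda>x :: 'n para. 1)" by (simp add: fun_eq_iff ck_poly_def ck_weight_def)
  then show ?thesis using True by simp
next
  case False
  define g where "g = (\<lambda>x :: 'n para. (real CARD('n) * norm (snd x) + \<bar>fst x\<bar>) ^ n)"
  have ck0: "ck_poly n (0 :: 'n para) = 0"
    unfolding ck_poly_def using False by (intro sum.neutral ballI) (auto simp: power_0_left)
  have "continuous_on UNIV g" unfolding g_def by (intro continuous_intros)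
  then have "isCont g 0" by (rule continuous_on_interior) simp
  then have "(g \<longlongrightarrow> g 0) (at 0)" by (rule isContD)
  moreover have "g 0 = 0" using False by (simp add: g_def power_0_left)
  ultimately have g: "(g \<longlongrightarrow> 0) (at 0)" by (simp only:)
  have "norm (ck_poly n x) \<le> g x" for x :: "'n para"
  proof -
    have "(cnorm1 (vecpart (snd x) :: 'n cliff) + \<bar>fst x\<bar>) ^ n \<le> g x"
      unfolding g_def by (intro power_mono add_right_mono cnorm1_vecpart) simp
    then show ?thesis
      using norm_le_cnorm1 [of "ck_poly n x"] cnorm1_ck_poly [of n x] by linarith
  qed
  then have "eventually (\<lambda>x. norm (ck_poly n x) \<le> g x) (at (0 :: 'n para))"
    by (intro always_eventually allI)
  then show ?thesis unfolding ck0 using g by (rule Lim_null_comparison)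
qed

text \<open>
  At the origin, where \<open>P_pos\<close> is a limit, the polynomial is continuous.
\<close>

lemma P_pos_eq:
  "P_pos n x = (lambda_const CARD('n) * real ((n + CARD('n) - 1) choose n)) *\<^sub>R ck_poly n (x :: 'n::{finite,linorder} para)"
proof (cases "x = 0")
  case True
  define C where "C = lambda_const CARD('n) * real ((n + CARD('n) - 1) choose n)"
  have "((\<lambda>y. C *\<^sub>R ck_poly n y) \<longlongrightarrow> C *\<^sub>R ck_poly n (0 :: 'n para)) (at 0)"
    by (rule tendsto_scaleR [OF tendsto_const tendsto_ck_poly_0])
  moreover have "eventually (\<lambda>y :: 'n para. C *\<^sub>R ck_poly n y = kelvin (P_neg (n + 1)) y) (at 0)"
    unfolding eventually_at_filter C_def
    by (intro always_eventually allI impI, rule kelvin_P_neg [symmetric])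
  ultimately have "(kelvin (P_neg (n + 1)) \<longlongrightarrow> C *\<^sub>R ck_poly n (0 :: 'n para)) (at 0)"
    by (rule Lim_transform_eventually)
  then have "Lim (at 0) (kelvin (P_neg (n + 1))) = C *\<^sub>R ck_poly n (0 :: 'n para)"
    by (rule tendsto_Lim [rotated]) (rule trivial_limit_at)
  then show ?thesis unfolding True P_pos_def C_def by simp
next
  case False
  have "P_pos n x = kelvin (P_neg (n + 1)) x"
    unfolding P_pos_def by (rule if_not_P [OF False])
  also have "\<dots> = (lambda_const CARD('n) * real ((n + CARD('n) - 1) choose n)) *\<^sub>R ck_poly n x"
    by (rule kelvin_P_neg [OF False])
  finally show ?thesis .
qed

section \<open>The Fueter-Sce-Qian mapping of a slice extension\<close>

lemma slice_ext_sums: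
  fixes a :: "nat \<Rightarrow> 'n::{finite,linorder} cliff"
  assumes a: "entire_coeffs a"
  shows "(\<lambda>l. para x ^ l * a l) sums slice_ext (pseries a) x"
proof -
  obtain S where 1: "(\<lambda>n. para x ^ n * a n) sums S"
    and 2: "(\<lambda>j. vecpart (snd x) ^ j * ((1 / fact j) *\<^sub>R nderiv j (pseries a) (fst x))) sums S"
    using binomial_double_series [OF a, of "\<lambda>_. 1" "fst x" "vecpart (snd x)"]
    unfolding para_def binomial_cliff by auto
  have "slice_ext (pseries a) x = S"
    using 2 by (simp add: slice_ext_def sums_iff divide_inverse)
  with 1 show ?thesis by simp
qed

text \<open>
  On the real axis the series is an ordinary power series.
\<close>

lemma slice_coefficients_unique:
  fixes a :: "nat \<Rightarrow> 'n::{finite,linorder} cliff"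
  assumes a: "entire_coeffs a"
  shows "(THE b :: nat \<Rightarrow> 'n cliff. \<forall>y. (\<lambda>l. para y ^ l * b l) sums slice_ext (pseries a) y) = a"
proof (rule the_equality)
  show "\<forall>y. (\<lambda>l. para y ^ l * a l) sums slice_ext (pseries a) y"
    using slice_ext_sums [OF a] by blast
next
  fix b :: "nat \<Rightarrow> 'n cliff"
  assume b: "\<forall>y. (\<lambda>l. para y ^ l * b l) sums slice_ext (pseries a) y"
  have "b l - a l = 0" for l
  proof (rule powser_zero_imp_coeff_zero [OF zero_less_one, where b = "\<lambda>l. b l - a l"])
    fix t :: real
    have p: "para (t, 0 :: (real, 'n) vec) ^ l = t ^ l *\<^sub>R 1" for l
      by (simp add: para_def of_real_def scaleR_power_cliff)
    have "(\<lambda>l. para (t, 0 :: (real, 'n) vec) ^ l * b l - para (t, 0 :: (real, 'n) vec) ^ l * a l) sums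
        (slice_ext (pseries a) (t, 0) - slice_ext (pseries a) (t, 0))"
      by (intro sums_diff b [rule_format] slice_ext_sums [OF a])
    then show "(\<lambda>l. t ^ l *\<^sub>R (b l - a l)) sums 0"
      unfolding p by (simp add: scaleR_diff_right)
  qed
  then show "b = a" by (intro ext) simp
qed

lemma cscale_scaleR: "c *\<^sub>C (r *\<^sub>R u) = (c * of_real r) *\<^sub>C u"
  by (rule cliff_eqI) (simp add: scaleR_conv_of_real mult.assoc)

lemma gamma_const_eq: "gamma_const m * of_real c = minus_one_power m * of_real (lambda_const m * (c / fact (m - 1)))"
  by (simp add: gamma_const_def lambda_const_def)

text \<open>
  For \<open>l = n + m - 1\<close> one has \<open>(l choose n) = (l! / n!) / (m - 1)!\<close>.  The factor \<open>l! / n!\<close> belongs to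
  the derivative of order \<open>m - 1\<close>, the denominator to \<open>gamma_const\<close>.
\<close>

theorem tau_slice_ext:
  fixes a :: "nat \<Rightarrow> 'n::{finite,linorder} cliff"
  assumes a: "entire_coeffs a"
  shows "tau (slice_ext (pseries a)) x =
    gamma_const CARD('n) *\<^sub>C GCK (nderiv (CARD('n) - 1) (pseries a)) x"
proof -
  define m where "m = CARD('n)"
  have m: "1 \<le> m" unfolding m_def by (rule one_le_card)
  \<comment> \<open>\<open>b\<close> are the coefficients of the derivative of order \<open>m - 1\<close>\<close>
  define k where "k = m - 1"
  define b where "b = (\<lambda>n. (fact (n + k) / fact n :: real) *\<^sub>R a (n + k))"
  have b: "entire_coeffs b" and pb: "nderiv k (pseries a) = pseries b"
    unfolding b_def by (rule nderiv_pseries [OF a])+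
  define T where "T = (\<lambda>l. tau_monomial l x * a l)"
  have "T (n + k) = gamma_const m *\<^sub>C (ck_poly n x * b n)" for n
  proof -
    have nk: "n + k + 1 - m = n" "n + m - 1 = n + k" using m by (simp_all add: k_def)
    have "\<not> n + k + 1 < m" using m by (simp add: k_def)
    then have "tau_monomial (n + k) x = minus_one_power m *\<^sub>C P_pos n x"
      unfolding tau_monomial_def m_def [symmetric] nk by (simp only: if_False)
    also have "P_pos n x = (lambda_const m * real ((n + k) choose n)) *\<^sub>R ck_poly n x"
      unfolding P_pos_eq m_def [symmetric] nk ..
    finally have "T (n + k) = (minus_one_power m * of_real (lambda_const m * real ((n + k) choose n))) *\<^sub>C (ck_poly n x * a (n + k))"
      by (simp only: T_def cscale_scaleR cscale_mult_left)
    also have "real ((n + k) choose n) = (fact (n + k) / fact n) / fact (m - 1)"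
      by (subst binomial_fact) (simp_all add: k_def)
    also have "minus_one_power m * of_real (lambda_const m * ((fact (n + k) / fact n) / fact (m - 1))) =
        gamma_const m * of_real (fact (n + k) / fact n)"
      by (rule gamma_const_eq [symmetric])
    also have "(gamma_const m * of_real (fact (n + k) / fact n)) *\<^sub>C (ck_poly n x * a (n + k)) =
        gamma_const m *\<^sub>C (ck_poly n x * b n)"
      by (simp only: b_def mult_scaleR_right cscale_scaleR)
    finally show ?thesis .
  qed
  moreover have "(\<lambda>n. gamma_const m *\<^sub>C (ck_poly n x * b n)) sums (gamma_const m *\<^sub>C ck_series b x)"
    by (rule bounded_linear.sums [OF bounded_linear_cscale ck_series_sums(1) [OF b]])
  ultimately have "(\<lambda>n. T (n + k)) sums (gamma_const m *\<^sub>C ck_series b x)" by simp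
  moreover have "T l = 0" if "l < k" for l
  proof -
    have "l + 1 < CARD('n)" using that by (simp add: k_def m_def less_diff_conv)
    then show ?thesis unfolding T_def tau_monomial_def by (simp only: if_True mult_zero_left)
  qed
  ultimately have "T sums (gamma_const m *\<^sub>C ck_series b x)"
    by (subst (asm) sums_zero_iff_shift)
  moreover have "tau (slice_ext (pseries a)) x = suminf T"
    unfolding tau_def slice_coefficients_unique [OF a] T_def by simp
  ultimately show ?thesis
    using GCK_pseries [OF b] pb by (simp add: sums_iff k_def m_def)
qed

section \<open>Hermite expansion of the heat kernel\<close>

text \<open>
  For \<open>e = -1\<close> these are the Hermite polynomials with weight \<open>exp (- y\<^sup>2 / 2)\<close>.  For \<open>e = 1\<close> all signs
  are positive, and the values at \<open>\<bar>y\<bar>\<close> dominate them.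
\<close>

fun hermite :: "real \<Rightarrow> nat \<Rightarrow> real \<Rightarrow> real" where
  "hermite e 0 y = 1"
| "hermite e (Suc 0) y = y"
| "hermite e (Suc (Suc n)) y = y * hermite e (Suc n) y + e * real (Suc n) * hermite e n y"

definition hermite_coeff :: "real \<Rightarrow> real \<Rightarrow> nat \<Rightarrow> real" where
  "hermite_coeff e y n = hermite e n y / fact n"

text \<open>
  The recurrence as a statement on the generating function \<open>G(t)\<close>: it says \<open>G' = (y + e t) G\<close>.
\<close>

lemma diffs_hermite_coeff:
  "diffs (hermite_coeff e y) n = y * hermite_coeff e y n + (if n = 0 then 0 else e * hermite_coeff e y (n - 1))"
proof (cases n)
  case 0
  then show ?thesis by (simp add: diffs_def hermite_coeff_def)
next
  case (Suc k)
  have f: "(fact (Suc k) :: real) = real (Suc k) * fact k" by simp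
  have "diffs (hermite_coeff e y) (Suc k) = (y * hermite e (Suc k) y + e * real (Suc k) * hermite e k y) / fact (Suc k)"
    unfolding diffs_def hermite_coeff_def
    by (simp del: fact_Suc add: fact_Suc [of "Suc k"])
  also have "\<dots> = y * hermite_coeff e y (Suc k) + e * hermite_coeff e y k"
    by (simp add: hermite_coeff_def add_divide_distrib f del: fact_Suc)
  finally show ?thesis by (simp add: Suc)
qed

lemma hermite_coeff_nonneg: "0 \<le> y \<Longrightarrow> 0 \<le> hermite_coeff 1 y n"
proof -
  have "0 \<le> y \<Longrightarrow> 0 \<le> hermite 1 n y" by (induction "1 :: real" n y rule: hermite.induct) simp_all
  then show "0 \<le> y \<Longrightarrow> 0 \<le> hermite_coeff 1 y n" by (simp add: hermite_coeff_def)
qed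

lemma abs_hermite_coeff_le: "\<bar>hermite_coeff (-1) y n\<bar> \<le> hermite_coeff 1 \<bar>y\<bar> n"
proof -
  have "\<bar>hermite (-1) n y\<bar> \<le> hermite 1 n \<bar>y\<bar>"
  proof (induction n rule: less_induct)
    case (less n)
    consider "n = 0" | "n = 1" | k where "n = Suc (Suc k)"
      by (metis One_nat_def not0_implies_Suc)
    then show ?case
    proof cases
      case 3
      have "\<bar>y * hermite (-1) (Suc k) y\<bar> \<le> \<bar>y\<bar> * hermite 1 (Suc k) \<bar>y\<bar>"
        using less [of "Suc k"] 3 by (simp add: abs_mult mult_left_mono)
      moreover have "\<bar>- real (Suc k) * hermite (-1) k y\<bar> \<le> real (Suc k) * hermite 1 k \<bar>y\<bar>"
        using less [of k] 3 by (simp only: abs_mult abs_minus_cancel abs_of_nat) (intro mult_left_mono; simp)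
      ultimately show ?thesis unfolding 3 hermite.simps by linarith
    qed simp_all
  qed
  then show ?thesis by (simp add: hermite_coeff_def divide_right_mono)
qed

text \<open>
  The partial sums \<open>D\<close> of the generating function satisfy \<open>D' \<le> (y + t) D\<close>, so \<open>D\<close> times
  \<open>exp (- (y t + t\<^sup>2 / 2))\<close> is decreasing.  This proves convergence together with the bound that is
  needed for integration.
\<close>

lemma hermite_partial_sum_le:
  assumes "0 \<le> y" "0 \<le> s"
  shows "(\<Sum>n<N. hermite_coeff 1 y n * s ^ n) \<le> exp (y * s + s\<^sup>2 / 2)"
proof (cases N)
  case 0
  then show ?thesis by simp
next
  case (Suc M)
  define d where "d = hermite_coeff 1 y"
  define D where "D = (\<lambda>t. \<Sum>n<N. d n * t ^ n)"
  define D' where "D' = (\<lambda>t. \<Sum>n<N. d n * (real n * t ^ (n - 1)))"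
  have d0: "0 \<le> d n" for n using assms hermite_coeff_nonneg by (simp add: d_def)
  have deriv: "(D has_real_derivative D' t) (at t)" for t
    unfolding D_def D'_def by (auto intro!: derivative_eq_intros sum.cong)
  have D'_le: "D' t \<le> (y + t) * D t" if "0 \<le> t" for t
  proof -
    have "D' t = (\<Sum>n<M. d (Suc n) * (real (Suc n) * t ^ n))"
      unfolding D'_def Suc by (subst sum.lessThan_Suc_shift) simp
    also have "\<dots> = (\<Sum>n<M. diffs d n * t ^ n)"
      by (rule sum.cong) (simp_all add: diffs_def)
    also have "\<dots> = y * (\<Sum>n<M. d n * t ^ n) + (\<Sum>n<M. if n = 0 then 0 else d (n - 1) * t ^ n)"
      unfolding d_def diffs_hermite_coeff sum_distrib_left sum.distrib [symmetric]
      by (rule sum.cong) (auto simp: algebra_simps)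
    finally have 1: "D' t = y * (\<Sum>n<M. d n * t ^ n) + (\<Sum>n<M. if n = 0 then 0 else d (n - 1) * t ^ n)" .
    have 2: "(\<Sum>n<M. d n * t ^ n) \<le> D t"
      unfolding D_def Suc using d0 that by simp
    have 3: "(\<Sum>n<M. if n = 0 then 0 else d (n - 1) * t ^ n) \<le> t * D t"
    proof (cases M)
      case 0
      then show ?thesis using d0 that by (simp add: D_def sum_nonneg)
    next
      case (Suc K)
      have "(\<Sum>n<M. if n = 0 then 0 else d (n - 1) * t ^ n) = t * (\<Sum>n<K. d n * t ^ n)"
        unfolding Suc by (subst sum.lessThan_Suc_shift) (simp add: sum_distrib_left mult_ac)
      also have "(\<Sum>n<K. d n * t ^ n) \<le> D t"
        unfolding D_def by (rule sum_mono2) (use d0 that Suc \<open>N = Suc M\<close> in auto)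
      finally show ?thesis using that by (simp add: mult_left_mono)
    qed
    show ?thesis
      using add_mono [OF mult_left_mono [OF 2 assms(1)] 3] unfolding 1 by (simp add: algebra_simps)
  qed
  define g where "g = (\<lambda>t. D t * exp (- (y * t + t\<^sup>2 / 2)))"
  have "g s \<le> g 0"
  proof (rule DERIV_nonpos_imp_nonincreasing [OF assms(2)])
    fix t assume "0 \<le> t" "t \<le> s"
    have "(g has_real_derivative (D' t - (y + t) * D t) * exp (- (y * t + t\<^sup>2 / 2))) (at t)"
      unfolding g_def by (auto intro!: derivative_eq_intros deriv simp: algebra_simps)
    moreover have "(D' t - (y + t) * D t) * exp (- (y * t + t\<^sup>2 / 2)) \<le> 0"
      using D'_le [OF \<open>0 \<le> t\<close>] by (intro mult_nonpos_nonneg) simp_all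
    ultimately show "\<exists>y. (g has_real_derivative y) (at t) \<and> y \<le> 0" by blast
  qed
  also have "g 0 = 1"
    unfolding g_def D_def Suc by (subst sum.lessThan_Suc_shift) (simp add: d_def hermite_coeff_def)
  finally have "D s \<le> exp (y * s + s\<^sup>2 / 2)"
    by (simp add: g_def exp_minus field_simps)
  then show ?thesis by (simp add: D_def d_def)
qed

lemma summable_abs_hermite: "summable (\<lambda>n. \<bar>hermite_coeff (-1) y n * s ^ n\<bar>)"
proof (rule summable_comparison_test')
  show "summable (\<lambda>n. hermite_coeff 1 \<bar>y\<bar> n * \<bar>s\<bar> ^ n)"
    by (rule summableI_nonneg_bounded [OF _ hermite_partial_sum_le])
      (auto intro!: hermite_coeff_nonneg mult_nonneg_nonneg)
  show "norm \<bar>hermite_coeff (-1) y n * s ^ n\<bar> \<le> hermite_coeff 1 \<bar>y\<bar> n * \<bar>s\<bar> ^ n" for n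
    using abs_hermite_coeff_le [of y n] by (simp add: abs_mult power_abs mult_right_mono)
qed

text \<open>
  The sum and the exponential solve the same linear differential equation.
\<close>

lemma hermite_sums: "(\<lambda>n. hermite_coeff (-1) y n * s ^ n) sums exp (y * s - s\<^sup>2 / 2)"
proof -
  define c where "c = hermite_coeff (-1) y"
  have sm: "summable (\<lambda>n. c n * t ^ n)" for t
    using summable_abs_hermite [of y t] summable_rabs_cancel by (simp add: c_def)
  define f where "f = (\<lambda>t. \<Sum>n. c n * t ^ n)"
  have fs: "(\<lambda>n. c n * t ^ n) sums f t" for t using sm by (simp add: f_def summable_sums)
  have df: "(f has_real_derivative (y - t) * f t) (at t)" for t
  proof -
    have "(f has_real_derivative (\<Sum>n. diffs c n * t ^ n)) (at t)"
      unfolding f_def by (rule termdiffs_strong_converges_everywhere [OF sm])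
    also have "(\<Sum>n. diffs c n * t ^ n) = (y - t) * f t"
    proof -
      have "(\<lambda>n. t * (c n * t ^ n)) sums (t * f t)" by (intro sums_mult fs)
      then have "(\<lambda>n. if Suc n = 0 then 0 else c (Suc n - 1) * t ^ Suc n) sums (t * f t)" by (simp add: mult_ac)
      then have "(\<lambda>n. if n = 0 then 0 else c (n - 1) * t ^ n) sums (t * f t)"
        by (subst (asm) sums_Suc_iff) simp
      then have "(\<lambda>n. y * (c n * t ^ n) - (if n = 0 then 0 else c (n - 1) * t ^ n)) sums (y * f t - t * f t)"
        by (intro sums_diff sums_mult fs)
      moreover have "y * (c n * t ^ n) - (if n = 0 then 0 else c (n - 1) * t ^ n) = diffs c n * t ^ n" for n
        unfolding c_def diffs_hermite_coeff by (auto simp: algebra_simps)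
      ultimately show ?thesis by (simp add: sums_iff algebra_simps)
    qed
    finally show ?thesis .
  qed
  define g where "g = (\<lambda>t. f t * exp (- (y * t - t\<^sup>2 / 2)))"
  have "g s = g 0"
  proof (rule DERIV_isconst_all [of g])
    show "\<forall>t. (g has_real_derivative 0) (at t)"
      unfolding g_def by (auto intro!: derivative_eq_intros df simp: algebra_simps)
  qed
  also have "g 0 = 1"
    by (simp only: g_def f_def powser_zero) (simp add: c_def hermite_coeff_def)
  finally have "f s = exp (y * s - s\<^sup>2 / 2)" by (simp add: g_def exp_minus exp_diff field_simps)
  then show ?thesis using fs [of s] by (simp add: c_def)
qed

text \<open>
  The \<open>n\<close>-th derivative of \<open>exp (- y\<^sup>2 / 2)\<close> up to the sign \<open>(-1) ^ n\<close>.
\<close>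

definition gauss_deriv :: "nat \<Rightarrow> real \<Rightarrow> real" where
  "gauss_deriv n y = hermite (-1) n y * exp (- (y\<^sup>2 / 2))"

lemma hermite_derivative: "(hermite (-1) n has_real_derivative real n * hermite (-1) (n - 1) y) (at y)"
proof (induction n rule: less_induct)
  case (less n)
  consider "n = 0" | "n = 1" | "n = 2" | k where "n = Suc (Suc (Suc k))"
    by (metis One_nat_def numeral_2_eq_2 not0_implies_Suc)
  then show ?case
  proof cases
    case 1
    have "hermite (-1) 0 = (\<lambda>y. 1)" by auto
    then show ?thesis using 1 by simp
  next
    case 2
    have "hermite (-1) 1 = (\<lambda>y. y)" by auto
    then show ?thesis using 2 by simp
  next
    case 3
    have "hermite (-1) 2 = (\<lambda>y. y * y - 1)" by (auto simp: numeral_2_eq_2)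
    then show ?thesis using 3 by (auto intro!: derivative_eq_intros)
  next
    case (4 k)
    have eq: "hermite (-1) n = (\<lambda>y. y * hermite (-1) (Suc (Suc k)) y - real (Suc (Suc k)) * hermite (-1) (Suc k) y)"
      unfolding 4 by (auto simp: fun_eq_iff algebra_simps)
    have 1: "(hermite (-1) (Suc (Suc k)) has_real_derivative real (Suc (Suc k)) * hermite (-1) (Suc k) y) (at y)"
      using less [of "Suc (Suc k)"] 4 by (simp del: hermite.simps)
    have 2: "(hermite (-1) (Suc k) has_real_derivative real (Suc k) * hermite (-1) k y) (at y)"
      using less [of "Suc k"] 4 by simp
    show ?thesis
      unfolding eq
      by (rule derivative_eq_intros 1 2 refl)+ (simp add: 4 algebra_simps)
  qed
qed

lemma gauss_deriv_derivative: "(gauss_deriv n has_real_derivative - gauss_deriv (Suc n) y) (at y)"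
proof -
  have "(gauss_deriv n has_real_derivative
      (real n * hermite (-1) (n - 1) y - y * hermite (-1) n y) * exp (- (y\<^sup>2 / 2))) (at y)"
    unfolding gauss_deriv_def by (auto intro!: derivative_eq_intros hermite_derivative simp: algebra_simps)
  also have "real n * hermite (-1) (n - 1) y - y * hermite (-1) n y = - hermite (-1) (Suc n) y"
    by (cases n) (simp_all add: algebra_simps)
  finally show ?thesis by (simp only: gauss_deriv_def [abs_def] mult_minus_left)
qed

lemma heat_kernel_sums: "(\<lambda>n. s ^ n / fact n * gauss_deriv n y) sums exp (- ((s - y)\<^sup>2 / 2))"
proof -
  have "exp (y * s - s\<^sup>2 / 2) * exp (- (y\<^sup>2 / 2)) = exp (- ((s - y)\<^sup>2 / 2))"
    by (simp add: power2_eq_square algebra_simps flip: exp_add) (simp add: field_simps)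
  with sums_mult2 [OF hermite_sums [of y s], of "exp (- (y\<^sup>2 / 2))"] show ?thesis
    by (simp add: hermite_coeff_def gauss_deriv_def mult_ac)
qed

definition gauss_bound :: "real \<Rightarrow> real \<Rightarrow> real" where
  "gauss_bound s y = exp (\<bar>y\<bar> * \<bar>s\<bar> + s\<^sup>2 / 2 - y\<^sup>2 / 2)"

lemma gauss_partial_sum_le: "(\<Sum>n<N. \<bar>s\<bar> ^ n / fact n * \<bar>gauss_deriv n y\<bar>) \<le> gauss_bound s y"
proof -
  have "(\<Sum>n<N. \<bar>s\<bar> ^ n / fact n * \<bar>gauss_deriv n y\<bar>)
      = (\<Sum>n<N. \<bar>hermite_coeff (-1) y n\<bar> * \<bar>s\<bar> ^ n) * exp (- (y\<^sup>2 / 2))"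
    unfolding sum_distrib_right
    by (rule sum.cong) (simp_all add: gauss_deriv_def hermite_coeff_def abs_mult)
  also have "\<dots> \<le> (\<Sum>n<N. hermite_coeff 1 \<bar>y\<bar> n * \<bar>s\<bar> ^ n) * exp (- (y\<^sup>2 / 2))"
    by (intro mult_right_mono sum_mono abs_hermite_coeff_le) simp_all
  also have "\<dots> \<le> exp (\<bar>y\<bar> * \<bar>s\<bar> + \<bar>s\<bar>\<^sup>2 / 2) * exp (- (y\<^sup>2 / 2))"
    by (intro mult_right_mono hermite_partial_sum_le) simp_all
  also have "\<dots> = gauss_bound s y" by (simp add: gauss_bound_def flip: exp_add)
  finally show ?thesis .
qed

lemma abs_gauss_deriv_le: "\<bar>gauss_deriv n y\<bar> \<le> fact n * gauss_bound 1 y"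
proof -
  have "1 / fact n * \<bar>gauss_deriv n y\<bar> \<le> (\<Sum>k<Suc n. \<bar>1\<bar> ^ k / fact k * \<bar>gauss_deriv k y\<bar>)"
    by (simp add: sum_nonneg)
  also have "\<dots> \<le> gauss_bound 1 y" by (rule gauss_partial_sum_le)
  finally show ?thesis by (simp add: field_simps)
qed

lemma gauss_deriv_measurable [measurable]: "gauss_deriv n \<in> borel_measurable borel"
  by (intro borel_measurable_continuous_onI continuous_at_imp_continuous_on ballI)
    (rule DERIV_isCont [OF gauss_deriv_derivative])

lemma gauss_bound_measurable [measurable]: "gauss_bound s \<in> borel_measurable borel"
  unfolding gauss_bound_def by measurable

lemma integrable_gauss_bound_square: "integrable lborel (\<lambda>y. (gauss_bound s y)\<^sup>2)"
proof (rule Bochner_Integration.integrable_bound)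
  show "integrable lborel (\<lambda>y. exp (3 * s\<^sup>2) * sqrt (2 * pi) * std_normal_density y)"
    by (intro integrable_mult_right) simp
  show "(\<lambda>y. (gauss_bound s y)\<^sup>2) \<in> borel_measurable lborel" by measurable
  show "AE y in lborel. norm ((gauss_bound s y)\<^sup>2) \<le> norm (exp (3 * s\<^sup>2) * sqrt (2 * pi) * std_normal_density y)"
  proof (rule AE_I2)
    fix y
    \<comment> \<open>from \<open>2 a b \<le> a\<^sup>2 / 2 + 2 b\<^sup>2\<close>\<close>
    have "2 * (a * b + b\<^sup>2 / 2 - a\<^sup>2 / 2) \<le> 3 * b\<^sup>2 + - a\<^sup>2 / 2" for a b :: real
      using zero_le_power2 [of "a - 2 * b"] by (simp add: power2_eq_square algebra_simps)
    from this [of "\<bar>y\<bar>" "\<bar>s\<bar>"]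
    have "2 * (\<bar>y\<bar> * \<bar>s\<bar> + s\<^sup>2 / 2 - y\<^sup>2 / 2) \<le> 3 * s\<^sup>2 + - y\<^sup>2 / 2"
      by simp
    then have "(gauss_bound s y)\<^sup>2 \<le> exp (3 * s\<^sup>2 + - y\<^sup>2 / 2)"
      unfolding gauss_bound_def exp_double [symmetric] by (simp only: exp_le_cancel_iff)
    also have "\<dots> = exp (3 * s\<^sup>2) * sqrt (2 * pi) * std_normal_density y"
      by (simp add: std_normal_density_def) (simp flip: exp_add)
    finally show "norm ((gauss_bound s y)\<^sup>2) \<le> norm (exp (3 * s\<^sup>2) * sqrt (2 * pi) * std_normal_density y)"
      by simp
  qed
qed

definition square_integrable :: "(real \<Rightarrow> 'b::{banach,second_countable_topology}) \<Rightarrow> bool" where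
  "square_integrable f \<longleftrightarrow> f \<in> borel_measurable lborel \<and> integrable lborel (\<lambda>y. (norm (f y))\<^sup>2)"

text \<open>
  A product of two square integrable functions.
\<close>

lemma integrable_gauss_bound_times:
  assumes "square_integrable f"
  shows "integrable lborel (\<lambda>y. gauss_bound s y * norm (f y))"
proof (rule Bochner_Integration.integrable_bound)
  have [measurable]: "f \<in> borel_measurable lborel" using assms by (simp add: square_integrable_def)
  show "integrable lborel (\<lambda>y. (gauss_bound s y)\<^sup>2 + (norm (f y))\<^sup>2)"
    using assms by (intro Bochner_Integration.integrable_add integrable_gauss_bound_square) (simp add: square_integrable_def)
  show "(\<lambda>y. gauss_bound s y * norm (f y)) \<in> borel_measurable lborel" by measurable
  show "AE y in lborel. norm (gauss_bound s y * norm (f y)) \<le> norm ((gauss_bound s y)\<^sup>2 + (norm (f y))\<^sup>2)"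
  proof (rule AE_I2)
    fix y
    have "0 \<le> (gauss_bound s y - norm (f y))\<^sup>2" by simp
    moreover have g0: "0 \<le> gauss_bound s y" by (simp add: gauss_bound_def)
    moreover have "0 \<le> gauss_bound s y * norm (f y)" using g0 by simp
    ultimately have "gauss_bound s y * norm (f y) \<le> (gauss_bound s y)\<^sup>2 + (norm (f y))\<^sup>2"
      unfolding power2_diff by linarith
    then show "norm (gauss_bound s y * norm (f y)) \<le> norm ((gauss_bound s y)\<^sup>2 + (norm (f y))\<^sup>2)"
      using g0 by simp
  qed
qed

lemma integrable_gauss_deriv_times:
  fixes f :: "real \<Rightarrow> 'b::{banach,second_countable_topology}"
  assumes "square_integrable f"
  shows "integrable lborel (\<lambda>y. gauss_deriv n y *\<^sub>R f y)"
proof (rule Bochner_Integration.integrable_bound)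
  have [measurable]: "f \<in> borel_measurable lborel" using assms by (simp add: square_integrable_def)
  show "integrable lborel (\<lambda>y. fact n * (gauss_bound 1 y * norm (f y)))"
    by (intro integrable_mult_right integrable_gauss_bound_times assms)
  show "(\<lambda>y. gauss_deriv n y *\<^sub>R f y) \<in> borel_measurable lborel" by measurable
  show "AE y in lborel. norm (gauss_deriv n y *\<^sub>R f y) \<le> norm (fact n * (gauss_bound 1 y * norm (f y)))"
  proof (rule AE_I2)
    fix y
    show "norm (gauss_deriv n y *\<^sub>R f y) \<le> norm (fact n * (gauss_bound 1 y * norm (f y)))"
      using mult_right_mono [OF abs_gauss_deriv_le [of n y], of "norm (f y)"]
      by (simp add: abs_mult gauss_bound_def mult_ac)
  qed
qed

definition heat_coeff :: "(real \<Rightarrow> 'b::{banach,second_countable_topology}) \<Rightarrow> nat \<Rightarrow> 'b" where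
  "heat_coeff f n = (1 / (sqrt (2 * pi) * fact n)) *\<^sub>R (\<integral>y. gauss_deriv n y *\<^sub>R f y \<partial>lborel)"

text \<open>
  The partial sums of the expansion of the heat kernel are dominated by \<open>gauss_bound s\<close>, whose product
  with \<open>f\<close> is integrable; so the expansion may be integrated term by term.
\<close>

lemma heat_integral_sums:
  fixes f :: "real \<Rightarrow> 'b::{banach,second_countable_topology}"
  assumes f: "square_integrable f"
  shows "(\<lambda>n. s ^ n *\<^sub>R heat_coeff f n) sums
    ((1 / sqrt (2 * pi)) *\<^sub>R (\<integral>y. exp (- ((s - y)\<^sup>2 / 2)) *\<^sub>R f y \<partial>lborel))"
proof -
  define T where "T = (\<lambda>n y. (s ^ n / fact n * gauss_deriv n y) *\<^sub>R f y)"
  have T: "T = (\<lambda>n y. (s ^ n / fact n) *\<^sub>R (gauss_deriv n y *\<^sub>R f y))"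
    by (simp add: T_def)
  have intT: "integrable lborel (T n)" for n
    unfolding T by (intro integrable_scaleR_right integrable_gauss_deriv_times f)
  have normT: "norm (T n y) = \<bar>s\<bar> ^ n / fact n * \<bar>gauss_deriv n y\<bar> * norm (f y)" for n y
    by (simp add: T_def abs_mult power_abs)
  have part: "(\<Sum>n<N. norm (T n y)) \<le> gauss_bound s y * norm (f y)" for N y
    unfolding normT sum_distrib_right [symmetric] by (intro mult_right_mono gauss_partial_sum_le) simp
  have "(\<lambda>n. integral\<^sup>L lborel (T n)) sums (\<integral>y. (\<Sum>n. T n y) \<partial>lborel)"
  proof (rule sums_integral [OF intT])
    show "AE y in lborel. summable (\<lambda>n. norm (T n y))"
      by (intro AE_I2 summableI_nonneg_bounded [OF _ part]) simp
    show "summable (\<lambda>n. \<integral>y. norm (T n y) \<partial>lborel)"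
    proof (rule summableI_nonneg_bounded)
      fix N
      have "(\<Sum>n<N. \<integral>y. norm (T n y) \<partial>lborel) = (\<integral>y. (\<Sum>n<N. norm (T n y)) \<partial>lborel)"
        by (rule Bochner_Integration.integral_sum [symmetric]) (intro integrable_norm intT)
      also have "\<dots> \<le> (\<integral>y. gauss_bound s y * norm (f y) \<partial>lborel)"
        by (intro integral_mono part integrable_gauss_bound_times f Bochner_Integration.integrable_sum integrable_norm intT)
      finally show "(\<Sum>n<N. \<integral>y. norm (T n y) \<partial>lborel) \<le> (\<integral>y. gauss_bound s y * norm (f y) \<partial>lborel)" .
    qed simp
  qed
  moreover have "(\<Sum>n. T n y) = exp (- ((s - y)\<^sup>2 / 2)) *\<^sub>R f y" for y
    using bounded_linear.sums [OF bounded_linear_scaleR_left heat_kernel_sums [of s y], of "f y"]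
    by (simp add: T_def sums_iff)
  moreover have "integral\<^sup>L lborel (T n) = (s ^ n / fact n) *\<^sub>R (\<integral>y. gauss_deriv n y *\<^sub>R f y \<partial>lborel)" for n
    unfolding T by (rule integral_scaleR_right)
  ultimately have "(\<lambda>n. (s ^ n / fact n) *\<^sub>R (\<integral>y. gauss_deriv n y *\<^sub>R f y \<partial>lborel)) sums
      (\<integral>y. exp (- ((s - y)\<^sup>2 / 2)) *\<^sub>R f y \<partial>lborel)" by simp
  from sums_scaleR_right [OF this, of "1 / sqrt (2 * pi)"] show ?thesis
    by (simp add: heat_coeff_def mult.commute)
qed

lemma heat_eq_pseries:
  assumes "square_integrable f"
  shows "heat f = pseries (heat_coeff f)" "entire_coeffs (heat_coeff f)"
proof -
  have *: "(\<lambda>n. s ^ n *\<^sub>R heat_coeff f n) sums heat f s" for s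
    using heat_integral_sums [OF assms, of s] by (simp add: heat_def)
  show "heat f = pseries (heat_coeff f)"
    using * by (auto simp: pseries_def sums_iff)
  show "entire_coeffs (heat_coeff f)"
    by (rule entire_coeffsI) (rule sums_summable [OF *])
qed

section \<open>A smooth function with compact support\<close>

text \<open>
  Carrying all derivatives along makes products and compositions computable, and gives access to the
  iterated \<open>deriv\<close> in the definition of a test function.
\<close>

definition deriv_seq :: "(real \<Rightarrow> real) \<Rightarrow> (nat \<Rightarrow> real \<Rightarrow> real) \<Rightarrow> bool" where
  "deriv_seq f D \<longleftrightarrow> D 0 = f \<and> (\<forall>k t. (D k has_real_derivative D (Suc k) t) (at t))"

lemma deriv_seq_iterate: "deriv_seq f D \<Longrightarrow> (deriv ^^ k) f = D k"
proof (induction k)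
  case (Suc k)
  then have "deriv (D k) t = D (Suc k) t" for t
    by (intro DERIV_imp_deriv) (simp add: deriv_seq_def)
  with Suc show ?case by auto
qed (simp add: deriv_seq_def)

lemma deriv_seq_test_function:
  assumes "deriv_seq f D" and "\<And>t. R < \<bar>t\<bar> \<Longrightarrow> f t = 0"
  shows "test_function f"
  unfolding test_function_def
proof (intro conjI allI)
  show "(deriv ^^ k) f field_differentiable at t" for k t
    using assms(1) unfolding deriv_seq_iterate [OF assms(1)] deriv_seq_def
    by (auto simp: field_differentiable_def)
  have "closure {t. f t \<noteq> 0} \<subseteq> {-R..R}"
    by (rule closure_minimal) (use assms(2) in \<open>auto simp: not_less abs_le_iff, force+\<close>)
  then show "compact (closure {t. f t \<noteq> 0})"
    by (meson bounded_closed_interval bounded_subset closed_closure compact_eq_bounded_closed)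
qed

lemma deriv_seq_affine:
  assumes "deriv_seq f D"
  shows "deriv_seq (\<lambda>t. f (a + b * t)) (\<lambda>k t. b ^ k * D k (a + b * t))"
  unfolding deriv_seq_def
proof (intro conjI allI)
  show "(\<lambda>t. b ^ 0 * D 0 (a + b * t)) = (\<lambda>t. f (a + b * t))"
    using assms by (simp add: deriv_seq_def)
  fix k t
  have "((\<lambda>t. D k (a + b * t)) has_real_derivative D (Suc k) (a + b * t) * b) (at t)"
    using assms unfolding deriv_seq_def
    by (intro DERIV_chain2 [where g = "\<lambda>t. a + b * t"]) (auto intro!: derivative_eq_intros)
  from DERIV_cmult [OF this, of "b ^ k"]
  show "((\<lambda>t. b ^ k * D k (a + b * t)) has_real_derivative b ^ Suc k * D (Suc k) (a + b * t)) (at t)"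
    by (simp add: mult_ac)
qed

lemma deriv_seq_times:
  assumes f: "deriv_seq f D" and g: "deriv_seq g E"
  shows "deriv_seq (\<lambda>t. f t * g t) (\<lambda>k t. \<Sum>i\<le>k. real (k choose i) * (D i t * E (k - i) t))"
  unfolding deriv_seq_def
proof (intro conjI allI)
  show "(\<lambda>t. \<Sum>i\<le>0. real (0 choose i) * (D i t * E (0 - i) t)) = (\<lambda>t. f t * g t)"
    using f g by (simp add: deriv_seq_def)
  fix k t
  have "((\<lambda>t. \<Sum>i\<le>k. real (k choose i) * (D i t * E (k - i) t)) has_real_derivative
      (\<Sum>i\<le>k. real (k choose i) * (D (Suc i) t * E (k - i) t + D i t * E (Suc (k - i)) t))) (at t)"
    using f g unfolding deriv_seq_def
    by (auto intro!: DERIV_sum DERIV_cmult derivative_eq_intros simp: algebra_simps)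
  also have "(\<Sum>i\<le>k. real (k choose i) * (D (Suc i) t * E (k - i) t + D i t * E (Suc (k - i)) t)) =
      (\<Sum>i\<le>k. real (k choose i) * (D (Suc i) t * E (k - i) t)) + (\<Sum>i\<le>k. real (k choose i) * (D i t * E (Suc k - i) t))"
    unfolding sum.distrib [symmetric] by (rule sum.cong) (auto simp: Suc_diff_le distrib_left)
  also have "(\<Sum>i\<le>k. real (k choose i) * (D i t * E (Suc k - i) t)) =
      (\<Sum>i\<le>Suc k. real (k choose i) * (D i t * E (Suc k - i) t))"
    by simp
  also have "\<dots> = D 0 t * E (Suc k) t + (\<Sum>i\<le>k. real (k choose Suc i) * (D (Suc i) t * E (k - i) t))"
    by (subst sum.atMost_Suc_shift) simp
  also have "(\<Sum>i\<le>k. real (k choose i) * (D (Suc i) t * E (k - i) t)) +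
      (D 0 t * E (Suc k) t + (\<Sum>i\<le>k. real (k choose Suc i) * (D (Suc i) t * E (k - i) t))) =
      (\<Sum>i\<le>Suc k. real (Suc k choose i) * (D i t * E (Suc k - i) t))"
    by (subst sum.atMost_Suc_shift) (simp add: sum.distrib [symmetric] algebra_simps)
  finally show "((\<lambda>t. \<Sum>i\<le>k. real (k choose i) * (D i t * E (k - i) t)) has_real_derivative
      (\<Sum>i\<le>Suc k. real (Suc k choose i) * (D i t * E (Suc k - i) t))) (at t)" .
qed

primrec flat_poly :: "nat \<Rightarrow> real poly" where
  "flat_poly 0 = 1"
| "flat_poly (Suc k) = [:0, 0, 1:] * (flat_poly k - pderiv (flat_poly k))"

text \<open>
  The \<open>k\<close>-th derivative of \<open>exp (- 1 / x)\<close>, extended by \<open>0\<close> to the left.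
\<close>

definition flat :: "nat \<Rightarrow> real \<Rightarrow> real" where
  "flat k x = (if 0 < x then poly (flat_poly k) (1 / x) * exp (- (1 / x)) else 0)"

lemma poly_times_exp_minus_tendsto_0: "((\<lambda>u. poly p u * exp (- u)) \<longlongrightarrow> 0) at_top" for p :: "real poly"
proof -
  have "((\<lambda>u. \<Sum>i\<le>degree p. coeff p i * (u ^ i / exp u)) \<longlongrightarrow> (\<Sum>i\<le>degree p. coeff p i * 0)) at_top"
    by (intro tendsto_sum tendsto_mult tendsto_const tendsto_power_div_exp_0)
  then show ?thesis
    by (simp add: poly_altdef sum_distrib_right exp_minus divide_inverse mult.assoc)
qed

text \<open>
  At \<open>0\<close> the difference quotient from the right is a polynomial in \<open>1 / h\<close> times \<open>exp (- 1 / h)\<close>.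
\<close>

lemma flat_derivative: "(flat k has_real_derivative flat (Suc k) x) (at x)"
proof -
  consider "x < 0" | "0 < x" | "x = 0" by linarith
  then show ?thesis
  proof cases
    case 1
    have "((\<lambda>x. 0) has_real_derivative 0) (at x)" by simp
    then have "(flat k has_real_derivative 0) (at x)"
      by (rule has_field_derivative_transform_within_open [of _ _ _ "{..<0}"]) (use 1 in \<open>auto simp: flat_def\<close>)
    then show ?thesis using 1 by (simp add: flat_def)
  next
    case 2
    have "((\<lambda>x. poly (flat_poly k) (1 / x) * exp (- (1 / x))) has_real_derivative
        (poly (pderiv (flat_poly k)) (1 / x) * (- 1 / x\<^sup>2)) * exp (- (1 / x)) +
        poly (flat_poly k) (1 / x) * (exp (- (1 / x)) * (1 / x\<^sup>2))) (at x)"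
      using 2 by (auto intro!: derivative_eq_intros DERIV_chain2 [OF poly_DERIV] simp: power2_eq_square)
    also have "(poly (pderiv (flat_poly k)) (1 / x) * (- 1 / x\<^sup>2)) * exp (- (1 / x)) +
        poly (flat_poly k) (1 / x) * (exp (- (1 / x)) * (1 / x\<^sup>2)) = flat (Suc k) x"
      using 2 by (simp add: flat_def power2_eq_square field_simps)
    finally have D: "((\<lambda>x. poly (flat_poly k) (1 / x) * exp (- (1 / x))) has_real_derivative flat (Suc k) x) (at x)" .
    show ?thesis
      by (rule has_field_derivative_transform_within_open [OF D, of "{0<..}"]) (use 2 in \<open>auto simp: flat_def\<close>)
  next
    case 3
    have "((\<lambda>h. (flat k (0 + h) - flat k 0) / h) \<longlongrightarrow> 0) (at 0)"
      unfolding filterlim_at_split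
    proof
      have "eventually (\<lambda>h. (flat k (0 + h) - flat k 0) / h = 0) (at_left 0)"
        by (rule eventually_at_leftI [of "-1"]) (auto simp: flat_def)
      then show "((\<lambda>h. (flat k (0 + h) - flat k 0) / h) \<longlongrightarrow> 0) (at_left 0)"
        by (rule tendsto_eventually)
      have "((\<lambda>h. poly ([:0, 1:] * flat_poly k) (inverse h) * exp (- inverse h)) \<longlongrightarrow> 0) (at_right 0)"
        by (rule filterlim_compose [OF poly_times_exp_minus_tendsto_0 filterlim_inverse_at_top_right])
      moreover have "eventually (\<lambda>h. poly ([:0, 1:] * flat_poly k) (inverse h) * exp (- inverse h) =
          (flat k (0 + h) - flat k 0) / h) (at_right 0)"
        by (rule eventually_at_rightI [of 0 1]) (auto simp: flat_def field_simps)
      ultimately show "((\<lambda>h. (flat k (0 + h) - flat k 0) / h) \<longlongrightarrow> 0) (at_right 0)"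
        by (rule Lim_transform_eventually)
    qed
    then show ?thesis using 3 by (simp add: has_field_derivative_def DERIV_def flat_def flip: has_field_derivative_def)
  qed
qed

definition bump :: "real \<Rightarrow> real" where
  "bump t = flat 0 (1 + 1 * t) * flat 0 (1 + (-1) * t)"

definition bump_deriv :: "nat \<Rightarrow> real \<Rightarrow> real" where
  "bump_deriv k t = (\<Sum>i\<le>k. real (k choose i) *
     ((1 ^ i * flat i (1 + 1 * t)) * ((-1) ^ (k - i) * flat (k - i) (1 + (-1) * t))))"

lemma deriv_seq_bump: "deriv_seq bump bump_deriv"
proof -
  have "deriv_seq (flat 0) flat" by (simp add: deriv_seq_def flat_derivative)
  from deriv_seq_times [OF deriv_seq_affine [OF this, of 1 1] deriv_seq_affine [OF this, of 1 "-1"]]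
  show ?thesis unfolding bump_def [abs_def] bump_deriv_def [abs_def] .
qed

lemma bump_0: "bump 0 \<noteq> 0"
  by (simp add: bump_def flat_def)

lemma bump_deriv_eq_0: "1 \<le> \<bar>t\<bar> \<Longrightarrow> bump_deriv k t = 0"
  unfolding bump_deriv_def by (rule sum.neutral) (auto simp: flat_def)

lemma bump_deriv_bounded: "\<exists>K. \<forall>t. \<bar>bump_deriv k t\<bar> \<le> K"
proof -
  have "continuous_on {-1..1} (bump_deriv k)"
    using deriv_seq_bump unfolding deriv_seq_def
    by (intro continuous_at_imp_continuous_on ballI) (blast intro: DERIV_isCont)
  then have "compact (bump_deriv k ` {-1..1})" by (rule compact_continuous_image) simp
  then obtain K where K: "\<And>t. t \<in> {-1..1} \<Longrightarrow> \<bar>bump_deriv k t\<bar> \<le> K"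
    using compact_imp_bounded bounded_iff by (metis imageI real_norm_def)
  have "\<bar>bump_deriv k t\<bar> \<le> K" for t
  proof (cases "t \<in> {-1..1}")
    case False
    then show ?thesis using bump_deriv_eq_0 [of t k] K [of 0] by (auto simp: abs_le_iff not_le)
  qed (rule K)
  then show ?thesis by blast
qed

section \<open>Weak derivatives and Gaussian weights\<close>

lemma deriv_seq_gauss: "deriv_seq (gauss_deriv n) (\<lambda>k y. (-1) ^ k * gauss_deriv (n + k) y)"
  unfolding deriv_seq_def by (auto intro!: derivative_eq_intros gauss_deriv_derivative)

lemma isCont_bump_deriv: "isCont (bump_deriv k) t"
  using deriv_seq_bump unfolding deriv_seq_def by (blast intro: DERIV_isCont)

lemma bump_deriv_measurable [measurable]: "bump_deriv k \<in> borel_measurable borel"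
  by (intro borel_measurable_continuous_onI continuous_at_imp_continuous_on ballI isCont_bump_deriv)

text \<open>
  The dominating function does not depend on the scale \<open>b\<close>.
\<close>

lemma cutoff_bound:
  fixes f :: "real \<Rightarrow> 'b::{banach,second_countable_topology}"
  assumes f: "square_integrable f"
  shows "\<exists>w. integrable lborel w \<and>
    (\<forall>b y. norm ((gauss_deriv n y * bump_deriv k (b * y)) *\<^sub>R f y) \<le> w y)"
proof -
  obtain K where K: "\<And>t. \<bar>bump_deriv k t\<bar> \<le> K" using bump_deriv_bounded by blast
  have "norm ((gauss_deriv n y * bump_deriv k (b * y)) *\<^sub>R f y) \<le> K * norm (gauss_deriv n y *\<^sub>R f y)" for b y
    using mult_right_mono [OF K [of "b * y"], of "norm (gauss_deriv n y *\<^sub>R f y)"]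
    by (simp add: abs_mult mult_ac)
  moreover have "integrable lborel (\<lambda>y. K * norm (gauss_deriv n y *\<^sub>R f y))"
    by (intro integrable_mult_right integrable_norm integrable_gauss_deriv_times f)
  ultimately show ?thesis by blast
qed

lemma integrable_cutoff:
  fixes f :: "real \<Rightarrow> 'b::{banach,second_countable_topology}"
  assumes f: "square_integrable f"
  shows "integrable lborel (\<lambda>y. (gauss_deriv n y * bump_deriv k (b * y)) *\<^sub>R f y)"
proof -
  have [measurable]: "f \<in> borel_measurable lborel" using f by (simp add: square_integrable_def)
  obtain w where w: "integrable lborel w"
    and bound: "\<forall>b y. norm ((gauss_deriv n y * bump_deriv k (b * y)) *\<^sub>R f y) \<le> w y"
    using cutoff_bound [OF f] by blast
  show ?thesis
  proof (rule Bochner_Integration.integrable_bound [OF w])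
    show "AE y in lborel. norm ((gauss_deriv n y * bump_deriv k (b * y)) *\<^sub>R f y) \<le> norm (w y)"
      by (intro AE_I2 order_trans [OF bound [rule_format] abs_ge_self, folded real_norm_def])
  qed measurable
qed

lemma integral_cutoff_tendsto:
  fixes f :: "real \<Rightarrow> 'b::{banach,second_countable_topology}"
  assumes f: "square_integrable f"
  shows "(\<lambda>N. \<integral>y. (gauss_deriv n y * bump_deriv k (inverse (real (Suc N)) * y)) *\<^sub>R f y \<partial>lborel)
    \<longlonglongrightarrow> (\<integral>y. (gauss_deriv n y * bump_deriv k 0) *\<^sub>R f y \<partial>lborel)"
proof -
  have [measurable]: "f \<in> borel_measurable lborel" using f by (simp add: square_integrable_def)
  obtain w where w: "integrable lborel w"
    and bound: "\<forall>b y. norm ((gauss_deriv n y * bump_deriv k (b * y)) *\<^sub>R f y) \<le> w y"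
    using cutoff_bound [OF f] by blast
  show ?thesis
  proof (rule integral_dominated_convergence [OF _ _ w])
    show "AE y in lborel. norm ((gauss_deriv n y * bump_deriv k (inverse (real (Suc N)) * y)) *\<^sub>R f y) \<le> w y" for N
      using bound by (intro AE_I2) blast
    show "AE y in lborel. (\<lambda>N. (gauss_deriv n y * bump_deriv k (inverse (real (Suc N)) * y)) *\<^sub>R f y)
        \<longlonglongrightarrow> (gauss_deriv n y * bump_deriv k 0) *\<^sub>R f y"
    proof (rule AE_I2)
      fix y
      have "(\<lambda>N. inverse (real (Suc N)) * y) \<longlonglongrightarrow> 0 * y"
        by (intro tendsto_mult LIMSEQ_inverse_real_of_nat tendsto_const)
      then have "(\<lambda>N. bump_deriv k (inverse (real (Suc N)) * y)) \<longlonglongrightarrow> bump_deriv k 0"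
        using isCont_tendsto_compose [OF isCont_bump_deriv] by simp
      then show "(\<lambda>N. (gauss_deriv n y * bump_deriv k (inverse (real (Suc N)) * y)) *\<^sub>R f y)
        \<longlonglongrightarrow> (gauss_deriv n y * bump_deriv k 0) *\<^sub>R f y"
        by (intro tendsto_intros)
    qed
  qed measurable
qed

text \<open>
  The functions \<open>gauss_deriv n y * bump (y / N)\<close> are test functions.  In the Leibniz formula for their
  \<open>k\<close>-th derivative each derivative of the cutoff carries a factor \<open>1 / N\<close>.  As \<open>N\<close> grows only the term
  with all derivatives on the Gaussian survives, and both sides acquire the factor \<open>bump 0\<close>, which
  cancels.
\<close>

lemma weak_deriv_gauss:
  fixes f g :: "real \<Rightarrow> complex"
  assumes f: "square_integrable f" and g: "square_integrable g" and w: "weak_deriv k f g"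
  shows "(\<integral>y. gauss_deriv n y *\<^sub>R g y \<partial>lborel) = (\<integral>y. gauss_deriv (n + k) y *\<^sub>R f y \<partial>lborel)"
proof -
  define b where "b = (\<lambda>N. inverse (real (Suc N)))"
  have b: "0 < b N" for N by (simp add: b_def)
  define \<phi> where "\<phi> = (\<lambda>N y. gauss_deriv n y * bump (0 + b N * y))"
  define D where "D = (\<lambda>N k y. \<Sum>i\<le>k. real (k choose i) *
      (((-1) ^ i * gauss_deriv (n + i) y) * (b N ^ (k - i) * bump_deriv (k - i) (0 + b N * y))))"
  have seq: "deriv_seq (\<phi> N) (D N)" for N
    unfolding \<phi>_def D_def by (rule deriv_seq_times [OF deriv_seq_gauss deriv_seq_affine [OF deriv_seq_bump]])
  have bump0: "bump = bump_deriv 0" using deriv_seq_bump by (simp add: deriv_seq_def)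
  have "\<phi> N t = 0" if "real (Suc N) < \<bar>t\<bar>" for N t
  proof -
    have "1 \<le> \<bar>b N * t\<bar>" using that b [of N] by (simp add: b_def abs_mult field_simps)
    then show ?thesis by (simp add: \<phi>_def bump0 bump_deriv_eq_0)
  qed
  then have test: "test_function (\<phi> N)" for N by (rule deriv_seq_test_function [OF seq])
  have int: "integrable lborel (\<lambda>y. (gauss_deriv p y * bump_deriv q (b N * y)) *\<^sub>R f y)" for p q N
    by (rule integrable_cutoff [OF f])
  have I: "(\<lambda>N. \<integral>y. (gauss_deriv p y * bump_deriv q (b N * y)) *\<^sub>R u y \<partial>lborel)
      \<longlonglongrightarrow> (\<integral>y. (gauss_deriv p y * bump_deriv q 0) *\<^sub>R u y \<partial>lborel)"
    if "square_integrable u" for u :: "real \<Rightarrow> complex" and p q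
    unfolding b_def by (rule integral_cutoff_tendsto [OF that])
  have "(\<lambda>N. \<integral>y. (deriv ^^ k) (\<phi> N) y *\<^sub>R f y \<partial>lborel) \<longlonglongrightarrow>
      (\<Sum>i\<le>k. (real (k choose i) * (-1) ^ i * 0 ^ (k - i)) *\<^sub>R
        (\<integral>y. (gauss_deriv (n + i) y * bump_deriv (k - i) 0) *\<^sub>R f y \<partial>lborel))"
  proof -
    have "(deriv ^^ k) (\<phi> N) y *\<^sub>R f y = (\<Sum>i\<le>k. (real (k choose i) * (-1) ^ i * b N ^ (k - i)) *\<^sub>R
        ((gauss_deriv (n + i) y * bump_deriv (k - i) (b N * y)) *\<^sub>R f y))" for N y
      by (simp add: deriv_seq_iterate [OF seq] D_def scaleR_sum_left mult_ac)
    then have "(\<integral>y. (deriv ^^ k) (\<phi> N) y *\<^sub>R f y \<partial>lborel) =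
        (\<Sum>i\<le>k. (real (k choose i) * (-1) ^ i * b N ^ (k - i)) *\<^sub>R
        (\<integral>y. (gauss_deriv (n + i) y * bump_deriv (k - i) (b N * y)) *\<^sub>R f y \<partial>lborel))" for N
      by (simp add: Bochner_Integration.integral_sum int del: scaleR_scaleR scaleR_conv_of_real)
    moreover have "b \<longlonglongrightarrow> 0" unfolding b_def by (rule LIMSEQ_inverse_real_of_nat)
    ultimately show ?thesis
      by (simp only:) (intro tendsto_intros I f)
  qed
  also have "(\<Sum>i\<le>k. (real (k choose i) * (-1) ^ i * 0 ^ (k - i)) *\<^sub>R
        (\<integral>y. (gauss_deriv (n + i) y * bump_deriv (k - i) 0) *\<^sub>R f y \<partial>lborel)) =
      (\<Sum>i\<le>k. if i = k then (-1) ^ k *\<^sub>R (\<integral>y. (gauss_deriv (n + k) y * bump 0) *\<^sub>R f y \<partial>lborel) else 0)"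
    by (rule sum.cong) (auto simp: bump0)
  also have "\<dots> = (-1) ^ k *\<^sub>R (\<integral>y. (gauss_deriv (n + k) y * bump 0) *\<^sub>R f y \<partial>lborel)"
    by simp
  finally have 1: "(\<lambda>N. \<integral>y. (deriv ^^ k) (\<phi> N) y *\<^sub>R f y \<partial>lborel) \<longlonglongrightarrow>
      (-1) ^ k *\<^sub>R (\<integral>y. (gauss_deriv (n + k) y * bump 0) *\<^sub>R f y \<partial>lborel)" .
  have "(\<integral>y. (deriv ^^ k) (\<phi> N) y *\<^sub>R f y \<partial>lborel) = (-1) ^ k * (\<integral>y. \<phi> N y *\<^sub>R g y \<partial>lborel)" for N
    using w test by (simp add: weak_deriv_def)
  moreover have "(\<lambda>N. (-1) ^ k * (\<integral>y. \<phi> N y *\<^sub>R g y \<partial>lborel)) \<longlonglongrightarrow>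
      (-1) ^ k * (\<integral>y. (gauss_deriv n y * bump 0) *\<^sub>R g y \<partial>lborel)"
    unfolding \<phi>_def bump0 add_0 by (intro tendsto_intros I g)
  ultimately have "(-1) ^ k *\<^sub>R (\<integral>y. (gauss_deriv (n + k) y * bump 0) *\<^sub>R f y \<partial>lborel) =
      (-1) ^ k * (\<integral>y. (gauss_deriv n y * bump 0) *\<^sub>R g y \<partial>lborel)"
    using LIMSEQ_unique [OF 1] by simp
  then have "(\<integral>y. bump 0 *\<^sub>R (gauss_deriv (n + k) y *\<^sub>R f y) \<partial>lborel) = (\<integral>y. bump 0 *\<^sub>R (gauss_deriv n y *\<^sub>R g y) \<partial>lborel)"
    by (simp add: scaleR_conv_of_real mult_ac)
  then show ?thesis
    using bump_0 by (simp only: integral_scaleR_right scaleR_cancel_left) auto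
qed

section \<open>Rotation invariance of the surface measure\<close>

lemma nn_integral_lborel_shift:
  fixes f :: "'a::euclidean_space \<Rightarrow> ennreal"
  assumes [measurable]: "f \<in> borel_measurable borel"
  shows "(\<integral>\<^sup>+x. f (x + w) \<partial>lborel) = (\<integral>\<^sup>+x. f x \<partial>lborel)"
proof -
  have "(\<integral>\<^sup>+x. f x \<partial>lborel) = (\<integral>\<^sup>+x. f x \<partial>distr lborel borel ((+) w))"
    by (simp add: lborel_distr_plus)
  also have "\<dots> = (\<integral>\<^sup>+x. f (w + x) \<partial>lborel)"
    by (subst nn_integral_distr) simp_all
  finally show ?thesis by (simp add: add.commute)
qed

lemma borel_measurable_linear_map:
  fixes T :: "'a::euclidean_space \<Rightarrow> 'b::real_normed_vector"
  shows "linear T \<Longrightarrow> T \<in> borel_measurable borel"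
  by (intro borel_measurable_continuous_onI linear_continuous_on) (simp add: linear_conv_bounded_linear)

text \<open>
  The argument is the uniqueness of translation-invariant measures.  Let \<open>f\<close> and \<open>g\<close> be the indicators
  of \<open>A\<close> and of the unit ball.  In the double integral of \<open>f (T x + y) * g y\<close> the integral over \<open>x\<close> does
  not depend on \<open>y\<close>, by translation by the preimage of \<open>y\<close>.  Substituting \<open>y - T x\<close> for \<open>y\<close> turns the
  integrand into \<open>f y * g (y - T x)\<close>, where the integral over \<open>x\<close> is the volume of a unit ball.
\<close>

lemma emeasure_lborel_isometry:
  fixes T :: "'a::euclidean_space \<Rightarrow> 'a"
  assumes T: "orthogonal_transformation T" and A [measurable]: "A \<in> sets borel"
  shows "emeasure lborel (T -` A) = emeasure lborel A"
proof -
  have lin: "linear T" using T by (rule orthogonal_transformation_linear)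
  have [measurable]: "T \<in> borel_measurable borel"
    by (rule borel_measurable_linear_map [OF lin])
  define b where "b = emeasure lborel (ball (0 :: 'a) 1)"
  have b: "b \<noteq> 0" "b \<noteq> \<infinity>" 
  proof -
    have "0 < unit_ball_vol (real DIM('a))" by (rule unit_ball_vol_pos) simp
    then have "unit_ball_vol (real DIM('a)) \<noteq> 0" by (rule less_imp_neq [THEN not_sym])
    then show "b \<noteq> 0" "b \<noteq> \<infinity>" by (simp_all add: b_def emeasure_ball)
  qed
  define f :: "'a \<Rightarrow> ennreal" where "f = indicator A"
  define g :: "'a \<Rightarrow> ennreal" where "g = indicator (ball 0 1)"
  have [measurable]: "f \<in> borel_measurable borel" "g \<in> borel_measurable borel"
    unfolding f_def g_def by (intro borel_measurable_indicator; simp)+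
  have gi: "(\<integral>\<^sup>+y. g y \<partial>lborel) = b" by (simp add: g_def b_def)
  have surj: "\<exists>w. y = T w" for y using orthogonal_transformation_surj [OF T] by blast
  have 1: "(\<integral>\<^sup>+x. f (T x + y) \<partial>lborel) = (\<integral>\<^sup>+x. f (T x) \<partial>lborel)" for y
  proof -
    obtain w where w: "y = T w" using surj by blast
    have "(\<integral>\<^sup>+x. f (T (x + w)) \<partial>lborel) = (\<integral>\<^sup>+x. f (T x) \<partial>lborel)"
      by (rule nn_integral_lborel_shift [of "\<lambda>x. f (T x)"]) measurable
    then show ?thesis by (simp add: w linear_add [OF lin])
  qed
  have 2: "(\<integral>\<^sup>+y. f (T x + y) * g y \<partial>lborel) = (\<integral>\<^sup>+y. f y * g (y - T x) \<partial>lborel)" for x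
    using nn_integral_lborel_shift [of "\<lambda>y. f y * g (y - T x)" "T x"] by (simp add: add.commute)
  have 3: "(\<integral>\<^sup>+x. g (y - T x) \<partial>lborel) = b" for y
  proof -
    obtain w where w: "y = T w" using surj by blast
    have "norm (T w - T x) = norm (x - w)" for x
      by (simp add: linear_diff [OF lin, symmetric] orthogonal_transformation_norm [OF T] norm_minus_commute)
    then have "g (y - T x) = g (x + - w)" for x by (simp add: g_def indicator_def w)
    then show ?thesis using nn_integral_lborel_shift [of g "- w"] gi by simp
  qed
  have "b * (\<integral>\<^sup>+x. f (T x) \<partial>lborel) = (\<integral>\<^sup>+y. (\<integral>\<^sup>+x. f (T x + y) * g y \<partial>lborel) \<partial>lborel)"
    by (simp add: nn_integral_multc nn_integral_cmult 1 gi mult.commute)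
  also have "\<dots> = (\<integral>\<^sup>+x. (\<integral>\<^sup>+y. f (T x + y) * g y \<partial>lborel) \<partial>lborel)"
    by (rule lborel_pair.Fubini') measurable
  also have "\<dots> = (\<integral>\<^sup>+x. (\<integral>\<^sup>+y. f y * g (y - T x) \<partial>lborel) \<partial>lborel)"
    by (simp only: 2)
  also have "\<dots> = (\<integral>\<^sup>+y. (\<integral>\<^sup>+x. f y * g (y - T x) \<partial>lborel) \<partial>lborel)"
    by (rule lborel_pair.Fubini' [symmetric]) measurable
  also have "\<dots> = b * (\<integral>\<^sup>+y. f y \<partial>lborel)"
    by (simp add: nn_integral_cmult nn_integral_multc 3 mult.commute)
  finally have "(\<integral>\<^sup>+x. f (T x) \<partial>lborel) = (\<integral>\<^sup>+y. f y \<partial>lborel)"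
    using b by (simp add: ennreal_mult_cancel_left)
  moreover have "f (T x) = indicator (T -` A) x" for x by (simp add: f_def indicator_def)
  moreover have "T -` A \<in> sets borel" using measurable_sets_borel [of T borel A] by simp
  ultimately show ?thesis by (simp add: f_def)
qed

lemma sgn_measurable [measurable]: "sgn \<in> borel_measurable (borel :: 'a::euclidean_space measure)"
  unfolding sgn_div_norm by measurable

lemma space_sphere_measure [simp]: "space sphere_measure = UNIV"
  by (simp add: sphere_measure_def space_scale_measure)

lemma sets_sphere_measure [simp, measurable_cong]: "sets sphere_measure = sets borel"
  by (simp add: sphere_measure_def)

lemma emeasure_sphere_measure:
  fixes A :: "(real ^ 'n::finite) set"
  assumes [measurable]: "A \<in> sets borel"
  shows "emeasure sphere_measure A = of_nat CARD('n) * emeasure lborel (sgn -` A \<inter> (ball 0 1 - {0}))"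
proof -
  have sgn: "sgn \<in> restrict_space lborel (ball 0 1 - {0}) \<rightarrow>\<^sub>M (borel :: (real ^ 'n) measure)"
    by (intro measurable_restrict_space1) measurable
  have "emeasure (distr (restrict_space lborel (ball 0 1 - {0})) borel sgn) A =
      emeasure lborel (sgn -` A \<inter> (ball 0 1 - {0}))"
    by (subst emeasure_distr [OF sgn]) (simp_all add: emeasure_restrict_space space_restrict_space)
  then show ?thesis by (simp add: sphere_measure_def)
qed

lemma finite_sphere_measure: "finite_measure (sphere_measure :: (real ^ 'n::finite) measure)"
proof
  have "emeasure lborel (ball 0 1 - {0} :: (real ^ 'n) set) \<le> emeasure lborel (ball 0 1 :: (real ^ 'n) set)"
    by (rule emeasure_mono) auto
  also have "\<dots> < top" by (simp add: emeasure_ball)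
  finally have "emeasure lborel (ball 0 1 - {0} :: (real ^ 'n) set) \<noteq> top" by (rule less_imp_neq)
  then show "emeasure sphere_measure (space sphere_measure :: (real ^ 'n) set) \<noteq> \<infinity>"
    using emeasure_sphere_measure [of "UNIV :: (real ^ 'n) set"]
    by (simp add: ennreal_mult_eq_top_iff)
qed

lemma AE_sphere_measure: "AE \<omega> in (sphere_measure :: (real ^ 'n::finite) measure). norm \<omega> = 1"
proof (rule AE_I')
  have "sgn -` {\<omega>. norm \<omega> \<noteq> 1} \<inter> (ball 0 1 - {0}) = ({} :: (real ^ 'n) set)"
    by (auto simp: norm_sgn)
  moreover have m: "{\<omega> :: real ^ 'n. norm \<omega> \<noteq> 1} \<in> sets borel" by measurable
  ultimately show "{\<omega> :: real ^ 'n. norm \<omega> \<noteq> 1} \<in> null_sets sphere_measure"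
    by (auto simp: null_sets_def emeasure_sphere_measure)
qed auto

lemma distr_sphere_measure:
  fixes T :: "real ^ 'n::finite \<Rightarrow> real ^ 'n"
  assumes T: "orthogonal_transformation T"
  shows "distr sphere_measure borel T = sphere_measure"
proof (rule measure_eqI)
  have lin: "linear T" using T by (rule orthogonal_transformation_linear)
  have mT [measurable]: "T \<in> borel_measurable borel"
    by (rule borel_measurable_linear_map [OF lin])
  fix A assume "A \<in> sets (distr sphere_measure borel T)"
  then have A [measurable]: "A \<in> sets borel" by simp
  have TA: "T -` A \<in> sets borel" using measurable_sets_borel [OF mT A] by simp
  have B: "sgn -` A \<inter> (ball 0 1 - {0}) \<in> sets borel"
    by (intro sets.Int measurable_sets_borel [OF sgn_measurable A]) auto
  have "sgn (T x) = T (sgn x)" for x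
    by (simp add: sgn_div_norm orthogonal_transformation_norm [OF T] linear_cmul [OF lin])
  moreover have "T x = 0 \<longleftrightarrow> x = 0" for x
    using orthogonal_transformation_norm [OF T, of x] by (metis norm_eq_zero)
  ultimately have eq: "sgn -` (T -` A) \<inter> (ball 0 1 - {0}) = T -` (sgn -` A \<inter> (ball 0 1 - {0}))"
    by (auto simp: orthogonal_transformation_norm [OF T])
  have "emeasure sphere_measure (T -` A) = emeasure sphere_measure A"
    by (simp only: emeasure_sphere_measure [OF A] emeasure_sphere_measure [OF TA] eq emeasure_lborel_isometry [OF T B])
  then show "emeasure (distr sphere_measure borel T) A = emeasure sphere_measure A"
    by (subst emeasure_distr) simp_all
qed simp

section \<open>Moments of the surface measure\<close>

lemma integrable_sphere_measure:
  fixes f :: "real ^ 'n::finite \<Rightarrow> 'b::{banach,second_countable_topology}"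
  assumes f: "continuous_on UNIV f"
  shows "integrable sphere_measure f"
proof -
  interpret finite_measure "sphere_measure :: (real ^ 'n) measure" by (rule finite_sphere_measure)
  have "compact (f ` sphere 0 1)"
    by (rule compact_continuous_image) (use f continuous_on_subset in auto)
  then obtain B where "\<forall>x\<in>f ` sphere 0 1. norm x \<le> B"
    using compact_imp_bounded [of "f ` sphere 0 1"] unfolding bounded_iff by auto
  then have B: "norm (f \<omega>) \<le> B" if "norm \<omega> = 1" for \<omega>
    using that by auto
  show ?thesis
  proof (rule integrable_const_bound)
    show "AE \<omega> in sphere_measure. norm (f \<omega>) \<le> B"
      using AE_sphere_measure by eventually_elim (rule B)
    show "f \<in> borel_measurable sphere_measure"
      using borel_measurable_continuous_onI [OF f] by (simp cong: measurable_cong_sets)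
  qed
qed

text \<open>
  By the binomial theorem the integral is a polynomial in \<open>t\<close>, so no limit has to be interchanged with
  the integral.
\<close>

lemma derivative_integral_power:
  fixes v w :: "real ^ 'n::finite" and g :: "real ^ 'n \<Rightarrow> real"
  assumes g: "continuous_on UNIV g"
  shows "((\<lambda>t. \<integral>\<omega>. ((v + t *\<^sub>R w) \<bullet> \<omega>) ^ Suc n * g \<omega> \<partial>sphere_measure) has_real_derivative
    real (Suc n) * (\<integral>\<omega>. (v \<bullet> \<omega>) ^ n * (w \<bullet> \<omega>) * g \<omega> \<partial>sphere_measure)) (at 0)"
proof -
  define J where "J = (\<lambda>i. real (Suc n choose i) * (\<integral>\<omega>. (w \<bullet> \<omega>) ^ i * (v \<bullet> \<omega>) ^ (Suc n - i) * g \<omega> \<partial>sphere_measure))"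
  have int: "integrable sphere_measure (\<lambda>\<omega>. (w \<bullet> \<omega>) ^ i * (v \<bullet> \<omega>) ^ k * g \<omega>)" for i k
    by (intro integrable_sphere_measure continuous_intros g)
  have "(\<integral>\<omega>. ((v + t *\<^sub>R w) \<bullet> \<omega>) ^ Suc n * g \<omega> \<partial>sphere_measure) = (\<Sum>i\<le>Suc n. t ^ i * J i)" for t
  proof -
    have "((v + t *\<^sub>R w) \<bullet> \<omega>) ^ Suc n * g \<omega> =
        (\<Sum>i\<le>Suc n. (t ^ i * real (Suc n choose i)) * ((w \<bullet> \<omega>) ^ i * (v \<bullet> \<omega>) ^ (Suc n - i) * g \<omega>))" for \<omega>
    proof -
      have "(v + t *\<^sub>R w) \<bullet> \<omega> = t * (w \<bullet> \<omega>) + v \<bullet> \<omega>" by (simp add: inner_add_left)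
      then show ?thesis
        by (simp only: binomial_ring sum_distrib_right power_mult_distrib) (simp only: of_nat_id mult_ac)
    qed
    then have "(\<integral>\<omega>. ((v + t *\<^sub>R w) \<bullet> \<omega>) ^ Suc n * g \<omega> \<partial>sphere_measure) =
        (\<Sum>i\<le>Suc n. \<integral>\<omega>. (t ^ i * real (Suc n choose i)) * ((w \<bullet> \<omega>) ^ i * (v \<bullet> \<omega>) ^ (Suc n - i) * g \<omega>) \<partial>sphere_measure)"
      by (simp only:) (intro Bochner_Integration.integral_sum integrable_mult_right int)
    then show ?thesis by (simp only: integral_mult_right_zero J_def mult.assoc)
  qed
  moreover have "((\<lambda>t. \<Sum>i\<le>Suc n. t ^ i * J i) has_real_derivative (\<Sum>i\<le>Suc n. real i * 0 ^ (i - 1) * J i)) (at 0)"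
    by (auto intro!: derivative_eq_intros sum.cong)
  moreover have "(\<Sum>i\<le>Suc n. real i * 0 ^ (i - 1) * J i) = J 1"
  proof -
    have "(\<Sum>i\<le>Suc n. real i * 0 ^ (i - 1) * J i) = (\<Sum>i\<le>Suc n. if i = 1 then J 1 else 0)"
      by (rule sum.cong) (auto simp: power_0_left)
    then show ?thesis by simp
  qed
  moreover have "J 1 = real (Suc n) * (\<integral>\<omega>. (v \<bullet> \<omega>) ^ n * (w \<bullet> \<omega>) * g \<omega> \<partial>sphere_measure)"
    by (simp add: J_def mult.commute)
  ultimately show ?thesis by simp
qed

text \<open>
  The direction is arbitrary, by \<open>even_moment\<close>.
\<close>

definition sphere_moment :: "'n::finite itself \<Rightarrow> nat \<Rightarrow> real" where
  "sphere_moment _ k = (\<integral>\<omega>. (axis undefined 1 \<bullet> \<omega>) ^ (2 * k) \<partial>(sphere_measure :: (real ^ 'n) measure))"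

text \<open>
  A rotation takes the fixed direction to that of \<open>v\<close>.
\<close>

lemma even_moment:
  fixes v :: "real ^ 'n::finite"
  shows "(\<integral>\<omega>. (v \<bullet> \<omega>) ^ (2 * k) \<partial>sphere_measure) = sphere_moment TYPE('n) k * (norm v ^ 2) ^ k"
proof -
  define e :: "real ^ 'n" where "e = axis undefined 1"
  obtain T where T: "orthogonal_transformation T" and Te: "T (norm v *\<^sub>R e) = v"
    by (rule orthogonal_transformation_exists [of "norm v *\<^sub>R e" v]) (simp add: e_def)
  have mT [measurable]: "T \<in> borel_measurable borel"
    by (rule borel_measurable_linear_map [OF orthogonal_transformation_linear [OF T]])
  have "(\<integral>\<omega>. (v \<bullet> \<omega>) ^ (2 * k) \<partial>sphere_measure) = (\<integral>\<omega>. (v \<bullet> \<omega>) ^ (2 * k) \<partial>(distr sphere_measure borel T))"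
    by (simp add: distr_sphere_measure [OF T])
  also have "\<dots> = (\<integral>\<omega>. (v \<bullet> T \<omega>) ^ (2 * k) \<partial>sphere_measure)"
    by (rule integral_distr) measurable
  also have "\<dots> = (\<integral>\<omega>. (norm v * (e \<bullet> \<omega>)) ^ (2 * k) \<partial>sphere_measure)"
  proof -
    have "T (norm v *\<^sub>R e) \<bullet> T \<omega> = (norm v *\<^sub>R e) \<bullet> \<omega>" for \<omega>
      using T by (simp add: orthogonal_transformation_def)
    then show ?thesis by (simp add: Te)
  qed
  finally have "(\<integral>\<omega>. (v \<bullet> \<omega>) ^ (2 * k) \<partial>sphere_measure) = (\<integral>\<omega>. (norm v * (e \<bullet> \<omega>)) ^ (2 * k) \<partial>sphere_measure)" .
  have "(norm v * (e \<bullet> \<omega>)) ^ (2 * k) = ((norm v)\<^sup>2) ^ k * (e \<bullet> \<omega>) ^ (2 * k)" for \<omega>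
    by (simp only: power_mult_distrib power_mult [of "norm v"])
  then have "(\<integral>\<omega>. (norm v * (e \<bullet> \<omega>)) ^ (2 * k) \<partial>sphere_measure) =
      sphere_moment TYPE('n) k * ((norm v)\<^sup>2) ^ k"
    by (simp only: integral_mult_right_zero sphere_moment_def e_def mult.commute)
  with \<open>(\<integral>\<omega>. (v \<bullet> \<omega>) ^ (2 * k) \<partial>sphere_measure) = (\<integral>\<omega>. (norm v * (e \<bullet> \<omega>)) ^ (2 * k) \<partial>sphere_measure)\<close>
  show ?thesis by simp
qed

text \<open>
  Differentiate \<open>even_moment\<close> for \<open>k + 1\<close> at \<open>v\<close> in the direction \<open>w\<close> and divide by \<open>2 (k + 1)\<close>.
\<close>

lemma odd_moment:
  fixes v w :: "real ^ 'n::finite"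
  shows "(\<integral>\<omega>. (v \<bullet> \<omega>) ^ (2 * k + 1) * (w \<bullet> \<omega>) \<partial>sphere_measure) =
    sphere_moment TYPE('n) (Suc k) * ((norm v ^ 2) ^ k * (v \<bullet> w))"
proof -
  have n2: "(norm (v + t *\<^sub>R w))\<^sup>2 = (norm v)\<^sup>2 + 2 * t * (v \<bullet> w) + t\<^sup>2 * (norm w)\<^sup>2" for t
    unfolding power2_norm_eq_inner
    by (simp add: inner_simps inner_commute power2_eq_square algebra_simps)
  have "((\<lambda>t. \<integral>\<omega>. ((v + t *\<^sub>R w) \<bullet> \<omega>) ^ Suc (2 * k + 1) * 1 \<partial>sphere_measure) has_real_derivative
      real (Suc (2 * k + 1)) * (\<integral>\<omega>. (v \<bullet> \<omega>) ^ (2 * k + 1) * (w \<bullet> \<omega>) * 1 \<partial>sphere_measure)) (at 0)"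
    by (rule derivative_integral_power) simp
  moreover have "(\<integral>\<omega>. ((v + t *\<^sub>R w) \<bullet> \<omega>) ^ Suc (2 * k + 1) * 1 \<partial>sphere_measure) =
      sphere_moment TYPE('n) (Suc k) * ((norm v)\<^sup>2 + 2 * t * (v \<bullet> w) + t\<^sup>2 * (norm w)\<^sup>2) ^ Suc k" for t
    using even_moment [of "v + t *\<^sub>R w" "Suc k"] by (simp add: n2)
  moreover have "((\<lambda>t. sphere_moment TYPE('n) (Suc k) * ((norm v)\<^sup>2 + 2 * t * (v \<bullet> w) + t\<^sup>2 * (norm w)\<^sup>2) ^ Suc k)
      has_real_derivative sphere_moment TYPE('n) (Suc k) * (real (Suc k) * ((norm v)\<^sup>2) ^ k * (2 * (v \<bullet> w)))) (at 0)"
    by (auto intro!: derivative_eq_intros simp del: power_Suc)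
  ultimately have "real (Suc (2 * k + 1)) * (\<integral>\<omega>. (v \<bullet> \<omega>) ^ (2 * k + 1) * (w \<bullet> \<omega>) * 1 \<partial>sphere_measure) =
      sphere_moment TYPE('n) (Suc k) * (real (Suc k) * ((norm v)\<^sup>2) ^ k * (2 * (v \<bullet> w)))"
    using DERIV_unique by (simp only:) 
  then have "(2 * real (Suc k)) * (\<integral>\<omega>. (v \<bullet> \<omega>) ^ (2 * k + 1) * (w \<bullet> \<omega>) \<partial>sphere_measure) =
      (2 * real (Suc k)) * (sphere_moment TYPE('n) (Suc k) * ((norm v ^ 2) ^ k * (v \<bullet> w)))"
    by (simp add: algebra_simps)
  then show ?thesis by (simp del: of_nat_Suc)
qed

text \<open>
  Differentiate \<open>odd_moment\<close>, with \<open>w\<close> a coordinate vector, once more in the direction \<open>w\<close> and sum over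
  the coordinates.  On the left the squares of the coordinates of \<open>\<omega>\<close> add up to \<open>1\<close>; on the right one
  obtains the divergence of \<open>\<bar>v\<bar> ^ (2 k) v\<close>, which is \<open>2 k + m\<close> for a unit vector.
\<close>

lemma sphere_moment_rec:
  "real (2 * k + 1) * sphere_moment TYPE('n::finite) k = real (2 * k + CARD('n)) * sphere_moment TYPE('n) (Suc k)"
proof -
  define v :: "real ^ 'n" where "v = axis undefined 1"
  have v1: "norm v = 1" by (simp add: v_def)
  have "real (2 * k + 1) * (\<integral>\<omega>. (v \<bullet> \<omega>) ^ (2 * k) * (axis j 1 \<bullet> \<omega>) * (axis j 1 \<bullet> \<omega>) \<partial>sphere_measure) =
      sphere_moment TYPE('n) (Suc k) * (real k * (2 * (v $ j) * (v $ j)) + 1)" for j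
  proof -
    have n2: "(norm (v + t *\<^sub>R axis j 1))\<^sup>2 = 1 + 2 * t * v $ j + t\<^sup>2" for t
      using v1 by (simp add: power2_norm_eq_inner inner_simps inner_commute inner_axis_axis norm_eq_1)
        (simp add: inner_axis algebra_simps power2_eq_square)
    have "((\<lambda>t. \<integral>\<omega>. ((v + t *\<^sub>R axis j 1) \<bullet> \<omega>) ^ Suc (2 * k) * (axis j 1 \<bullet> \<omega>) \<partial>sphere_measure) has_real_derivative
        real (Suc (2 * k)) * (\<integral>\<omega>. (v \<bullet> \<omega>) ^ (2 * k) * (axis j 1 \<bullet> \<omega>) * (axis j 1 \<bullet> \<omega>) \<partial>sphere_measure)) (at 0)"
      by (rule derivative_integral_power) (intro continuous_intros)
    moreover have "(\<integral>\<omega>. ((v + t *\<^sub>R axis j 1) \<bullet> \<omega>) ^ Suc (2 * k) * (axis j 1 \<bullet> \<omega>) \<partial>sphere_measure) =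
        sphere_moment TYPE('n) (Suc k) * ((1 + 2 * t * v $ j + t\<^sup>2) ^ k * (v $ j + t))" for t
      using odd_moment [of "v + t *\<^sub>R axis j 1" k "axis j 1"]
      by (simp add: n2 inner_add_left inner_axis inner_axis_axis)
    moreover have "((\<lambda>t. sphere_moment TYPE('n) (Suc k) * ((1 + 2 * t * v $ j + t\<^sup>2) ^ k * (v $ j + t))) has_real_derivative
        sphere_moment TYPE('n) (Suc k) * (real k * (2 * (v $ j) * (v $ j)) + 1)) (at 0)"
      by (auto intro!: derivative_eq_intros simp: algebra_simps)
    ultimately show ?thesis
      using DERIV_unique by simp
  qed
  then have "(\<Sum>j\<in>UNIV. real (2 * k + 1) * (\<integral>\<omega>. (v \<bullet> \<omega>) ^ (2 * k) * (axis j 1 \<bullet> \<omega>) * (axis j 1 \<bullet> \<omega>) \<partial>sphere_measure)) =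
      (\<Sum>j\<in>UNIV. sphere_moment TYPE('n) (Suc k) * (real k * (2 * (v $ j) * (v $ j)) + 1))"
    by (rule sum.cong [OF refl])
  also have "\<dots> = sphere_moment TYPE('n) (Suc k) * (2 * real k * (\<Sum>j\<in>UNIV. v $ j * v $ j) + real CARD('n))"
    by (simp add: sum_distrib_left [symmetric] sum.distrib mult.assoc)
  also have "(\<Sum>j\<in>UNIV. v $ j * v $ j) = 1"
    using v1 by (simp add: norm_eq_1 inner_vec_def)
  also have "(\<Sum>j\<in>UNIV. real (2 * k + 1) * (\<integral>\<omega>. (v \<bullet> \<omega>) ^ (2 * k) * (axis j 1 \<bullet> \<omega>) * (axis j 1 \<bullet> \<omega>) \<partial>sphere_measure)) =
      real (2 * k + 1) * (\<integral>\<omega>. (\<Sum>j\<in>UNIV. (v \<bullet> \<omega>) ^ (2 * k) * (axis j 1 \<bullet> \<omega>) * (axis j 1 \<bullet> \<omega>)) \<partial>sphere_measure)"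
    by (subst Bochner_Integration.integral_sum)
      (auto simp: sum_distrib_left intro!: integrable_sphere_measure continuous_intros)
  also have "(\<integral>\<omega>. (\<Sum>j\<in>UNIV. (v \<bullet> \<omega>) ^ (2 * k) * (axis j 1 \<bullet> \<omega>) * (axis j 1 \<bullet> \<omega>)) \<partial>sphere_measure) =
      (\<integral>\<omega>. (v \<bullet> \<omega>) ^ (2 * k) \<partial>sphere_measure)"
  proof (rule integral_cong_AE)
    show "AE \<omega> in sphere_measure. (\<Sum>j\<in>UNIV. (v \<bullet> \<omega>) ^ (2 * k) * (axis j 1 \<bullet> \<omega>) * (axis j 1 \<bullet> \<omega>)) = (v \<bullet> \<omega>) ^ (2 * k)"
      using AE_sphere_measure
    proof eventually_elim
      fix \<omega> :: "(real, 'n) vec" assume \<omega>: "norm \<omega> = 1"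
      have "(\<Sum>j\<in>UNIV. (v \<bullet> \<omega>) ^ (2 * k) * (axis j 1 \<bullet> \<omega>) * (axis j 1 \<bullet> \<omega>)) = (v \<bullet> \<omega>) ^ (2 * k) * (\<omega> \<bullet> \<omega>)"
        by (simp add: inner_vec_def [of \<omega> \<omega>] inner_axis' sum_distrib_left mult.assoc)
      then show "(\<Sum>j\<in>UNIV. (v \<bullet> \<omega>) ^ (2 * k) * (axis j 1 \<bullet> \<omega>) * (axis j 1 \<bullet> \<omega>)) = (v \<bullet> \<omega>) ^ (2 * k)"
        using \<omega> by (simp add: norm_eq_1)
    qed
  qed measurable
  also have "(\<integral>\<omega>. (v \<bullet> \<omega>) ^ (2 * k) \<partial>sphere_measure) = sphere_moment TYPE('n) k"
    using even_moment [of v k] by (simp add: v1)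
  finally show ?thesis by (simp add: mult.commute)
qed

lemma sphere_moment_eq:
  "sphere_moment TYPE('n::finite) k = sphere_area CARD('n) * ck_weight CARD('n) (2 * k)"
proof (induction k)
  case 0
  then show ?case
    using measure_sphere_measure [where 'n = 'n] by (simp add: sphere_moment_def ck_weight_def)
next
  case (Suc k)
  have "0 < real (2 * k + CARD('n))" using one_le_card [where 'n = 'n] by linarith
  then have "sphere_moment TYPE('n) (Suc k) = real (2 * k + 1) / real (2 * k + CARD('n)) * sphere_moment TYPE('n) k"
    using sphere_moment_rec [of k, where 'n = 'n] by (simp add: field_simps)
  moreover have "real (2 * k + 1) / real (2 * k + CARD('n)) * ck_weight CARD('n) (2 * k) = ck_weight CARD('n) (2 * Suc k)"
  proof -
    define c where "c = 2 * (real k + 1)"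
    have "c \<noteq> 0" by (simp add: c_def)
    have f: "(fact (2 * Suc k) :: real) = c * (real (2 * k + 1) * fact (2 * k))"
      by (simp add: c_def algebra_simps)
    have d: "dirac_fact CARD('n) (2 * Suc k) = c * (real (2 * k + CARD('n)) * dirac_fact CARD('n) (2 * k))"
      by (simp add: dirac_factor_def c_def)
    show ?thesis unfolding ck_weight_def f d using \<open>c \<noteq> 0\<close> by simp
  qed
  ultimately show ?case unfolding Suc by (simp only: mult_ac)
qed

lemma ck_weight_odd: "ck_weight m (2 * k + 1) = ck_weight m (2 * Suc k)"
proof -
  define c where "c = 2 * (real k + 1)"
  have "c \<noteq> 0" by (simp add: c_def)
  have f: "(fact (2 * Suc k) :: real) = c * fact (2 * k + 1)"
    by (simp add: c_def algebra_simps)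
  have d: "dirac_fact m (2 * Suc k) = c * dirac_fact m (2 * k + 1)"
    by (simp add: dirac_factor_def c_def)
  show ?thesis unfolding ck_weight_def f d using \<open>c \<noteq> 0\<close> by simp
qed

section \<open>The dual Radon transform of a slice extension\<close>

lemma continuous_on_vecpart_power:
  fixes v :: "(real, 'n::{finite,linorder}) vec"
  shows "continuous_on UNIV (\<lambda>\<omega>. vecpart ((v \<bullet> \<omega>) *\<^sub>R \<omega>) ^ j * u)"
proof (induction j)
  case (Suc j)
  have "continuous_on UNIV (\<lambda>\<omega>. vecpart ((v \<bullet> \<omega>) *\<^sub>R \<omega>))"
    by (intro bounded_linear.continuous_on [OF bounded_linear_vecpart] continuous_intros)
  from bounded_bilinear.continuous_on [OF bounded_bilinear_times_cliff this Suc]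
  show ?case by (simp add: mult.assoc)
qed simp

text \<open>
  On the sphere \<open>(<v, \<omega>> \<omega>) ^ j\<close> equals \<open><v, \<omega>> ^ j\<close> times \<open>1\<close> or \<open>\<omega>\<close> up to sign, according to the
  parity of \<open>j\<close>; so the even and the odd moments apply.
\<close>

lemma integral_vecpart_power:
  fixes v :: "(real, 'n::{finite,linorder}) vec"
  shows "(\<integral>\<omega>. vecpart ((v \<bullet> \<omega>) *\<^sub>R \<omega>) ^ j * u \<partial>sphere_measure) =
    (sphere_area CARD('n) * ck_weight CARD('n) j) *\<^sub>R (vecpart v ^ j * u)"
proof (cases "even j")
  case True
  then obtain k where j: "j = 2 * k" by blast
  have "(\<integral>\<omega>. vecpart ((v \<bullet> \<omega>) *\<^sub>R \<omega>) ^ j * u \<partial>sphere_measure) =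
      (\<integral>\<omega>. (v \<bullet> \<omega>) ^ (2 * k) *\<^sub>R ((-1) ^ k *\<^sub>R u) \<partial>sphere_measure)"
  proof (rule integral_cong_AE)
    show "AE \<omega> in sphere_measure. vecpart ((v \<bullet> \<omega>) *\<^sub>R \<omega>) ^ j * u = (v \<bullet> \<omega>) ^ (2 * k) *\<^sub>R ((-1) ^ k *\<^sub>R u)"
      using AE_sphere_measure
    proof eventually_elim
      fix \<omega> :: "(real, 'n) vec" assume "norm \<omega> = 1"
      then show "vecpart ((v \<bullet> \<omega>) *\<^sub>R \<omega>) ^ j * u = (v \<bullet> \<omega>) ^ (2 * k) *\<^sub>R ((-1) ^ k *\<^sub>R u)"
        using vecpart_even_odd(1) [of "(v \<bullet> \<omega>) *\<^sub>R \<omega>" k "\<lambda>_. u"]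
        by (simp add: j power_mult)
    qed
    show "(\<lambda>\<omega>. vecpart ((v \<bullet> \<omega>) *\<^sub>R \<omega>) ^ j * u) \<in> borel_measurable sphere_measure"
      using borel_measurable_continuous_onI [OF continuous_on_vecpart_power] by (simp cong: measurable_cong_sets)
  qed measurable
  also have "\<dots> = (\<integral>\<omega>. (v \<bullet> \<omega>) ^ (2 * k) \<partial>sphere_measure) *\<^sub>R ((-1) ^ k *\<^sub>R u)"
    by (intro integral_scaleR_left integrable_sphere_measure continuous_intros)
  also have "\<dots> = (sphere_area CARD('n) * ck_weight CARD('n) j) *\<^sub>R (vecpart v ^ j * u)"
    using vecpart_even_odd(1) [of v k "\<lambda>_. u"] by (simp add: even_moment sphere_moment_eq j)
  finally show ?thesis .
next
  case False
  then obtain k where j: "j = 2 * k + 1" by (blast elim: oddE)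
  have "(\<integral>\<omega>. vecpart ((v \<bullet> \<omega>) *\<^sub>R \<omega>) ^ j * u \<partial>sphere_measure) =
      (\<integral>\<omega>. (\<Sum>i\<in>UNIV. ((v \<bullet> \<omega>) ^ (2 * k + 1) * (axis i 1 \<bullet> \<omega>)) *\<^sub>R ((-1) ^ k *\<^sub>R (gen i * u))) \<partial>sphere_measure)"
  proof (rule integral_cong_AE)
    show "AE \<omega> in sphere_measure. vecpart ((v \<bullet> \<omega>) *\<^sub>R \<omega>) ^ j * u =
        (\<Sum>i\<in>UNIV. ((v \<bullet> \<omega>) ^ (2 * k + 1) * (axis i 1 \<bullet> \<omega>)) *\<^sub>R ((-1) ^ k *\<^sub>R (gen i * u)))"
      using AE_sphere_measure
    proof eventually_elim
      fix \<omega> :: "(real, 'n) vec" assume "norm \<omega> = 1"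
      then have nn: "(norm ((v \<bullet> \<omega>) *\<^sub>R \<omega>))\<^sup>2 ^ k = (v \<bullet> \<omega>) ^ (2 * k)"
        by (simp add: power_mult)
      have "vecpart ((v \<bullet> \<omega>) *\<^sub>R \<omega>) ^ j * u = (v \<bullet> \<omega>) ^ (2 * k + 1) *\<^sub>R (vecpart \<omega> * ((-1) ^ k *\<^sub>R u))"
        using vecpart_even_odd(2) [of "(v \<bullet> \<omega>) *\<^sub>R \<omega>" k "\<lambda>_. u"]
        unfolding j nn by (simp add: vecpart_scaleR mult_ac)
      also have "vecpart \<omega> * ((-1) ^ k *\<^sub>R u) = (\<Sum>i\<in>UNIV. (axis i 1 \<bullet> \<omega>) *\<^sub>R ((-1) ^ k *\<^sub>R (gen i * u)))"
        by (simp add: vecpart_def sum_distrib_right inner_axis' mult.commute scaleR_sum_right)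
      finally show "vecpart ((v \<bullet> \<omega>) *\<^sub>R \<omega>) ^ j * u =
          (\<Sum>i\<in>UNIV. ((v \<bullet> \<omega>) ^ (2 * k + 1) * (axis i 1 \<bullet> \<omega>)) *\<^sub>R ((-1) ^ k *\<^sub>R (gen i * u)))"
        by (simp add: scaleR_sum_right mult_ac)
    qed
    show "(\<lambda>\<omega>. vecpart ((v \<bullet> \<omega>) *\<^sub>R \<omega>) ^ j * u) \<in> borel_measurable sphere_measure"
      using borel_measurable_continuous_onI [OF continuous_on_vecpart_power] by (simp cong: measurable_cong_sets)
  qed measurable
  also have "\<dots> = (\<Sum>i\<in>UNIV. (\<integral>\<omega>. (v \<bullet> \<omega>) ^ (2 * k + 1) * (axis i 1 \<bullet> \<omega>) \<partial>sphere_measure) *\<^sub>R ((-1) ^ k *\<^sub>R (gen i * u)))"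
    by (subst Bochner_Integration.integral_sum)
      (auto intro!: integrable_sphere_measure continuous_intros sum.cong integral_scaleR_left simp del: scaleR_scaleR)
  also have "\<dots> = (sphere_area CARD('n) * ck_weight CARD('n) j) *\<^sub>R (\<Sum>i\<in>UNIV. (v $ i) *\<^sub>R (((norm v)\<^sup>2) ^ k *\<^sub>R (-1) ^ k *\<^sub>R (gen i * u)))"
    unfolding odd_moment sphere_moment_eq j ck_weight_odd
    by (simp add: scaleR_sum_right inner_axis mult_ac)
  also have "(\<Sum>i\<in>UNIV. (v $ i) *\<^sub>R (((norm v)\<^sup>2) ^ k *\<^sub>R (-1) ^ k *\<^sub>R (gen i * u))) = vecpart v ^ j * u"
  proof -
    have "(\<Sum>i\<in>UNIV. (v $ i) *\<^sub>R (((norm v)\<^sup>2) ^ k *\<^sub>R (-1) ^ k *\<^sub>R (gen i * u))) =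
        ((norm v)\<^sup>2) ^ k *\<^sub>R (-1) ^ k *\<^sub>R (vecpart v * u)"
      by (simp add: vecpart_def sum_distrib_right scaleR_sum_right mult_ac)
    also have "\<dots> = vecpart v ^ j * u"
      using vecpart_even_odd(2) [of v k "\<lambda>_. u"] unfolding j by simp
    finally show ?thesis .
  qed
  finally show ?thesis .
qed

lemma sphere_area_pos: "1 \<le> m \<Longrightarrow> 0 < sphere_area m"
  unfolding sphere_area_def by (intro divide_pos_pos mult_pos_pos Gamma_real_pos) simp_all

text \<open>
  Integration term by term multiplies the \<open>j\<close>-th term of the slice extension by \<open>ck_weight\<close>, that is,
  it replaces \<open>j!\<close> by \<open>dirac_fact\<close>.
\<close>

lemma dual_radon_slice_ext:
  fixes a :: "nat \<Rightarrow> 'n::{finite,linorder} cliff"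
  assumes a: "entire_coeffs a"
  shows "dual_radon (slice_ext (pseries a)) = ck_series a"
proof
  fix x :: "'n para"
  obtain s v where x: "x = (s, v)" by (cases x)
  define d where "d = (\<lambda>j. nderiv j (pseries a) s /\<^sub>R fact j)"
  have d: "entire_coeffs d" unfolding d_def by (rule pseries_recenter [OF a])
  define T where "T = (\<lambda>j \<omega>. vecpart ((v \<bullet> \<omega>) *\<^sub>R \<omega>) ^ j * d j)"
  define \<rho> where "\<rho> = real CARD('n) * norm v"
  have int: "integrable sphere_measure (T j)" for j
    unfolding T_def by (intro integrable_sphere_measure continuous_on_vecpart_power)
  have bound: "norm (T j \<omega>) \<le> \<rho> ^ j * cnorm1 (d j)" if "norm \<omega> = 1" for j \<omega>
  proof -
    have "cnorm1 (vecpart ((v \<bullet> \<omega>) *\<^sub>R \<omega>)) \<le> real CARD('n) * norm ((v \<bullet> \<omega>) *\<^sub>R \<omega>)"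
      by (rule cnorm1_vecpart)
    also have "\<dots> \<le> \<rho>"
      unfolding \<rho>_def using Cauchy_Schwarz_ineq2 [of v \<omega>] that by (intro mult_left_mono) simp_all
    finally have "cnorm1 (vecpart ((v \<bullet> \<omega>) *\<^sub>R \<omega>)) ^ j \<le> \<rho> ^ j" by (rule power_mono) simp
    then have "cnorm1 (vecpart ((v \<bullet> \<omega>) *\<^sub>R \<omega>) ^ j) \<le> \<rho> ^ j"
      by (rule order_trans [OF cnorm1_power])
    then have "cnorm1 (vecpart ((v \<bullet> \<omega>) *\<^sub>R \<omega>) ^ j) * cnorm1 (d j) \<le> \<rho> ^ j * cnorm1 (d j)"
      by (rule mult_right_mono) simp
    then show ?thesis
      unfolding T_def by (rule order_trans [OF order_trans [OF norm_le_cnorm1 cnorm1_times]])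
  qed
  have sm: "summable (\<lambda>j. \<rho> ^ j * cnorm1 (d j))"
    by (rule entire_coeffs_cnorm1 [OF d]) (simp add: \<rho>_def)
  have "(\<lambda>j. integral\<^sup>L sphere_measure (T j)) sums (\<integral>\<omega>. (\<Sum>j. T j \<omega>) \<partial>sphere_measure)"
  proof (rule sums_integral [OF int])
    show "AE \<omega> in sphere_measure. summable (\<lambda>j. norm (T j \<omega>))"
      using AE_sphere_measure
      by eventually_elim (rule summable_comparison_test' [OF sm], simp add: bound)
    show "summable (\<lambda>j. \<integral>\<omega>. norm (T j \<omega>) \<partial>sphere_measure)"
    proof (rule summable_comparison_test')
      interpret finite_measure "sphere_measure :: (real, 'n) vec measure" by (rule finite_sphere_measure)
      show "summable (\<lambda>j. sphere_area CARD('n) * (\<rho> ^ j * cnorm1 (d j)))"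
        by (intro summable_mult sm)
      fix j
      have "(\<integral>\<omega>. norm (T j \<omega>) \<partial>sphere_measure) \<le> (\<integral>\<omega>. \<rho> ^ j * cnorm1 (d j) \<partial>(sphere_measure :: (real, 'n) vec measure))"
      proof (rule integral_mono_AE)
        show "AE \<omega> in sphere_measure. norm (T j \<omega>) \<le> \<rho> ^ j * cnorm1 (d j)"
          using AE_sphere_measure by eventually_elim (rule bound)
      qed (use int in auto)
      then show "norm (\<integral>\<omega>. norm (T j \<omega>) \<partial>sphere_measure) \<le> sphere_area CARD('n) * (\<rho> ^ j * cnorm1 (d j))"
        using measure_sphere_measure [where 'n = 'n] by simp
    qed
  qed
  moreover have "(\<Sum>j. T j \<omega>) = slice_ext (pseries a) (s, (v \<bullet> \<omega>) *\<^sub>R \<omega>)" for \<omega>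
    by (simp add: slice_ext_def T_def d_def)
  ultimately have "(\<lambda>j. integral\<^sup>L sphere_measure (T j)) sums (\<integral>\<omega>. slice_ext (pseries a) (s, (v \<bullet> \<omega>) *\<^sub>R \<omega>) \<partial>sphere_measure)"
    by simp
  from sums_scaleR_right [OF this, of "1 / sphere_area CARD('n)"]
  have "(\<lambda>j. (1 / sphere_area CARD('n)) *\<^sub>R integral\<^sup>L sphere_measure (T j)) sums dual_radon (slice_ext (pseries a)) x"
    by (simp add: dual_radon_def x)
  moreover have "(1 / sphere_area CARD('n)) *\<^sub>R integral\<^sup>L sphere_measure (T j) =
      vecpart v ^ j * (nderiv j (pseries a) s /\<^sub>R dirac_fact CARD('n) j)" for j
  proof -
    have "sphere_area CARD('n) \<noteq> 0" using sphere_area_pos [OF one_le_card [where 'n = 'n]] by simp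
    then show ?thesis
      unfolding T_def integral_vecpart_power by (simp add: d_def ck_weight_def divide_inverse)
  qed
  ultimately have "(\<lambda>j. vecpart v ^ j * (nderiv j (pseries a) s /\<^sub>R dirac_fact CARD('n) j)) sums dual_radon (slice_ext (pseries a)) x"
    by simp
  then show "dual_radon (slice_ext (pseries a)) x = ck_series a x"
    using sums_unique2 ck_series_vecpart_sums [OF a, of v s] by (simp add: x)
qed

section \<open>Coherent state transforms\<close>

lemma square_integrable_cliff:
  fixes f :: "real \<Rightarrow> 'n::finite cliff"
  assumes f: "f \<in> tensor_cliff L2"
  shows "square_integrable f"
proof -
  have meas: "(\<lambda>t. coef (f t) A) \<in> borel_measurable lborel" and int: "integrable lborel (\<lambda>t. (cmod (coef (f t) A))\<^sup>2)" for A
    using f by (simp_all add: tensor_cliff_def L2_def)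
  have "(\<lambda>t. f t \<bullet> b) \<in> borel_measurable lborel" if "b \<in> Basis" for b
  proof -
    have "f t \<bullet> b = (\<Sum>A\<in>UNIV. coef (f t) A \<bullet> coef b A)" for t
      by transfer (simp add: inner_vec_def)
    then show ?thesis using meas by (simp add: borel_measurable_sum borel_measurable_inner)
  qed
  then have [measurable]: "f \<in> borel_measurable lborel"
    by (subst borel_measurable_euclidean_space) auto
  have "(norm (f t))\<^sup>2 = (\<Sum>A\<in>UNIV. (cmod (coef (f t) A))\<^sup>2)" for t
    by transfer (simp add: norm_vec_def L2_set_def sum_nonneg)
  then show ?thesis
    using int by (simp add: square_integrable_def)
qed

lemma square_integrable_coef: "f \<in> tensor_cliff L2 \<Longrightarrow> square_integrable (\<lambda>t. coef (f t) A)"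
  by (simp add: tensor_cliff_def L2_def square_integrable_def)

lemma coef_heat_coeff:
  fixes f :: "real \<Rightarrow> 'n::finite cliff"
  assumes f: "f \<in> tensor_cliff L2"
  shows "coef (heat_coeff f n) A = heat_coeff (\<lambda>t. coef (f t) A) n"
proof -
  have "coef (\<integral>y. gauss_deriv n y *\<^sub>R f y \<partial>lborel) A = (\<integral>y. coef (gauss_deriv n y *\<^sub>R f y) A \<partial>lborel)"
    by (rule integral_bounded_linear [OF bounded_linear_coef integrable_gauss_deriv_times [OF square_integrable_cliff [OF f]], symmetric])
  then show ?thesis by (simp add: heat_coeff_def)
qed

text \<open>
  Both functions are determined by their Taylor coefficients at \<open>0\<close>, which only involve integrals
  against the functions \<open>gauss_deriv n\<close>.
\<close>

lemma heat_weak_deriv: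
  fixes f g :: "real \<Rightarrow> 'n::{finite,linorder} cliff"
  assumes f: "f \<in> tensor_cliff L2" and g: "g \<in> tensor_cliff L2" and w: "weak_deriv_cliff k f g"
  shows "heat g = nderiv k (heat f)"
proof -
  have ef: "entire_coeffs (heat_coeff f)" by (rule heat_eq_pseries [OF square_integrable_cliff [OF f]])
  have "heat_coeff g = (\<lambda>n. (fact (n + k) / fact n) *\<^sub>R heat_coeff f (n + k))"
  proof (intro ext cliff_eqI)
    fix n A
    have "(\<integral>y. gauss_deriv n y *\<^sub>R coef (g y) A \<partial>lborel) = (\<integral>y. gauss_deriv (n + k) y *\<^sub>R coef (f y) A \<partial>lborel)"
      using w by (intro weak_deriv_gauss square_integrable_coef f g) (simp add: weak_deriv_cliff_def)
    then show "coef (heat_coeff g n) A = coef ((fact (n + k) / fact n) *\<^sub>R heat_coeff f (n + k)) A"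
      by (simp add: coef_heat_coeff f g) (simp add: heat_coeff_def)
  qed
  then show ?thesis
    by (simp only: heat_eq_pseries [OF square_integrable_cliff [OF f]]
        heat_eq_pseries [OF square_integrable_cliff [OF g]] nderiv_pseries [OF ef])
qed

lemma sobolev_subset_L2: "tensor_cliff (sobolev k) \<subseteq> tensor_cliff L2"
  by (auto simp: tensor_cliff_def sobolev_def)

theorem theorem6p7:
  shows "(\<forall>f :: real \<Rightarrow> 'n::{finite,linorder} cliff. f \<in> tensor_cliff L2 \<longrightarrow>
            tau (slice_ext (heat f)) =
              (\<lambda>x. gamma_const CARD('n) *\<^sub>C GCK (nderiv (CARD('n) - 1) (heat f)) x))
       \<and> (\<forall>f g :: real \<Rightarrow> 'n cliff.
            f \<in> tensor_cliff (sobolev (CARD('n) - 1)) \<longrightarrow>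
            g \<in> tensor_cliff L2 \<longrightarrow> weak_deriv_cliff (CARD('n) - 1) f g \<longrightarrow>
            tau (slice_ext (heat f)) = (\<lambda>x. gamma_const CARD('n) *\<^sub>C U_a g x) \<and>
            tau (slice_ext (heat f)) = (\<lambda>x. gamma_const CARD('n) *\<^sub>C dual_radon (U_s g) x))"
proof -
  have 1: "tau (slice_ext (heat f)) = (\<lambda>x. gamma_const CARD('n) *\<^sub>C GCK (nderiv (CARD('n) - 1) (heat f)) x)"
    if "f \<in> tensor_cliff L2" for f :: "real \<Rightarrow> 'n cliff"
    using heat_eq_pseries [OF square_integrable_cliff [OF that]] by (auto simp: tau_slice_ext)
  have 2: "dual_radon (U_s g) = U_a g" if "g \<in> tensor_cliff L2" for g :: "real \<Rightarrow> 'n cliff"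
    using heat_eq_pseries [OF square_integrable_cliff [OF that]]
    by (simp add: U_s_def U_a_def dual_radon_slice_ext GCK_pseries)
  have 3: "tau (slice_ext (heat f)) = (\<lambda>x. gamma_const CARD('n) *\<^sub>C U_a g x)"
    if "f \<in> tensor_cliff (sobolev (CARD('n) - 1))" "g \<in> tensor_cliff L2" "weak_deriv_cliff (CARD('n) - 1) f g"
    for f g :: "real \<Rightarrow> 'n cliff"
  proof -
    have f: "f \<in> tensor_cliff L2" using that(1) sobolev_subset_L2 by blast
    show ?thesis
      using 1 [OF f] heat_weak_deriv [OF f that(2,3)] by (simp add: U_a_def)
  qed
  show ?thesis using 1 2 3 by auto
qed

end
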